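(* Let $B=(B_t)_{t\in[0,1]}$ be a fractional Brownian motion with Hurst index $H$. Then: 1. If $h:\mathbb{R}\to\mathbb{R}$ verifies $(\mathbf{H}_4)$ and if $H\in(0,1/4)$, then, as $n\to\infty$, $$n^{2H-1}\sum_{k=0}^{n-1} h(B_{k/n})\left[n^{2H}(\Delta B_{k/n})^2-1\right]\ \longrightarrow\ \frac14\int_0^1 h''(B_u)\,du\quad\text{in } L^2.$$ 2. If $h:\mathbb{R}\to\mathbb{R}$ verifies $(\mathbf{H}_6)$ and if $H\in(0,1/6)$, then, as $n\to\infty$, $$n^{3H-1}\sum_{k=0}^{n-1}\left[h(B_{k/n})\,n^{3H}(\Delta B_{k/n})^3+\frac32\,h'(B_{k/n})\,n^{-H}\right]\ \longrightarrow\ -\frac18\int_0^1 h'''(B_u)\,du\quad\text{in } L^2.$$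
   Context: A fractional Brownian motion $B=(B_t)_{t\in[0,1]}$ with Hurst index $H$, defined on a probability space $(\Omega,\mathscr{A},P)$, is a centered Gaussian process with covariance $E(B_sB_t)=\frac12\left(t^{2H}+s^{2H}-|t-s|^{2H}\right)$. For integers $n\ge 1$ and $0\le k\le n-1$, $\Delta B_{k/n}=B_{(k+1)/n}-B_{k/n}$. $L^2$ means $L^2(\Omega,\mathscr{A},P)$. For an integer $m$, a function $h:\mathbb{R}\to\mathbb{R}$ verifies $(\mathbf{H}_m)$ if $h$ is of class $\mathscr{C}^m$ and, for every $p\in(0,\infty)$ and every $0\le i\le m$, $\sup_{t\in[0,1]}E\{|h^{(i)}(B_t)|^p\}<\infty$. *)

theory Defs
  imports "HOL-Probability.Probability"
begin

text \<open>A point mass counts as a (degenerate) Gaussian law; this is needed since \<open>B 0 = 0\<close>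
  almost surely.\<close>

definition gaussian_rv :: "'a measure \<Rightarrow> ('a \<Rightarrow> real) \<Rightarrow> bool" where
  "gaussian_rv M X \<longleftrightarrow>
     X \<in> borel_measurable M \<and>
     ((\<exists>\<mu>. distr M borel X = return borel \<mu>) \<or>
      (\<exists>\<mu> \<sigma>. \<sigma> > 0 \<and> distributed M lborel X (normal_density \<mu> \<sigma>)))"

definition gaussian_process :: "'a measure \<Rightarrow> 'i set \<Rightarrow> ('i \<Rightarrow> 'a \<Rightarrow> real) \<Rightarrow> bool" where
  "gaussian_process M T X \<longleftrightarrow>
     (\<forall>J c. finite J \<and> J \<subseteq> T \<longrightarrow> gaussian_rv M (\<lambda>\<omega>. \<Sum>t\<in>J. c t * X t \<omega>))"

text \<open>The process is a function on the whole real line of which only the values at times in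
  \<open>{0..1}\<close> matter. Since \<open>0 powr a = 0\<close>, the covariance formula is also the intended one
  when \<open>s = 0\<close>, \<open>t = 0\<close> or \<open>s = t\<close>.\<close>

definition fractional_brownian_motion ::
    "'a measure \<Rightarrow> real \<Rightarrow> (real \<Rightarrow> 'a \<Rightarrow> real) \<Rightarrow> bool" where
  "fractional_brownian_motion M H B \<longleftrightarrow>
     0 < H \<and> H < 1 \<and>
     gaussian_process M {0..1} B \<and>
     (\<forall>t\<in>{0..1}. (LINT \<omega>|M. B t \<omega>) = 0) \<and>
     (\<forall>s\<in>{0..1}. \<forall>t\<in>{0..1}. (LINT \<omega>|M. B s \<omega> * B t \<omega>) =
        (t powr (2 * H) + s powr (2 * H) - \<bar>t - s\<bar> powr (2 * H)) / 2)"

text \<open>Finite-dimensional laws say nothing about sample paths, so a regularity condition is needed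
  for the pathwise integrals of \<open>h'' (B u)\<close> and \<open>h''' (B u)\<close> over \<open>u \<in> {0..1}\<close> to be random
  variables. Joint measurability up to null sets suffices, and holds for every version of \<open>B\<close>
  with almost surely continuous paths.\<close>

definition measurable_process :: "'a measure \<Rightarrow> (real \<Rightarrow> 'a \<Rightarrow> real) \<Rightarrow> bool" where
  "measurable_process M B \<longleftrightarrow>
     (\<lambda>(\<omega>, u). B u \<omega>) \<in>
       borel_measurable (completion (M \<Otimes>\<^sub>M restrict_space lborel {0..1}))"

definition class_C :: "nat \<Rightarrow> (real \<Rightarrow> real) \<Rightarrow> bool" where
  "class_C m h \<longleftrightarrow>
     (\<forall>i<m. \<forall>x. (deriv ^^ i) h differentiable (at x)) \<and>
     continuous_on UNIV ((deriv ^^ m) h)"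

text \<open>The condition \<open>(H\<^sub>m)\<close>. The moments are extended nonnegative integrals, so that
  finiteness of the supremum includes existence of each moment.\<close>

definition cond_H ::
    "'a measure \<Rightarrow> (real \<Rightarrow> 'a \<Rightarrow> real) \<Rightarrow> nat \<Rightarrow> (real \<Rightarrow> real) \<Rightarrow> bool" where
  "cond_H M B m h \<longleftrightarrow>
     class_C m h \<and>
     (\<forall>p>0. \<forall>i\<le>m.
        (SUP t\<in>{0..1}. \<integral>\<^sup>+ \<omega>. ennreal (\<bar>(deriv ^^ i) h (B t \<omega>)\<bar> powr p) \<partial>M) < \<infinity>)"

definition increment :: "(real \<Rightarrow> 'a \<Rightarrow> real) \<Rightarrow> nat \<Rightarrow> nat \<Rightarrow> 'a \<Rightarrow> real" where
  "increment B n k \<omega> = B (real (k + 1) / real n) \<omega> - B (real k / real n) \<omega>"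

text \<open>Elements of \<open>L\<^sup>2\<close> are classes modulo almost sure equality, so functions are only
  required to be measurable up to a null set, i.e. for the completion of \<open>M\<close>; on \<open>M\<close>-measurable
  functions integrals for \<open>M\<close> and its completion agree.\<close>

definition in_L2 :: "'a measure \<Rightarrow> ('a \<Rightarrow> real) \<Rightarrow> bool" where
  "in_L2 M X \<longleftrightarrow>
     X \<in> borel_measurable (completion M) \<and> integrable (completion M) (\<lambda>\<omega>. (X \<omega>)\<^sup>2)"

definition tendsto_L2 :: "'a measure \<Rightarrow> (nat \<Rightarrow> 'a \<Rightarrow> real) \<Rightarrow> ('a \<Rightarrow> real) \<Rightarrow> bool" where
  "tendsto_L2 M X Y \<longleftrightarrow>
     (\<forall>n. in_L2 M (X n)) \<and> in_L2 M Y \<and>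
     (\<lambda>n. LINT \<omega>|completion M. (X n \<omega> - Y \<omega>)\<^sup>2) \<longlonglongrightarrow> 0"

end

theory Submission
  imports Defs
begin

text \<open>
  Write \<open>\<delta> = n\<^sup>-\<^sup>2\<^sup>H\<close> for the variance of one increment \<open>U\<^sub>k\<close> and \<open>X\<^sub>k\<close> for the value of the process
  at the \<open>k\<close>-th grid point. The centered square \<open>U\<^sub>k\<^sup>2 - \<delta>\<close> and the combination \<open>U\<^sub>k\<^sup>3 - 3 \<delta> U\<^sub>k\<close> are Hermite
  polynomials of the increment. For small \<open>H\<close> increments are negatively correlated with the
  current value: \<open>E (U\<^sub>k X\<^sub>k)\<close> is close to \<open>\<beta> = - \<delta> / 2\<close> when \<open>k\<close> is large. Gaussian integration by parts
  moves the \<open>q\<close>-th Hermite polynomial of \<open>U\<^sub>k\<close> onto the weight: each of the \<open>q\<close> contractions of \<open>U\<^sub>k\<close>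
  with \<open>X\<^sub>k\<close> produces a factor close to \<open>\<beta>\<close> and differentiates \<open>h\<close> once. So in the weighted sum
  \<open>h(X\<^sub>k) H\<^sub>q(U\<^sub>k)\<close> behaves like \<open>\<beta>\<^sup>q h\<^sup>(\<^sup>q\<^sup>)(X\<^sub>k)\<close>, and this drift dominates the fluctuations precisely when \<open>2 q H < 1\<close>.
  That is where the constants \<open>1/4 = (-1/2)\<^sup>2\<close> and \<open>-1/8 = (-1/2)\<^sup>3\<close> come from.

  To make this precise, let \<open>D\<^sub>k = h(X\<^sub>k) H\<^sub>q(U\<^sub>k) - \<beta>\<^sup>q h\<^sup>(\<^sup>q\<^sup>)(X\<^sub>k)\<close> and expand the second moment of the sum of
  the \<open>D\<^sub>k\<close> into the expectations of \<open>D\<^sub>k D\<^sub>l\<close>. Contracting \<open>U\<^sub>k\<close> completely, the leading term cancels, and every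
  surviving term contains \<open>E (U\<^sub>k X\<^sub>k) - \<beta>\<close>, \<open>E (U\<^sub>k X\<^sub>l)\<close> or \<open>E (U\<^sub>k U\<^sub>l)\<close>
  (\<open>contraction_error_bound\<close>, \<open>hermite_product_expectation_bound\<close>). Each of these three is at most of order \<open>\<delta>\<close>,
  but summed over \<open>k\<close> they are only of order \<open>1\<close>, \<open>1\<close> and \<open>\<delta>\<close>, by telescoping and concavity
  of \<open>x\<^sup>2\<^sup>H\<close>. The second moment is therefore of order \<open>n \<delta>\<^sup>q\<close> (\<open>comp_sum_variance\<close>), which becomes
  \<open>n\<^sup>2\<^sup>q\<^sup>H\<^sup>-\<^sup>1\<close> after normalization. The cubic case follows from \<open>q = 3\<close> together with \<open>q = 1\<close>, because
  \<open>U\<^sup>3 = H\<^sub>3(U) + 3 \<delta> U\<close>; the term with \<open>h'\<close> in the statement compensates \<open>3 \<delta> U\<close>.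

  What remains is a Riemann sum of \<open>h\<^sup>(\<^sup>q\<^sup>)(X\<^sub>k)\<close>, which converges in \<open>L\<^sup>2\<close> because \<open>t \<mapsto> h\<^sup>(\<^sup>q\<^sup>)(B\<^sub>t)\<close> is uniformly
  continuous in \<open>L\<^sup>2\<close> (\<open>riemann_sums_tendsto_L2\<close>).

  The weight \<open>h\<close> satisfies moment conditions but no growth condition, and the Gaussian vectors involved
  may be degenerate (\<open>k = l\<close>, \<open>k = l + 1\<close> or \<open>X\<^sub>0 = 0\<close>). Integration by parts is therefore derived
  without densities of vectors: after subtracting its regression on the Gaussian variable \<open>G\<close> that is to be
  contracted, the vector is uncorrelated with \<open>G\<close>, hence independent of it
  (\<open>gaussian_space_uncorrelated_indep\<close>), and only the one-dimensional density of \<open>G\<close> is needed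
  (\<open>gaussian_integration_by_parts\<close>).
\<close>

abbreviation "\<gamma> \<equiv> std_normal_distribution"

abbreviation (in prob_space) "E \<equiv> expectation"

abbreviation (in prob_space) "covar X Y \<equiv> E (\<lambda>w. X w * Y w)"

lemmas lint_cong = Bochner_Integration.integral_cong

lemmas lint_bound = Bochner_Integration.integrable_bound

section \<open>Characteristic functions and joint laws\<close>

text \<open>A signed measure on the line with vanishing Fourier transform is zero. The positive and negative
  parts of \<open>W\<close> have the same mass (take \<open>\<theta> = 0\<close>), so after normalization they induce two laws of
  \<open>X\<close> with the same characteristic function, to which the uniqueness theorem for probability measures applies.\<close>

lemma (in prob_space) indicator_integral_eq_0_if_char_eq_0_real:
  fixes X W :: "'a \<Rightarrow> real"
  assumes X[measurable]: "X \<in> borel_measurable M" and W: "integrable M W"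
    and zero: "\<And>\<theta>. (CLINT w|M. iexp (\<theta> * X w) * complex_of_real (W w)) = 0"
    and A[measurable]: "A \<in> sets borel"
  shows "(LINT w|M. indicator A (X w) * W w) = 0"
proof -
  define p where "p = (\<lambda>w. max 0 (W w))"
  define m where "m = (\<lambda>w. max 0 (- W w))"
  have Wm[measurable]: "W \<in> borel_measurable M" using W by auto
  have pm[measurable]: "p \<in> borel_measurable M" "m \<in> borel_measurable M"
    by (auto simp: p_def m_def)
  have ip: "integrable M p" "integrable M m"
    using W by (auto simp: p_def m_def)
  have W_eq: "W w = p w - m w" for w by (auto simp: p_def m_def)
  have nn: "p w \<ge> 0" "m w \<ge> 0" for w by (auto simp: p_def m_def)
  define c where "c = (LINT w|M. p w)"
  have "(CLINT w|M. complex_of_real (W w)) = 0" using zero[of 0] by simp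
  then have "(LINT w|M. W w) = 0"
    by (metis integral_complex_of_real of_real_eq_0_iff)
  then have cm: "c = (LINT w|M. m w)" using ip by (simp add: W_eq c_def)
  have ind: "integrable M (\<lambda>w. indicator A (X w) * p w)" "integrable M (\<lambda>w. indicator A (X w) * m w)"
    by (rule lint_bound[OF ip(1)], measurable, simp add: indicator_def)
       (rule lint_bound[OF ip(2)], measurable, simp add: indicator_def)
  show ?thesis
  proof (cases "c = 0")
    case True
    have "AE w in M. p w = 0"
      using True nn(1) ip(1) by (simp add: c_def integral_nonneg_eq_0_iff_AE)
    moreover have "AE w in M. m w = 0"
      using True nn(2) ip(2) by (simp add: cm integral_nonneg_eq_0_iff_AE)
    ultimately have "AE w in M. indicator A (X w) * W w = 0" by eventually_elim (simp add: W_eq)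
    then show ?thesis by (rule integral_eq_zero_AE)
  next
    case False
    then have c: "c > 0" using nn unfolding c_def
      by (metis Bochner_Integration.integral_nonneg less_eq_real_def)
    define N where "N = (\<lambda>q. distr (density M (\<lambda>w. ennreal (q w / c))) borel X)"
    have N: "real_distribution (N q) \<and> (\<forall>t. char (N q) t = (CLINT w|M. iexp (t * X w) * complex_of_real (q w)) / c) \<and>
        measure (N q) A = (LINT w|M. indicator A (X w) * q w) / c"
      if q[measurable]: "q \<in> borel_measurable M" and iq: "integrable M q" and nq: "\<And>w. q w \<ge> 0"
        and qc: "(LINT w|M. q w) = c" for q
    proof (intro conjI allI)
      have pd: "prob_space (density M (\<lambda>w. ennreal (q w / c)))"
      proof (rule prob_spaceI)
        have "emeasure (density M (\<lambda>w. ennreal (q w / c))) (space M) = (\<integral>\<^sup>+w. ennreal (q w / c) \<partial>M)"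
          by (subst emeasure_density) (auto intro!: nn_integral_cong)
        also have "\<dots> = ennreal (LINT w|M. q w / c)"
          using iq nq c by (intro nn_integral_eq_integral) auto
        also have "\<dots> = 1" using qc c by simp
        finally show "emeasure (density M (\<lambda>w. ennreal (q w / c))) (space (density M (\<lambda>w. ennreal (q w / c)))) = 1"
          by simp
      qed
      then interpret D: prob_space "density M (\<lambda>w. ennreal (q w / c))" .
      show rd: "real_distribution (N q)"
        unfolding N_def by (rule D.real_distribution_distr) simp
      show "char (N q) t = (CLINT w|M. iexp (t * X w) * complex_of_real (q w)) / c" for t
      proof -
        have "char (N q) t = (CLINT w|density M (\<lambda>w. ennreal (q w / c)). iexp (t * X w))"
          unfolding char_def N_def by (rule integral_distr) auto
        also have "\<dots> = (CLINT w|M. (q w / c) *\<^sub>R iexp (t * X w))"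
          using nq c by (intro integral_density) auto
        also have "\<dots> = (CLINT w|M. (iexp (t * X w) * complex_of_real (q w)) / c)"
          by (intro lint_cong) (auto simp: scaleR_conv_of_real)
        finally show ?thesis by simp
      qed
      interpret R: real_distribution "N q" by (rule rd)
      have "measure (N q) A = (LINT x|N q. indicator A x)" by simp
      also have "\<dots> = (LINT w|density M (\<lambda>w. ennreal (q w / c)). indicator A (X w))"
          unfolding N_def by (rule integral_distr) auto
      also have "\<dots> = (LINT w|M. (q w / c) *\<^sub>R indicator A (X w))"
          using nq c by (intro integral_density) auto
      also have "\<dots> = (LINT w|M. (indicator A (X w) * q w) / c)"
          by (intro lint_cong) auto
      finally show "measure (N q) A = (LINT w|M. indicator A (X w) * q w) / c" by simp
    qed
    note Np = N[OF pm(1) ip(1) nn(1) c_def[symmetric]] and Nm = N[OF pm(2) ip(2) nn(2) cm[symmetric]]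
    have ce: "integrable M (\<lambda>w. iexp (t * X w) * complex_of_real (p w))"
       "integrable M (\<lambda>w. iexp (t * X w) * complex_of_real (m w))" for t
      by (rule lint_bound[OF ip(1)], measurable, simp add: norm_mult)
       (rule lint_bound[OF ip(2)], measurable, simp add: norm_mult)
    have "(CLINT w|M. iexp (t * X w) * complex_of_real (p w)) -
         (CLINT w|M. iexp (t * X w) * complex_of_real (m w)) = 0" for t
      unfolding Bochner_Integration.integral_diff[OF ce, symmetric]
      using zero[of t] by (simp add: W_eq algebra_simps)
    then have "char (N p) = char (N m)" using Np Nm by (auto intro!: ext)
    then have "N p = N m" using Np Nm by (auto intro: Levy_uniqueness)
    then have "(LINT w|M. indicator A (X w) * p w) = (LINT w|M. indicator A (X w) * m w)"
      using Np Nm c by simp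
    then show ?thesis using ind by (simp add: W_eq algebra_simps)
  qed
qed

text \<open>Complex weights reduce to real ones: conjugation together with \<open>\<theta> \<mapsto> - \<theta>\<close> shows that the hypothesis
  passes to the conjugate weight, hence to real and imaginary parts. Complex weights are what makes the next
  induction possible, since the exponentials of the remaining coordinates are absorbed into \<open>W\<close>.\<close>

lemma (in prob_space) indicator_integral_eq_0_if_char_eq_0:
  fixes X :: "'a \<Rightarrow> real" and W :: "'a \<Rightarrow> complex"
  assumes X[measurable]: "X \<in> borel_measurable M" and W: "integrable M W"
    and zero: "\<And>\<theta>. (CLINT w|M. iexp (\<theta> * X w) * W w) = 0"
    and A[measurable]: "A \<in> sets borel"
  shows "(CLINT w|M. indicator A (X w) * W w) = 0"
proof -
  have Wm[measurable]: "W \<in> borel_measurable M" using W by auto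
  have Wc: "integrable M (\<lambda>w. cnj (W w))" using W by simp
  then have [measurable]: "(\<lambda>w. cnj (W w)) \<in> borel_measurable M" by (rule borel_measurable_integrable)
  have int: "integrable M (\<lambda>w. iexp (t * X w) * W w)" "integrable M (\<lambda>w. iexp (t * X w) * cnj (W w))" for t
    by (rule lint_bound[OF W], measurable, simp add: norm_mult)
       (rule lint_bound[OF Wc], measurable, simp add: norm_mult)
  have zc: "(CLINT w|M. iexp (t * X w) * cnj (W w)) = 0" for t
  proof -
    have "(CLINT w|M. iexp (t * X w) * cnj (W w)) = (CLINT w|M. cnj (iexp ((-t) * X w) * W w))"
      by (intro lint_cong) (auto simp: exp_cnj)
    also have "\<dots> = cnj (CLINT w|M. iexp ((-t) * X w) * W w)"
      by (rule Bochner_Integration.integral_cnj)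
    finally show ?thesis by (simp only: zero complex_cnj_zero)
  qed
  have re: "complex_of_real (Re w) = (w + cnj w) / 2" "complex_of_real (Im w) = (w - cnj w) / (2*\<i>)" for w
    by (simp_all add: complex_add_cnj complex_diff_cnj complex_eq_iff)
  have "(CLINT w|M. iexp (t * X w) * complex_of_real (Re (W w))) = 0" for t
  proof -
    have "(CLINT w|M. iexp (t * X w) * complex_of_real (Re (W w))) =
      (CLINT w|M. (iexp (t * X w) * W w + iexp (t * X w) * cnj (W w)) / 2)"
      by (intro lint_cong) (auto simp: re field_simps)
    then show ?thesis using int zero zc by simp
  qed
  moreover have "(CLINT w|M. iexp (t * X w) * complex_of_real (Im (W w))) = 0" for t
  proof -
    have "(CLINT w|M. iexp (t * X w) * complex_of_real (Im (W w))) =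
      (CLINT w|M. (iexp (t * X w) * W w - iexp (t * X w) * cnj (W w)) / (2*\<i>))"
      by (intro lint_cong) (auto simp: re field_simps)
    then show ?thesis using int zero zc by simp
  qed
  ultimately have R: "(LINT w|M. indicator A (X w) * Re (W w)) = 0" "(LINT w|M. indicator A (X w) * Im (W w)) = 0"
    using W by (auto intro!: indicator_integral_eq_0_if_char_eq_0_real)
  have i: "integrable M (\<lambda>w. indicator A (X w) * W w)"
    by (rule lint_bound[OF W]) (auto simp: indicator_def)
  show ?thesis
  proof (rule complex_eqI)
    have *: "Re (indicator A x * w) = indicator A x * Re w" "Im (indicator A x * w) = indicator A x * Im w" for x w
      by (auto simp: indicator_def)
    show "Re (CLINT w|M. indicator A (X w) * W w) = Re 0" using R(1) i * by (simp flip: integral_Re)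
    show "Im (CLINT w|M. indicator A (X w) * W w) = Im 0" using R(2) i * by (simp flip: integral_Im)
  qed
qed

text \<open>Uniqueness in several dimensions, tested on rectangles, by exchanging exponentials for indicators
  one coordinate at a time.\<close>

lemma (in prob_space) indicator_prod_integral_eq_0_if_char_eq_0:
  fixes X :: "'i \<Rightarrow> 'a \<Rightarrow> real" and W :: "'a \<Rightarrow> complex"
  assumes "finite I" and X: "\<And>i. i \<in> I \<Longrightarrow> X i \<in> borel_measurable M" and W: "integrable M W"
    and zero: "\<And>\<theta>. (CLINT w|M. iexp (\<Sum>i\<in>I. \<theta> i * X i w) * W w) = 0"
    and A: "\<And>i. i \<in> I \<Longrightarrow> A i \<in> sets borel"
  shows "(CLINT w|M. (\<Prod>i\<in>I. indicator (A i) (X i w)) * W w) = 0"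
  using assms
proof (induction I arbitrary: W rule: finite_induct)
  case empty
  then show ?case by simp
next
  case (insert j I)
  have Xm[measurable]: "X j \<in> borel_measurable M" "\<And>i. i \<in> I \<Longrightarrow> X i \<in> borel_measurable M"
    and [measurable]: "A j \<in> sets borel"
    using insert.prems by auto
  have [measurable]: "W \<in> borel_measurable M" using insert.prems by auto
  have sums[measurable]: "(\<lambda>w. \<Sum>i\<in>I. \<theta> i * X i w) \<in> borel_measurable M" for \<theta>
    by (intro borel_measurable_sum) auto
  have int: "integrable M (\<lambda>w. indicator (A j) (X j w) * W w)"
    by (rule lint_bound[OF insert.prems(2)]) (auto simp: indicator_def)
  have "(CLINT w|M. (\<Prod>i\<in>I. indicator (A i) (X i w)) * (indicator (A j) (X j w) * W w)) = 0"
  proof (rule insert.IH)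
    show "X i \<in> borel_measurable M" if "i \<in> I" for i using that insert.prems by auto
    show "A i \<in> sets borel" if "i \<in> I" for i using that insert.prems by auto
    show "integrable M (\<lambda>w. indicator (A j) (X j w) * W w)" by (rule int)
    show "(CLINT w|M. iexp (\<Sum>i\<in>I. \<theta> i * X i w) * (indicator (A j) (X j w) * W w)) = 0" for \<theta>
    proof -
      have "(CLINT w|M. indicator (A j) (X j w) * (iexp (\<Sum>i\<in>I. \<theta> i * X i w) * W w)) = 0"
      proof (rule indicator_integral_eq_0_if_char_eq_0)
        show "integrable M (\<lambda>w. iexp (\<Sum>i\<in>I. \<theta> i * X i w) * W w)"
          by (rule lint_bound[OF insert.prems(2)])
             (auto simp: norm_mult intro!: measurable_compose[OF sums] borel_measurable_times)
        show "(CLINT w|M. iexp (t * X j w) * (iexp (\<Sum>i\<in>I. \<theta> i * X i w) * W w)) = 0" for t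
        proof -
          have "(\<Sum>i\<in>I. (\<theta>(j := t)) i * X i w) = (\<Sum>i\<in>I. \<theta> i * X i w)" for w
            using insert.hyps by (intro sum.cong) auto
          then have e: "iexp (t * X j w) * (iexp (\<Sum>i\<in>I. \<theta> i * X i w) * W w) =
              iexp (\<Sum>i\<in>insert j I. (\<theta>(j := t)) i * X i w) * W w" for w
            using insert.hyps by (simp add: distrib_left exp_add)
          show ?thesis unfolding e by (rule insert.prems(3))
        qed
      qed auto
      then show ?thesis by (simp add: ac_simps)
    qed
  qed
  then show ?case using insert.hyps by (simp add: ac_simps)
qed

text \<open>Independence of a variable and a vector, phrased as a product law. Factorization of the
  characteristic function says that a centered weight has vanishing transform; first the vector and then the
  variable is localized on Borel sets, and rectangles form an intersection-stable generator.\<close>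

lemma (in prob_space) joint_law_if_char_factorizes:
  fixes G :: "'a \<Rightarrow> real" and Z :: "'i \<Rightarrow> 'a \<Rightarrow> real"
  assumes "finite I" and G[measurable]: "G \<in> borel_measurable M"
    and Z: "\<And>i. i \<in> I \<Longrightarrow> Z i \<in> borel_measurable M"
    and fact: "\<And>\<eta> \<theta>. (CLINT w|M. iexp (\<Sum>i\<in>I. \<theta> i * Z i w) * iexp (\<eta> * G w)) =
       (CLINT w|M. iexp (\<Sum>i\<in>I. \<theta> i * Z i w)) * (CLINT w|M. iexp (\<eta> * G w))"
  shows "distr M (borel \<Otimes>\<^sub>M PiM I (\<lambda>_. borel)) (\<lambda>w. (G w, \<lambda>i\<in>I. Z i w)) =
    distr M borel G \<Otimes>\<^sub>M distr M (PiM I (\<lambda>_. borel)) (\<lambda>w. \<lambda>i\<in>I. Z i w)"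
proof -
  let ?Z = "\<lambda>w. \<lambda>i\<in>I. Z i w" and ?P = "PiM I (\<lambda>_. borel :: real measure)"
  note Z[measurable]
  have Zv[measurable]: "?Z \<in> M \<rightarrow>\<^sub>M ?P"
    by (rule measurable_restrict) (rule Z)
  have sums[measurable]: "(\<lambda>w. \<Sum>i\<in>I. \<theta> i * Z i w) \<in> borel_measurable M" for \<theta>
    by (intro borel_measurable_sum) (use Z in auto)
  have bnd: "integrable M f" if "f \<in> borel_measurable M" "\<And>w. norm (f w) \<le> 1" for f :: "'a \<Rightarrow> complex"
    by (rule integrable_const_bound[where B=1]) (use that in auto)
  define R where "R = {?Z -` Pi\<^sub>E I A \<inter> space M | A. \<forall>i\<in>I. A i \<in> sets borel}"
  have prodI: "(\<Prod>i\<in>I. indicator (A i) (Z i w)) = (indicator (?Z -` Pi\<^sub>E I A \<inter> space M) w :: complex)"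
    if "w \<in> space M" for A w
  proof (cases "\<forall>i\<in>I. Z i w \<in> A i")
    case True
    then have "(\<Prod>i\<in>I. indicator (A i) (Z i w)) = (1 :: complex)" by (intro prod.neutral) auto
    then show ?thesis using True that by (auto simp: indicator_def PiE_iff)
  next
    case False
    then have "(\<Prod>i\<in>I. indicator (A i) (Z i w)) = (0 :: complex)"
      using \<open>finite I\<close> by (auto simp: prod_zero_iff indicator_def)
    then show ?thesis using False that by (auto simp: indicator_def PiE_iff)
  qed
  have rect: "prob (G -` C \<inter> space M \<inter> (?Z -` Pi\<^sub>E I A \<inter> space M)) =
      prob (G -` C \<inter> space M) * prob (?Z -` Pi\<^sub>E I A \<inter> space M)"
    if C[measurable]: "C \<in> sets borel" and A: "\<forall>i\<in>I. A i \<in> sets borel" for C A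
  proof -
    define S where "S = ?Z -` Pi\<^sub>E I A \<inter> space M"
    have "Pi\<^sub>E I A \<in> sets ?P" by (rule sets_PiM_I_finite) (use A \<open>finite I\<close> in auto)
    then have S[measurable]: "S \<in> sets M" unfolding S_def by (rule measurable_sets[OF Zv])
    have step1: "(CLINT w|M. indicator S w * (iexp (\<eta> * G w) - (CLINT w|M. iexp (\<eta> * G w)))) = 0" for \<eta>
    proof -
      let ?c = "CLINT w|M. iexp (\<eta> * G w)"
      have i1: "integrable M (\<lambda>w. iexp (\<Sum>i\<in>I. \<theta> i * Z i w) * iexp (\<eta> * G w))"
         "integrable M (\<lambda>w. iexp (\<Sum>i\<in>I. \<theta> i * Z i w))"
         "integrable M (\<lambda>w. iexp (\<eta> * G w))" for \<theta>
        by (rule bnd; auto simp: norm_mult)+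
      have "(CLINT w|M. (\<Prod>i\<in>I. indicator (A i) (Z i w)) * (iexp (\<eta> * G w) - ?c)) = 0"
      proof (rule indicator_prod_integral_eq_0_if_char_eq_0)
        show "integrable M (\<lambda>w. iexp (\<eta> * G w) - ?c)" using i1 by simp
        show "(CLINT w|M. iexp (\<Sum>i\<in>I. \<theta> i * Z i w) * (iexp (\<eta> * G w) - ?c)) = 0" for \<theta>
          using i1 fact[of \<theta> \<eta>] by (simp add: right_diff_distrib)
      qed (use A Z \<open>finite I\<close> in auto)
      moreover have "(CLINT w|M. (\<Prod>i\<in>I. indicator (A i) (Z i w)) * (iexp (\<eta> * G w) - ?c)) =
         (CLINT w|M. indicator S w * (iexp (\<eta> * G w) - ?c))"
        by (intro lint_cong) (auto simp: prodI S_def)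
      ultimately show ?thesis by simp
    qed
    have iS: "integrable M (indicator S :: _ \<Rightarrow> complex)" by (rule bnd) (auto simp: indicator_def)
    have mS: "(CLINT w|M. indicator S w) = complex_of_real (prob S)"
    proof -
      have "(CLINT w|M. indicator S w) = (CLINT w|M. complex_of_real (indicator S w))"
        by (intro lint_cong) (auto simp: indicator_def)
      then show ?thesis by (simp add: sets.sets_into_space Int_absorb2)
    qed
    have "(CLINT w|M. indicator C (G w) * (indicator S w - complex_of_real (prob S))) = 0"
    proof (rule indicator_integral_eq_0_if_char_eq_0)
      show "integrable M (\<lambda>w. indicator S w - complex_of_real (prob S))" using iS by simp
      show "(CLINT w|M. iexp (t * G w) * (indicator S w - complex_of_real (prob S))) = 0" for t
      proof -
        have i: "integrable M (\<lambda>w. iexp (t * G w))" by (rule bnd) auto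
        have j: "integrable M (\<lambda>w. indicator S w * iexp (t * G w))"
          by (rule bnd) (auto simp: norm_mult indicator_def)
        have "(CLINT w|M. indicator S w * iexp (t * G w)) = complex_of_real (prob S) * (CLINT w|M. iexp (t * G w))"
          using step1[of t] j iS mS by (simp add: right_diff_distrib)
        moreover have "(CLINT w|M. iexp (t * G w) * (indicator S w - complex_of_real (prob S))) =
          (CLINT w|M. indicator S w * iexp (t * G w) - complex_of_real (prob S) * iexp (t * G w))"
          by (intro lint_cong) (auto simp: algebra_simps)
        ultimately show ?thesis using i j by simp
      qed
    qed auto
    moreover have "integrable M (\<lambda>w. indicator C (G w) * indicator S w :: complex)"
        "integrable M (\<lambda>w. indicator C (G w) :: complex)"
      by (rule bnd; auto simp: indicator_def)+
    ultimately have e: "(CLINT w|M. indicator C (G w) * indicator S w) = (CLINT w|M. indicator C (G w)) * complex_of_real (prob S)"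
      by (simp add: right_diff_distrib)
    have "(CLINT w|M. indicator C (G w)) = (CLINT w|M. complex_of_real (indicator (G -` C \<inter> space M) w))"
      by (intro lint_cong) (auto simp: indicator_def)
    moreover have "(CLINT w|M. indicator C (G w) * indicator S w) = (CLINT w|M. complex_of_real (indicator (G -` C \<inter> space M \<inter> S) w))"
      by (intro lint_cong) (auto simp: indicator_def)
    moreover have "G -` C \<inter> space M \<inter> S \<inter> space M = G -` C \<inter> space M \<inter> S" by auto
    ultimately have "complex_of_real (prob (G -` C \<inter> space M \<inter> S)) = complex_of_real (prob (G -` C \<inter> space M) * prob S)"
      using e by simp
    then show ?thesis unfolding S_def by (simp only: of_real_eq_iff)
  qed
  have gen: "sigma_sets (space M) {?Z -` A \<inter> space M |A. A \<in> sets ?P} = sigma_sets (space M) R"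
  proof -
    have sp: "?Z \<in> space M \<rightarrow> (\<Pi>\<^sub>E i\<in>I. UNIV)" by auto
    have "{?Z -` A \<inter> space M |A. A \<in> sets ?P} =
      {?Z -` A \<inter> space M |A. A \<in> sigma_sets (\<Pi>\<^sub>E i\<in>I. UNIV) {Pi\<^sub>E I X |X. X \<in> (\<Pi> j\<in>I. sets borel)}}"
      unfolding sets_PiM prod_algebra_eq_finite[OF \<open>finite I\<close>] by simp
    also have "\<dots> = sigma_sets (space M) {?Z -` A \<inter> space M |A. A \<in> {Pi\<^sub>E I X |X. X \<in> (\<Pi> j\<in>I. sets borel)}}"
      by (rule sigma_sets_vimage_commute[OF sp])
    also have "{?Z -` A \<inter> space M |A. A \<in> {Pi\<^sub>E I X |X. X \<in> (\<Pi> j\<in>I. sets borel)}} = R"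
      unfolding R_def by (auto simp: Pi_iff; blast)
    finally show ?thesis
      by (simp only:) (rule sigma_sets_sigma_sets_eq, auto simp: R_def)
  qed
  have indep: "indep_set (sigma_sets (space M) {G -` A \<inter> space M |A. A \<in> sets borel})
     (sigma_sets (space M) {?Z -` A \<inter> space M |A. A \<in> sets ?P})"
    unfolding gen
  proof (intro indep_set_sigma_sets)
    show "indep_set {G -` A \<inter> space M |A. A \<in> sets borel} R"
    proof (rule indep_setI)
      show "{G -` A \<inter> space M |A. A \<in> sets borel} \<subseteq> events" by auto
      show "R \<subseteq> events" unfolding R_def using \<open>finite I\<close>
        by (auto intro!: measurable_sets[OF Zv] sets_PiM_I_finite)
      show "prob (a \<inter> b) = prob a * prob b" if "a \<in> {G -` A \<inter> space M |A. A \<in> sets borel}" "b \<in> R" for a b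
        using that rect by (auto simp: R_def)
    qed
    show "Int_stable {G -` A \<inter> space M |A. A \<in> sets borel}"
    proof (rule Int_stableI, safe)
      fix A C :: "real set" assume "A \<in> sets borel" "C \<in> sets borel"
      then show "\<exists>D. G -` A \<inter> space M \<inter> (G -` C \<inter> space M) = G -` D \<inter> space M \<and> D \<in> sets borel"
        by (intro exI[of _ "A \<inter> C"]) auto
    qed
    show "Int_stable R"
    proof (rule Int_stableI)
      fix a b assume "a \<in> R" "b \<in> R"
      then obtain A C where AC: "\<forall>i\<in>I. A i \<in> sets borel" "\<forall>i\<in>I. C i \<in> sets borel"
        "a = ?Z -` Pi\<^sub>E I A \<inter> space M" "b = ?Z -` Pi\<^sub>E I C \<inter> space M"
        unfolding R_def by auto
      then have "a \<inter> b = ?Z -` Pi\<^sub>E I (\<lambda>i. A i \<inter> C i) \<inter> space M" by auto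
      then show "a \<inter> b \<in> R" unfolding R_def using AC(1,2)
        by (intro CollectI exI[of _ "\<lambda>i. A i \<inter> C i"]) auto
    qed
  qed
  interpret G: prob_space "distr M borel G" by (rule prob_space_distr) simp
  interpret Z: prob_space "distr M ?P ?Z" by (rule prob_space_distr) simp
  interpret GZ: pair_prob_space "distr M borel G" "distr M ?P ?Z" ..
  show ?thesis
  proof (rule pair_measure_eqI[symmetric], unfold_locales)
    show "sets (distr M borel G \<Otimes>\<^sub>M distr M ?P ?Z) =
      sets (distr M (borel \<Otimes>\<^sub>M ?P) (\<lambda>w. (G w, \<lambda>i\<in>I. Z i w)))"
      by (auto intro!: sets_pair_measure_cong)
    fix A D assume "A \<in> sets (distr M borel G)" "D \<in> sets (distr M ?P ?Z)"
    then have [measurable]: "A \<in> sets borel" "D \<in> sets ?P" by auto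
    have "emeasure M (G -` A \<inter> space M) * emeasure M (?Z -` D \<inter> space M) =
       emeasure M ((G -` A \<inter> space M) \<inter> (?Z -` D \<inter> space M))"
    proof -
      have "prob ((G -` A \<inter> space M) \<inter> (?Z -` D \<inter> space M)) =
         prob (G -` A \<inter> space M) * prob (?Z -` D \<inter> space M)"
        using \<open>A \<in> sets borel\<close> \<open>D \<in> sets ?P\<close>
        by (intro indep_setD[OF indep] sigma_sets.Basic) blast+
      then show ?thesis by (simp add: emeasure_eq_measure ennreal_mult)
    qed
    also have "(G -` A \<inter> space M) \<inter> (?Z -` D \<inter> space M) =
       (\<lambda>w. (G w, \<lambda>i\<in>I. Z i w)) -` (A \<times> D) \<inter> space M" by auto
    finally show "emeasure (distr M borel G) A * emeasure (distr M ?P ?Z) D =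
      emeasure (distr M (borel \<Otimes>\<^sub>M ?P) (\<lambda>w. (G w, \<lambda>i\<in>I. Z i w))) (A \<times> D)"
      by (simp add: emeasure_distr del: restrict_apply)
  qed
qed

section \<open>Random variables with moments of all orders\<close>

text \<open>These variables form an algebra, so integrability of any product met below is automatic.
  The growth of \<open>h\<close> enters only in this form.\<close>

definition all_moments :: "'a measure \<Rightarrow> ('a \<Rightarrow> real) \<Rightarrow> bool" where
  "all_moments M X \<longleftrightarrow> X \<in> borel_measurable M \<and> (\<forall>n. integrable M (\<lambda>w. \<bar>X w\<bar> ^ n))"

lemma all_moments_measurable: "all_moments M X \<Longrightarrow> X \<in> borel_measurable M"
  by (simp add: all_moments_def)

lemma all_moments_abs_power: "all_moments M X \<Longrightarrow> integrable M (\<lambda>w. \<bar>X w\<bar> ^ n)"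
  by (simp add: all_moments_def)

lemma all_moments_integrable:
  assumes "all_moments M X" shows "integrable M X"
proof (rule integrable_abs_cancel)
  show "integrable M (\<lambda>w. \<bar>X w\<bar>)"
    using all_moments_abs_power[OF assms, of 1] by (simp only: power_one_right)
qed (rule all_moments_measurable[OF assms])

lemma (in prob_space) all_moments_const: "all_moments M (\<lambda>_. c)"
  unfolding all_moments_def by (intro conjI allI integrable_const) simp

lemma all_moments_mult:
  assumes X: "all_moments M X" and Y: "all_moments M Y"
  shows "all_moments M (\<lambda>w. X w * Y w)"
  unfolding all_moments_def
proof (intro conjI allI)
  note [measurable] = X[THEN all_moments_measurable] Y[THEN all_moments_measurable]
  show "(\<lambda>w. X w * Y w) \<in> borel_measurable M" by simp
  fix n
  have "integrable M (\<lambda>w. \<bar>X w\<bar> ^ (2 * n) + \<bar>Y w\<bar> ^ (2 * n))"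
    using X Y by (intro Bochner_Integration.integrable_add all_moments_abs_power)
  then show "integrable M (\<lambda>w. \<bar>X w * Y w\<bar> ^ n)"
  proof (rule lint_bound)
    show "AE w in M. norm (\<bar>X w * Y w\<bar> ^ n) \<le> norm (\<bar>X w\<bar> ^ (2 * n) + \<bar>Y w\<bar> ^ (2 * n))"
    proof (rule AE_I2)
      fix w
      have "2 * (\<bar>X w\<bar> ^ n * \<bar>Y w\<bar> ^ n) \<le> \<bar>X w\<bar> ^ (2 * n) + \<bar>Y w\<bar> ^ (2 * n)"
        using sum_squares_bound[of "\<bar>X w\<bar> ^ n" "\<bar>Y w\<bar> ^ n"] by (simp add: power_even_eq mult.assoc)
      moreover have "0 \<le> \<bar>X w\<bar> ^ n * \<bar>Y w\<bar> ^ n" by simp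
      ultimately have "\<bar>X w\<bar> ^ n * \<bar>Y w\<bar> ^ n \<le> \<bar>X w\<bar> ^ (2 * n) + \<bar>Y w\<bar> ^ (2 * n)" by linarith
      then show "norm (\<bar>X w * Y w\<bar> ^ n) \<le> norm (\<bar>X w\<bar> ^ (2 * n) + \<bar>Y w\<bar> ^ (2 * n))"
        by (simp add: abs_mult power_mult_distrib)
    qed
  qed simp
qed

lemma all_moments_add:
  assumes X: "all_moments M X" and Y: "all_moments M Y"
  shows "all_moments M (\<lambda>w. X w + Y w)"
  unfolding all_moments_def
proof (intro conjI allI)
  note [measurable] = X[THEN all_moments_measurable] Y[THEN all_moments_measurable]
  show "(\<lambda>w. X w + Y w) \<in> borel_measurable M" by simp
  fix n
  have "integrable M (\<lambda>w. 2 ^ n * (\<bar>X w\<bar> ^ n + \<bar>Y w\<bar> ^ n))"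
    using X Y by (intro integrable_mult_right Bochner_Integration.integrable_add all_moments_abs_power)
  then show "integrable M (\<lambda>w. \<bar>X w + Y w\<bar> ^ n)"
  proof (rule lint_bound)
    show "AE w in M. norm (\<bar>X w + Y w\<bar> ^ n) \<le> norm (2 ^ n * (\<bar>X w\<bar> ^ n + \<bar>Y w\<bar> ^ n))"
    proof (rule AE_I2)
      fix w
      have "\<bar>X w + Y w\<bar> ^ n \<le> (2 * max \<bar>X w\<bar> \<bar>Y w\<bar>) ^ n" by (intro power_mono) auto
      also have "\<dots> \<le> 2 ^ n * (\<bar>X w\<bar> ^ n + \<bar>Y w\<bar> ^ n)" by (simp add: power_mult_distrib max_def)
      finally show "norm (\<bar>X w + Y w\<bar> ^ n) \<le> norm (2 ^ n * (\<bar>X w\<bar> ^ n + \<bar>Y w\<bar> ^ n))" by simp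
    qed
  qed simp
qed

lemma (in prob_space) all_moments_cmult: "all_moments M X \<Longrightarrow> all_moments M (\<lambda>w. c * X w)"
  by (rule all_moments_mult[OF all_moments_const])

lemma (in prob_space) all_moments_diff:
  "all_moments M X \<Longrightarrow> all_moments M Y \<Longrightarrow> all_moments M (\<lambda>w. X w - Y w)"
  using all_moments_add[of M X "\<lambda>w. -1 * Y w", OF _ all_moments_cmult[of Y "-1"]] by simp

lemma (in prob_space) all_moments_power:
  assumes "all_moments M X"
  shows "all_moments M (\<lambda>w. X w ^ n)"
proof (induction n)
  case (Suc n)
  show ?case unfolding power_Suc by (rule all_moments_mult[OF assms Suc.IH])
qed (simp add: all_moments_const)

lemma (in prob_space) all_moments_prod:
  assumes "\<And>i. i \<in> I \<Longrightarrow> all_moments M (X i)"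
  shows "all_moments M (\<lambda>w. \<Prod>i\<in>I. X i w)"
  using assms
proof (induction I rule: infinite_finite_induct)
  case (insert j I)
  have "all_moments M (\<lambda>w. X j w * (\<Prod>i\<in>I. X i w))"
    using insert by (intro all_moments_mult) auto
  then show ?case using insert.hyps by simp
qed (simp_all add: all_moments_const)

lemma (in prob_space) all_moments_sum:
  assumes "\<And>i. i \<in> I \<Longrightarrow> all_moments M (X i)"
  shows "all_moments M (\<lambda>w. \<Sum>i\<in>I. X i w)"
  using assms
proof (induction I rule: infinite_finite_induct)
  case (insert j I)
  have "all_moments M (\<lambda>w. X j w + (\<Sum>i\<in>I. X i w))"
    using insert by (intro all_moments_add) auto
  then show ?case using insert.hyps by simp
qed (simp_all add: all_moments_const)

section \<open>Gaussian integration by parts\<close>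

text \<open>Instead of taking limits at infinity, integrate \<open>F (x + 1) - F x\<close> over the line: by translation
  invariance this is zero, and by Fubini it equals the integral of \<open>f\<close>.\<close>

lemma integral_derivative_eq_0:
  fixes F f :: "real \<Rightarrow> real"
  assumes F: "\<And>x. (F has_field_derivative f x) (at x)" and cont: "continuous_on UNIV f"
    and iF: "integrable lborel F" and int_f: "integrable lborel f"
  shows "(LINT x|lborel. f x) = 0"
proof -
  have [measurable]: "f \<in> borel_measurable borel" "F \<in> borel_measurable borel"
    using int_f iF by auto
  have cf: "isCont f x" for x using cont by (simp add: continuous_on_eq_continuous_at)
  have shift: "(LINT x|lborel. g (x + t)) = (LINT x|lborel. g x)" "integrable lborel g \<Longrightarrow> integrable lborel (\<lambda>x. g (x + t))"
    for g :: "real \<Rightarrow> real" and t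
    using lborel_integral_real_affine[of 1 g t] lborel_integrable_real_affine[of g 1 t] by (auto simp: add.commute)
  have step: "(LINT t|lborel. f (x + t) * indicator {0..1} t) = F (x + 1) - F x" for x
  proof -
    have "(LINT t|lborel. f (x + t) * indicator {0..1} t) = F (x + 1) - F (x + 0)"
    proof (rule integral_FTC_Icc_real[where F = "\<lambda>t. F (x + t)"])
      show "((\<lambda>t. F (x + t)) has_real_derivative f (x + t)) (at t)" for t
        using F[of "x + t"] by (simp add: DERIV_shift add.commute)
      show "isCont (\<lambda>t. f (x + t)) t" for t
        by (intro continuous_intros isCont_o2[OF _ cf])
    qed simp
    then show ?thesis by simp
  qed
  have int: "integrable (lborel \<Otimes>\<^sub>M lborel) (\<lambda>(t, x). f (x + t) * indicator {0..1} t)"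
  proof (rule lborel_pair.Fubini_integrable)
    have "(LINT x|lborel. norm (f (x + t) * indicator {0..1} t)) = indicator {0..1} t * (LINT x|lborel. \<bar>f x\<bar>)" for t :: real
      using shift(1)[of "\<lambda>x. \<bar>f x\<bar>" t] by (simp add: abs_mult)
    then show "integrable lborel (\<lambda>t. LINT x|lborel. norm (case (t, x) of (t, x) \<Rightarrow> f (x + t) * indicator {0..1} t))"
      by simp
    show "AE t in lborel. integrable lborel (\<lambda>x. case (t, x) of (t, x) \<Rightarrow> f (x + t) * indicator {0..1} t)"
      using shift(2)[OF int_f] by simp
  qed measurable
  have "(LINT x|lborel. f x) = (LINT t|lborel. indicator {0..1::real} t * (LINT x|lborel. f x))" by simp
  also have "\<dots> = (LINT t|lborel. (LINT x|lborel. f (x + t) * indicator {0..1} t))"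
    by (simp add: shift(1))
  also have "\<dots> = (LINT x|lborel. (LINT t|lborel. f (x + t) * indicator {0..1} t))"
    using lborel_pair.Fubini_integral[OF int] by simp
  also have "\<dots> = (LINT x|lborel. F (x + 1) - F x)" by (simp only: step)
  also have "\<dots> = 0" using shift[of F 1] iF by simp
  finally show ?thesis .
qed

lemma std_normal_integration_by_parts:
  fixes u u' :: "real \<Rightarrow> real"
  assumes u: "\<And>x. (u has_field_derivative u' x) (at x)" and cont: "continuous_on UNIV u'"
    and iu: "integrable \<gamma> u" "integrable \<gamma> u'"
      "integrable \<gamma> (\<lambda>x. x * u x)"
  shows "(LINT x|\<gamma>. x * u x) = (LINT x|\<gamma>. u' x)"
proof -
  have cu: "continuous_on UNIV u" by (intro continuous_at_imp_continuous_on ballI DERIV_isCont[OF u])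
  have [measurable]: "u \<in> borel_measurable borel" "u' \<in> borel_measurable borel"
    using cu cont by (auto intro: borel_measurable_continuous_onI)
  let ?d = std_normal_density
  have i: "integrable lborel (\<lambda>x. ?d x * u x)" "integrable lborel (\<lambda>x. ?d x * u' x)" "integrable lborel (\<lambda>x. ?d x * (x * u x))"
    using iu by (simp_all add: integrable_density)
  have D: "(?d has_field_derivative - (x * ?d x)) (at x)" for x
    unfolding std_normal_density_def by (auto intro!: derivative_eq_intros simp: field_simps)
  have "(LINT x|lborel. ?d x * u' x - ?d x * (x * u x)) = 0"
  proof (rule integral_derivative_eq_0)
    show "((\<lambda>x. ?d x * u x) has_field_derivative ?d x * u' x - ?d x * (x * u x)) (at x)" for x
      using DERIV_mult[OF D u, of x] by (simp add: field_simps)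
    have "continuous_on UNIV ?d" by (intro continuous_at_imp_continuous_on ballI DERIV_isCont[OF D])
    then show "continuous_on UNIV (\<lambda>x. ?d x * u' x - ?d x * (x * u x))"
      by (intro continuous_intros cont cu)
  qed (use i in auto)
  then show ?thesis using i by (simp add: integral_density)
qed

text \<open>Conditionally on \<open>Z\<close> this is the one-dimensional formula. The parameter \<open>z\<close> lives in an arbitrary
  measurable space, which makes the dimension of the Gaussian vector irrelevant here.\<close>

lemma (in prob_space) integration_by_parts_independent:
  fixes G :: "'a \<Rightarrow> real" and Z :: "'a \<Rightarrow> 'b" and \<phi> \<phi>' :: "real \<Rightarrow> 'b \<Rightarrow> real"
  assumes G[measurable]: "G \<in> borel_measurable M" and Z[measurable]: "Z \<in> M \<rightarrow>\<^sub>M N"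
    and indep: "distr M (borel \<Otimes>\<^sub>M N) (\<lambda>w. (G w, Z w)) = distr M borel G \<Otimes>\<^sub>M distr M N Z"
    and law: "distr M borel G = distr \<gamma> borel (\<lambda>x. s * x)"
    and [measurable]: "(\<lambda>(g, z). \<phi> g z) \<in> borel_measurable (borel \<Otimes>\<^sub>M N)" "(\<lambda>(g, z). \<phi>' g z) \<in> borel_measurable (borel \<Otimes>\<^sub>M N)"
    and D: "\<And>g z. ((\<lambda>g. \<phi> g z) has_field_derivative \<phi>' g z) (at g)" and cont: "\<And>z. continuous_on UNIV (\<lambda>g. \<phi>' g z)"
    and int: "integrable M (\<lambda>w. \<phi> (G w) (Z w))" "integrable M (\<lambda>w. \<phi>' (G w) (Z w))"
      "integrable M (\<lambda>w. G w * \<phi> (G w) (Z w))"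
  shows "E (\<lambda>w. G w * \<phi> (G w) (Z w)) = s\<^sup>2 * E (\<lambda>w. \<phi>' (G w) (Z w))"
proof -
  interpret G: prob_space "distr M borel G" by (rule prob_space_distr) simp
  interpret Z: prob_space "distr M N Z" by (rule prob_space_distr) simp
  interpret S: real_distribution \<gamma> by (rule real_dist_normal_dist)
  interpret GZ: pair_prob_space "distr M borel G" "distr M N Z" ..
  define P where "P = distr M borel G \<Otimes>\<^sub>M distr M N Z"
  have iP: "integrable P (\<lambda>(g, z). \<psi> g z)" and eP: "E (\<lambda>w. \<psi> (G w) (Z w)) = (LINT z|distr M N Z. LINT x|\<gamma>. \<psi> (s * x) z)"
    and AE: "AE z in distr M N Z. integrable \<gamma> (\<lambda>x. \<psi> (s * x) z)"
    if m[measurable]: "(\<lambda>(g, z). \<psi> g z) \<in> borel_measurable (borel \<Otimes>\<^sub>M N)" and i: "integrable M (\<lambda>w. \<psi> (G w) (Z w))" for \<psi> :: "real \<Rightarrow> 'b \<Rightarrow> real"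
  proof -
    show iP: "integrable P (\<lambda>(g, z). \<psi> g z)"
      unfolding P_def indep[symmetric] using i by (subst integrable_distr_eq) auto
    have "E (\<lambda>w. \<psi> (G w) (Z w)) = (LINT p|P. (case p of (g, z) \<Rightarrow> \<psi> g z))"
      unfolding P_def indep[symmetric] by (subst integral_distr) auto
    also have "\<dots> = (LINT z|distr M N Z. LINT g|distr M borel G. \<psi> g z)"
      using GZ.integral_snd[OF iP[unfolded P_def]] by (simp add: P_def)
    also have "\<dots> = (LINT z|distr M N Z. LINT x|\<gamma>. \<psi> (s * x) z)"
      unfolding law by (intro Bochner_Integration.integral_cong refl integral_distr) auto
    finally show "E (\<lambda>w. \<psi> (G w) (Z w)) = (LINT z|distr M N Z. LINT x|\<gamma>. \<psi> (s * x) z)" .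
    from GZ.AE_integrable_snd[OF iP[unfolded P_def]] AE_space
    show "AE z in distr M N Z. integrable \<gamma> (\<lambda>x. \<psi> (s * x) z)"
    proof eventually_elim
      case (elim z)
      then have [measurable]: "z \<in> space N" by simp
      from elim show ?case unfolding law by (subst (asm) integrable_distr_eq) auto
    qed
  qed
  have m3: "(\<lambda>(g, z). g * \<phi> g z) \<in> borel_measurable (borel \<Otimes>\<^sub>M N)" by measurable
  have "E (\<lambda>w. G w * \<phi> (G w) (Z w)) = (LINT z|distr M N Z. LINT x|\<gamma>. (s * x) * \<phi> (s * x) z)"
    by (rule eP[OF m3 int(3)])
  also have "\<dots> = (LINT z|distr M N Z. s\<^sup>2 * (LINT x|\<gamma>. \<phi>' (s * x) z))"
  proof (rule integral_cong_AE)
    show "(\<lambda>z. LINT x|\<gamma>. (s * x) * \<phi> (s * x) z) \<in> borel_measurable (distr M N Z)"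
      "(\<lambda>z. s\<^sup>2 * (LINT x|\<gamma>. \<phi>' (s * x) z)) \<in> borel_measurable (distr M N Z)"
      by measurable
    show "AE z in distr M N Z. (LINT x|\<gamma>. (s * x) * \<phi> (s * x) z) = s\<^sup>2 * (LINT x|\<gamma>. \<phi>' (s * x) z)"
      using AE[of \<phi>, OF assms(5) int(1)] AE[of \<phi>', OF assms(6) int(2)] AE[of "\<lambda>g z. g * \<phi> g z", OF m3 int(3)]
    proof eventually_elim
      case (elim z)
      show ?case
      proof (cases "s = 0")
        case False
        have ibp: "(LINT x|\<gamma>. x * \<phi> (s * x) z) = (LINT x|\<gamma>. s * \<phi>' (s * x) z)"
        proof (rule std_normal_integration_by_parts)
          show "((\<lambda>x. \<phi> (s * x) z) has_field_derivative s * \<phi>' (s * x) z) (at x)" for x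
          proof -
            have "((\<lambda>x. s * x) has_field_derivative s) (at x)" by (auto intro!: derivative_eq_intros)
            from DERIV_chain2[OF D[of z "s * x"] this] show ?thesis by (simp add: mult.commute)
          qed
          show "continuous_on UNIV (\<lambda>x. s * \<phi>' (s * x) z)"
            using continuous_on_compose2[OF cont[of z], of UNIV "\<lambda>x. s * x"] by (intro continuous_on_mult) (auto intro!: continuous_intros)
          show "integrable \<gamma> (\<lambda>x. x * \<phi> (s * x) z)"
            using integrable_mult_right[OF elim(3), of "1 / s"] False by (simp add: mult.assoc)
          show "integrable \<gamma> (\<lambda>x. \<phi> (s * x) z)" by (rule elim(1))
          show "integrable \<gamma> (\<lambda>x. s * \<phi>' (s * x) z)"
            by (rule integrable_mult_right[OF elim(2)])
        qed
        have "(LINT x|\<gamma>. (s * x) * \<phi> (s * x) z) = s * (LINT x|\<gamma>. x * \<phi> (s * x) z)"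
          unfolding mult.assoc by (rule integral_mult_right_zero)
        also have "\<dots> = s * (s * (LINT x|\<gamma>. \<phi>' (s * x) z))"
          unfolding ibp integral_mult_right_zero ..
        also have "\<dots> = s\<^sup>2 * (LINT x|\<gamma>. \<phi>' (s * x) z)"
          unfolding power2_eq_square mult.assoc ..
        finally show ?thesis .
      next
        case True
        show ?thesis unfolding True by (simp only: mult_zero_left power_zero_numeral Bochner_Integration.integral_zero)
      qed
    qed
  qed
  also have "\<dots> = s\<^sup>2 * E (\<lambda>w. \<phi>' (G w) (Z w))"
    using eP[of \<phi>', OF assms(6) int(2)] by simp
  finally show ?thesis .
qed

text \<open>Scaling a standard normal law covers the degenerate case \<open>s = 0\<close> without a case distinction.\<close>

definition centered_gaussian :: "'a measure \<Rightarrow> ('a \<Rightarrow> real) \<Rightarrow> bool" where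
  "centered_gaussian M X \<longleftrightarrow> X \<in> borel_measurable M \<and>
     (\<exists>s. distr M borel X = distr \<gamma> borel (\<lambda>x. s * x))"

lemma centered_gaussian_measurable: "centered_gaussian M X \<Longrightarrow> X \<in> borel_measurable M"
  by (simp add: centered_gaussian_def)

lemma (in prob_space) centered_gaussian_all_moments:
  assumes "centered_gaussian M X"
  shows "all_moments M X"
  unfolding all_moments_def
proof (intro conjI allI)
  from assms obtain s where law: "distr M borel X = distr \<gamma> borel (\<lambda>x. s * x)"
    by (auto simp: centered_gaussian_def)
  show X[measurable]: "X \<in> borel_measurable M" using assms by (rule centered_gaussian_measurable)
  fix n
  have "integrable lborel (\<lambda>x. \<bar>s\<bar> ^ n * (std_normal_density x * \<bar>x\<bar> ^ n))"
    by (intro integrable_mult_right integrable_std_normal_moment_abs)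
  then have "integrable \<gamma> (\<lambda>x. \<bar>s * x\<bar> ^ n)"
    by (subst integrable_density) (auto simp: abs_mult power_mult_distrib ac_simps)
  then have "integrable (distr \<gamma> borel (\<lambda>x. s * x)) (\<lambda>y. \<bar>y\<bar> ^ n)"
    by (subst integrable_distr_eq) auto
  then have "integrable (distr M borel X) (\<lambda>y. \<bar>y\<bar> ^ n)" by (simp only: law)
  then show "integrable M (\<lambda>w. \<bar>X w\<bar> ^ n)" by (subst (asm) integrable_distr_eq) auto
qed

lemma (in prob_space) centered_gaussian_law:
  assumes "centered_gaussian M X"
  obtains s where "distr M borel X = distr \<gamma> borel (\<lambda>x. s * x)"
    "E (\<lambda>w. (X w)\<^sup>2) = s\<^sup>2" "E X = 0"
    "\<And>\<theta>. (CLINT w|M. iexp (\<theta> * X w)) = complex_of_real (exp (- (\<theta> * s)\<^sup>2 / 2))"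
proof -
  from assms obtain s where law: "distr M borel X = distr \<gamma> borel (\<lambda>x. s * x)"
    by (auto simp: centered_gaussian_def)
  have X[measurable]: "X \<in> borel_measurable M" using assms by (rule centered_gaussian_measurable)
  have E: "(LINT w|M. f (X w)) = (LINT x|\<gamma>. f (s * x))"
    if [measurable]: "f \<in> borel_measurable borel" for f :: "real \<Rightarrow> 'b::{banach, second_countable_topology}"
  proof -
    have "(LINT w|M. f (X w)) = (LINT y|distr M borel X. f y)" by (subst integral_distr) auto
    also have "\<dots> = (LINT x|\<gamma>. f (s * x))"
      unfolding law by (subst integral_distr) auto
    finally show ?thesis .
  qed
  show thesis
  proof (rule that[OF law])
    have "E (\<lambda>w. (X w)\<^sup>2) = (LINT x|\<gamma>. (s * x)\<^sup>2)" by (rule E) simp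
    also have "\<dots> = s\<^sup>2 * (LINT x|\<gamma>. x\<^sup>2)"
      unfolding power_mult_distrib by (rule integral_mult_right_zero)
    also have "(LINT x|\<gamma>. x\<^sup>2) = 1"
      using std_normal_distribution_even_moments(1)[of 1] by simp
    finally show "E (\<lambda>w. (X w)\<^sup>2) = s\<^sup>2" by simp
    have "E X = (LINT x|\<gamma>. s * x)" by (rule E) simp
    also have "\<dots> = s * (LINT x|\<gamma>. x)" by (rule integral_mult_right_zero)
    also have "(LINT x|\<gamma>. x) = 0"
      using integral_std_normal_distribution_moment_odd[of 1] by simp
    finally show "E X = 0" by simp
    fix \<theta>
    have "(CLINT w|M. iexp (\<theta> * X w)) = (CLINT x|\<gamma>. iexp (\<theta> * (s * x)))"
      by (rule E) simp
    also have "\<dots> = char \<gamma> (\<theta> * s)"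
      unfolding char_def by (simp only: mult.assoc)
    finally show "(CLINT w|M. iexp (\<theta> * X w)) = complex_of_real (exp (- (\<theta> * s)\<^sup>2 / 2))"
      by (simp add: char_std_normal_distribution)
  qed
qed

lemma (in prob_space) centered_gaussian_char:
  assumes "centered_gaussian M X"
  shows "(CLINT w|M. iexp (X w)) = complex_of_real (exp (- E (\<lambda>w. (X w)\<^sup>2) / 2))"
proof -
  from centered_gaussian_law[OF assms] obtain s where
    s: "E (\<lambda>w. (X w)\<^sup>2) = s\<^sup>2"
    "\<And>\<theta>. (CLINT w|M. iexp (\<theta> * X w)) = complex_of_real (exp (- (\<theta> * s)\<^sup>2 / 2))" by blast
  show ?thesis using s(2)[of 1] by (simp add: s(1))
qed

text \<open>Closure under linear combinations makes any finite family in \<open>S\<close> jointly Gaussian, possibly with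
  singular covariance.\<close>

definition gaussian_space :: "'a measure \<Rightarrow> ('a \<Rightarrow> real) set \<Rightarrow> bool" where
  "gaussian_space M S \<longleftrightarrow> (\<forall>X\<in>S. centered_gaussian M X) \<and>
     (\<forall>X\<in>S. \<forall>Y\<in>S. \<forall>a b. (\<lambda>w. a * X w + b * Y w) \<in> S)"

lemma gaussian_space_gaussian: "gaussian_space M S \<Longrightarrow> X \<in> S \<Longrightarrow> centered_gaussian M X"
  by (simp add: gaussian_space_def)

lemma gaussian_space_lincomb:
  "gaussian_space M S \<Longrightarrow> X \<in> S \<Longrightarrow> Y \<in> S \<Longrightarrow> (\<lambda>w. a * X w + b * Y w) \<in> S"
  by (simp add: gaussian_space_def)

lemma gaussian_space_sum:
  assumes S: "gaussian_space M S" and ne: "S \<noteq> {}" and X: "\<And>i. i \<in> I \<Longrightarrow> X i \<in> S"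
  shows "(\<lambda>w. \<Sum>i\<in>I. \<theta> i * X i w) \<in> S"
  using X
proof (induction I rule: infinite_finite_induct)
  case (insert j I)
  have "(\<lambda>w. \<theta> j * X j w + 1 * (\<Sum>i\<in>I. \<theta> i * X i w)) \<in> S"
    using insert by (intro gaussian_space_lincomb[OF S]) auto
  then show ?case using insert.hyps by simp
next
  case empty
  from ne obtain Y where "Y \<in> S" by auto
  from gaussian_space_lincomb[OF S this this, of 0 0] show ?case by simp
next
  case (infinite I)
  from ne obtain Y where "Y \<in> S" by auto
  from gaussian_space_lincomb[OF S this this, of 0 0] show ?case using infinite by simp
qed

lemma (in prob_space) gaussian_space_mult_integrable:
  assumes "gaussian_space M S" "X \<in> S" "Y \<in> S"
  shows "integrable M (\<lambda>w. X w * Y w)"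
  using assms by (intro all_moments_integrable all_moments_mult centered_gaussian_all_moments gaussian_space_gaussian)

text \<open>For uncorrelated summands the variance of \<open>L + \<eta> G\<close> splits, and so does the characteristic function.\<close>

lemma (in prob_space) gaussian_space_uncorrelated_indep:
  assumes S: "gaussian_space M S" and G: "G \<in> S" and I: "finite I" and Z: "\<And>i. i \<in> I \<Longrightarrow> Z i \<in> S"
    and uncor: "\<And>i. i \<in> I \<Longrightarrow> E (\<lambda>w. Z i w * G w) = 0"
  shows "distr M (borel \<Otimes>\<^sub>M PiM I (\<lambda>_. borel)) (\<lambda>w. (G w, \<lambda>i\<in>I. Z i w)) =
    distr M borel G \<Otimes>\<^sub>M distr M (PiM I (\<lambda>_. borel)) (\<lambda>w. \<lambda>i\<in>I. Z i w)"
proof (rule joint_law_if_char_factorizes[OF I])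
  show "G \<in> borel_measurable M"
    using gaussian_space_gaussian[OF S G] by (rule centered_gaussian_measurable)
  show "Z i \<in> borel_measurable M" if "i \<in> I" for i
    using gaussian_space_gaussian[OF S Z[OF that]] by (rule centered_gaussian_measurable)
  fix \<eta> :: real and \<theta>
  define L where "L = (\<lambda>w. \<Sum>i\<in>I. \<theta> i * Z i w)"
  have L: "L \<in> S" unfolding L_def using S Z G by (intro gaussian_space_sum) auto
  have G': "(\<lambda>w. \<eta> * G w) \<in> S" using gaussian_space_lincomb[OF S G G, of \<eta> 0] by simp
  have LG: "(\<lambda>w. L w + \<eta> * G w) \<in> S" using gaussian_space_lincomb[OF S L G, of 1 \<eta>] by simp
  have "E (\<lambda>w. L w * G w) = E (\<lambda>w. \<Sum>i\<in>I. \<theta> i * (Z i w * G w))"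
    unfolding L_def by (simp only: sum_distrib_right mult.assoc)
  also have "\<dots> = (\<Sum>i\<in>I. \<theta> i * E (\<lambda>w. Z i w * G w))"
    using gaussian_space_mult_integrable[OF S Z G] by (subst Bochner_Integration.integral_sum) auto
  finally have 0: "E (\<lambda>w. L w * G w) = 0" using uncor by simp
  have "E (\<lambda>w. (L w + \<eta> * G w)\<^sup>2) = E (\<lambda>w. (L w * L w + (\<eta> * G w) * (\<eta> * G w)) + (2 * \<eta>) * (L w * G w))"
    by (intro lint_cong) (auto simp: power2_eq_square algebra_simps)
  also have "\<dots> = E (\<lambda>w. L w * L w) + E (\<lambda>w. (\<eta> * G w) * (\<eta> * G w)) + (2 * \<eta>) * E (\<lambda>w. L w * G w)"
    using gaussian_space_mult_integrable[OF S L L] gaussian_space_mult_integrable[OF S G' G'] gaussian_space_mult_integrable[OF S L G]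
    by (subst Bochner_Integration.integral_add; (intro Bochner_Integration.integrable_add integrable_mult_right)?; simp?)
  finally have v: "E (\<lambda>w. (L w + \<eta> * G w)\<^sup>2) = E (\<lambda>w. (L w)\<^sup>2) + E (\<lambda>w. (\<eta> * G w)\<^sup>2)"
    by (simp only: 0 power2_eq_square)
  have "(CLINT w|M. iexp (L w) * iexp (\<eta> * G w)) = (CLINT w|M. iexp (L w + \<eta> * G w))"
    by (simp only: of_real_add distrib_left exp_add)
  also have "\<dots> = complex_of_real (exp (- E (\<lambda>w. (L w)\<^sup>2) / 2)) * complex_of_real (exp (- E (\<lambda>w. (\<eta> * G w)\<^sup>2) / 2))"
    unfolding centered_gaussian_char[OF gaussian_space_gaussian[OF S LG]] v of_real_mult[symmetric] exp_add[symmetric]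
    by (simp add: field_simps)
  also have "\<dots> = (CLINT w|M. iexp (L w)) * (CLINT w|M. iexp (\<eta> * G w))"
    unfolding centered_gaussian_char[OF gaussian_space_gaussian[OF S L]] centered_gaussian_char[OF gaussian_space_gaussian[OF S G']] ..
  finally show "(CLINT w|M. iexp (\<Sum>i\<in>I. \<theta> i * Z i w) * iexp (\<eta> * G w)) =
       (CLINT w|M. iexp (\<Sum>i\<in>I. \<theta> i * Z i w)) * (CLINT w|M. iexp (\<eta> * G w))"
    unfolding L_def .
qed

text \<open>The regression coefficients \<open>c i\<close> make \<open>Z i = X i - c i G\<close> uncorrelated with \<open>G\<close>. Freezing \<open>Z\<close>, the
  product is a function of \<open>G\<close> alone, whose derivative is the sum over \<open>j\<close> of \<open>c j\<close> times the product with
  the \<open>j\<close>-th factor differentiated; and \<open>s\<^sup>2 c j\<close> is the covariance of \<open>G\<close> and \<open>X j\<close>.\<close>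

theorem (in prob_space) gaussian_integration_by_parts:
  fixes f f' :: "'i \<Rightarrow> real \<Rightarrow> real"
  assumes S: "gaussian_space M S" and G: "G \<in> S" and I: "finite I" and X: "\<And>i. i \<in> I \<Longrightarrow> X i \<in> S"
    and D: "\<And>i x. i \<in> I \<Longrightarrow> (f i has_field_derivative f' i x) (at x)"
    and cont: "\<And>i. i \<in> I \<Longrightarrow> continuous_on UNIV (f' i)"
    and mom: "\<And>i. i \<in> I \<Longrightarrow> all_moments M (\<lambda>w. f i (X i w))"
      "\<And>i. i \<in> I \<Longrightarrow> all_moments M (\<lambda>w. f' i (X i w))"
  shows "E (\<lambda>w. G w * (\<Prod>i\<in>I. f i (X i w))) =
    (\<Sum>j\<in>I. E (\<lambda>w. G w * X j w) * E (\<lambda>w. \<Prod>i\<in>I. (if i = j then f' i else f i) (X i w)))"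
proof -
  note gs = gaussian_space_gaussian[OF S]
  note am = centered_gaussian_all_moments[OF gs]
  have Gm[measurable]: "G \<in> borel_measurable M" using gs[OF G] by (rule centered_gaussian_measurable)
  from centered_gaussian_law[OF gs[OF G]] obtain s where
    law: "distr M borel G = distr \<gamma> borel (\<lambda>x. s * x)" and s: "E (\<lambda>w. (G w)\<^sup>2) = s\<^sup>2"
    by blast
  show ?thesis
  proof (cases "s = 0")
    case True
    have "AE w in M. (G w)\<^sup>2 = 0"
      using s True all_moments_integrable[OF all_moments_power[OF am[OF G], of 2]]
      by (subst integral_nonneg_eq_0_iff_AE[symmetric]) auto
    then have G0: "AE w in M. G w = 0" by simp
    have "E (\<lambda>w. G w * Y w) = 0" for Y
      by (rule integral_eq_zero_AE) (use G0 in eventually_elim, simp)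
    then show ?thesis by simp
  next
    case False
    define c where "c i = E (\<lambda>w. G w * X i w) / s\<^sup>2" for i
    define Z where "Z i = (\<lambda>w. 1 * X i w + (- c i) * G w)" for i
    have Z: "Z i \<in> S" if "i \<in> I" for i unfolding Z_def by (intro gaussian_space_lincomb[OF S] X that G)
    have XZ: "X i w = Z i w + c i * G w" for i w by (simp add: Z_def)
    have uncor: "E (\<lambda>w. Z i w * G w) = 0" if "i \<in> I" for i
    proof -
      have "E (\<lambda>w. Z i w * G w) = E (\<lambda>w. G w * X i w - c i * (G w)\<^sup>2)"
        by (intro lint_cong) (auto simp: Z_def algebra_simps power2_eq_square)
      also have "\<dots> = E (\<lambda>w. G w * X i w) - c i * s\<^sup>2"
        using gaussian_space_mult_integrable[OF S G X[OF that]] gaussian_space_mult_integrable[OF S G G] s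
        by (subst Bochner_Integration.integral_diff) (auto simp: power2_eq_square)
      finally show ?thesis using False by (simp add: c_def)
    qed
    have fc: "continuous_on UNIV (f i)" if "i \<in> I" for i
      by (intro continuous_at_imp_continuous_on ballI DERIV_isCont[OF D[OF that]])
    have fm[measurable]: "f i \<in> borel_measurable borel" "f' i \<in> borel_measurable borel" if "i \<in> I" for i
      using fc[OF that] cont[OF that] by (auto intro: borel_measurable_continuous_onI)
    define \<phi> where "\<phi> g z = (\<Prod>i\<in>I. f i (z i + c i * g))" for g z
    define \<phi>' where "\<phi>' g z = (\<Sum>j\<in>I. c j * (\<Prod>i\<in>I. (if i = j then f' i else f i) (z i + c i * g)))" for g z
    let ?Z = "\<lambda>w. \<lambda>i\<in>I. Z i w"
    have Zm: "?Z \<in> M \<rightarrow>\<^sub>M PiM I (\<lambda>_. borel)"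
      by (rule measurable_restrict) (use gs[OF Z] centered_gaussian_measurable in blast)
    have \<phi>e: "\<phi> (G w) (?Z w) = (\<Prod>i\<in>I. f i (X i w))" for w
      unfolding \<phi>_def by (intro prod.cong refl) (simp add: XZ)
    have \<phi>'e: "\<phi>' (G w) (?Z w) = (\<Sum>j\<in>I. c j * (\<Prod>i\<in>I. (if i = j then f' i else f i) (X i w)))" for w
      unfolding \<phi>'_def by (intro sum.cong prod.cong refl arg_cong2[where f="(*)"]) (simp add: XZ)
    have pm: "all_moments M (\<lambda>w. \<Prod>i\<in>I. (if i = j then f' i else f i) (X i w))" for j
      by (intro all_moments_prod) (use mom in auto)
    have p: "all_moments M (\<lambda>w. \<Prod>i\<in>I. f i (X i w))" by (intro all_moments_prod mom)
    have "E (\<lambda>w. G w * \<phi> (G w) (?Z w)) = s\<^sup>2 * E (\<lambda>w. \<phi>' (G w) (?Z w))"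
    proof (rule integration_by_parts_independent[OF Gm Zm gaussian_space_uncorrelated_indep[OF S G I Z uncor] law])
      show "(\<lambda>(g, z). \<phi> g z) \<in> borel_measurable (borel \<Otimes>\<^sub>M PiM I (\<lambda>_. borel))"
        unfolding \<phi>_def by measurable
      show "(\<lambda>(g, z). \<phi>' g z) \<in> borel_measurable (borel \<Otimes>\<^sub>M PiM I (\<lambda>_. borel))"
        unfolding \<phi>'_def case_prod_beta
      proof (intro borel_measurable_sum borel_measurable_times borel_measurable_prod)
        fix j i assume "i \<in> I"
        then have [measurable]: "i \<in> I" by simp
        have [measurable]: "(if i = j then f' i else f i) \<in> borel_measurable borel"
          by (cases "i = j") (use fm \<open>i \<in> I\<close> in auto)
        show "(\<lambda>x. (if i = j then f' i else f i) (snd x i + c i * fst x)) \<in> borel_measurable (borel \<Otimes>\<^sub>M PiM I (\<lambda>_. borel))"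
          by measurable
      qed simp
      fix z
      have dlin: "((\<lambda>g. z i + c i * g) has_field_derivative c i) (at g)" for i g
        by (auto intro!: derivative_eq_intros)
      show "((\<lambda>g. \<phi> g z) has_field_derivative \<phi>' g z) (at g)" for g
      proof -
        have fl: "((\<lambda>g. f i (z i + c i * g)) has_field_derivative c i * f' i (z i + c i * g)) (at g)" if "i \<in> I" for i
          using DERIV_chain2[OF D[OF that, of "z i + c i * g"] dlin] by (simp add: mult.commute)
        have "((\<lambda>g. \<phi> g z) has_field_derivative
            (\<Sum>j\<in>I. (c j * f' j (z j + c j * g)) * (\<Prod>i\<in>I - {j}. f i (z i + c i * g)))) (at g)"
          unfolding \<phi>_def by (rule has_field_derivative_prod) (rule fl)
        also have "(\<Sum>j\<in>I. (c j * f' j (z j + c j * g)) * (\<Prod>i\<in>I - {j}. f i (z i + c i * g))) = \<phi>' g z"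
          unfolding \<phi>'_def
        proof (intro sum.cong refl)
          fix j assume j: "j \<in> I"
          have "(\<Prod>i\<in>I - {j}. (if i = j then f' i else f i) (z i + c i * g)) = (\<Prod>i\<in>I - {j}. f i (z i + c i * g))"
            by (intro prod.cong) auto
          then show "(c j * f' j (z j + c j * g)) * (\<Prod>i\<in>I - {j}. f i (z i + c i * g)) =
              c j * (\<Prod>i\<in>I. (if i = j then f' i else f i) (z i + c i * g))"
            by (subst prod.remove[OF I j]) (simp add: mult.assoc)
        qed
        finally show ?thesis .
      qed
      show "continuous_on UNIV (\<lambda>g. \<phi>' g z)"
        unfolding \<phi>'_def
      proof (intro continuous_on_sum continuous_on_mult continuous_on_const continuous_on_prod)
        fix j i assume "i \<in> I"
        then have "continuous_on UNIV (if i = j then f' i else f i)" by (cases "i = j") (use fc cont in auto)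
        then show "continuous_on UNIV (\<lambda>g. (if i = j then f' i else f i) (z i + c i * g))"
          by (rule continuous_on_compose2) (auto intro!: continuous_intros)
      qed
    next
      show "integrable M (\<lambda>w. \<phi> (G w) (?Z w))" unfolding \<phi>e by (rule all_moments_integrable[OF p])
      show "integrable M (\<lambda>w. \<phi>' (G w) (?Z w))" unfolding \<phi>'e
        by (intro all_moments_integrable all_moments_sum all_moments_cmult pm)
      show "integrable M (\<lambda>w. G w * \<phi> (G w) (?Z w))" unfolding \<phi>e
        by (intro all_moments_integrable all_moments_mult am[OF G] p)
    qed
    then have "E (\<lambda>w. G w * (\<Prod>i\<in>I. f i (X i w))) =
      s\<^sup>2 * E (\<lambda>w. \<Sum>j\<in>I. c j * (\<Prod>i\<in>I. (if i = j then f' i else f i) (X i w)))"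
      unfolding \<phi>e \<phi>'e .
    also have "\<dots> = s\<^sup>2 * (\<Sum>j\<in>I. c j * E (\<lambda>w. \<Prod>i\<in>I. (if i = j then f' i else f i) (X i w)))"
      using all_moments_integrable[OF pm] by (subst Bochner_Integration.integral_sum) simp_all
    also have "\<dots> = (\<Sum>j\<in>I. E (\<lambda>w. G w * X j w) * E (\<lambda>w. \<Prod>i\<in>I. (if i = j then f' i else f i) (X i w)))"
      using False by (simp add: sum_distrib_left c_def)
    finally show ?thesis .
  qed
qed

section \<open>Hermite polynomials and their expectations\<close>

text \<open>The monic polynomials that are orthogonal for the centered Gaussian law of variance \<open>v\<close>;
  for \<open>v = 0\<close> they are the monomials.\<close>

fun hermite :: "real \<Rightarrow> nat \<Rightarrow> real \<Rightarrow> real" where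
  "hermite v 0 x = 1"
| "hermite v (Suc 0) x = x"
| "hermite v (Suc (Suc n)) x = x * hermite v (Suc n) x - v * real (Suc n) * hermite v n x"

lemma hermite_Suc: "hermite v (Suc n) x = x * hermite v n x - v * real n * hermite v (n - 1) x"
  by (cases n) auto

lemma hermite_deriv: "(hermite v n has_field_derivative real n * hermite v (n - 1) x) (at x)"
proof (induction v n x rule: hermite.induct)
  case (1 v x)
  have "hermite v 0 = (\<lambda>_. 1)" by auto
  then show ?case by simp
next
  case (2 v x)
  have "hermite v (Suc 0) = (\<lambda>x. x)" by auto
  then show ?case by simp
next
  case (3 v n x)
  have e: "hermite v (Suc (Suc n)) = (\<lambda>x. x * hermite v (Suc n) x - v * real (Suc n) * hermite v n x)" by auto
  have "((\<lambda>x. x * hermite v (Suc n) x - v * real (Suc n) * hermite v n x) has_field_derivative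
      (1 * hermite v (Suc n) x + (real (Suc n) * hermite v (Suc n - 1) x) * x) - v * real (Suc n) * (real n * hermite v (n - 1) x)) (at x)"
    by (intro DERIV_diff DERIV_mult DERIV_ident DERIV_cmult 3)
  also have "(1 * hermite v (Suc n) x + (real (Suc n) * hermite v (Suc n - 1) x) * x) - v * real (Suc n) * (real n * hermite v (n - 1) x) =
     real (Suc (Suc n)) * hermite v (Suc (Suc n) - 1) x"
    by (simp add: hermite_Suc[of v n] algebra_simps)
  finally show ?case unfolding e .
qed

lemma continuous_hermite: "continuous_on UNIV (hermite v n)"
  by (intro continuous_at_imp_continuous_on ballI DERIV_isCont[OF hermite_deriv])

lemma (in prob_space) all_moments_hermite:
  assumes "all_moments M X"
  shows "all_moments M (\<lambda>w. hermite v n (X w))"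
proof (induction n rule: less_induct)
  case (less n)
  show ?case
  proof (cases n)
    case 0
    then show ?thesis by (simp add: all_moments_const)
  next
    case (Suc k)
    show ?thesis unfolding Suc hermite_Suc
      by (intro all_moments_diff all_moments_mult all_moments_cmult assms less.IH) (use Suc in auto)
  qed
qed

text \<open>One factor \<open>U\<close> of the Hermite polynomial is integrated by parts. The term in which it meets
  another copy of \<open>U\<close> is cancelled by the recursion of the Hermite polynomials, because their parameter is the
  variance of \<open>U\<close>; only contractions of \<open>U\<close> with the other three variables remain.\<close>

lemma (in prob_space) hermite_integration_by_parts:
  assumes S: "gaussian_space M S" and XY: "X \<in> S" "Y \<in> S" and UV: "U \<in> S" "V \<in> S"
    and f: "\<And>x. (f has_field_derivative f' x) (at x)" "continuous_on UNIV f'"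
      "all_moments M (\<lambda>w. f (X w))" "all_moments M (\<lambda>w. f' (X w))"
    and g: "\<And>x. (g has_field_derivative g' x) (at x)" "continuous_on UNIV g'"
      "all_moments M (\<lambda>w. g (Y w))" "all_moments M (\<lambda>w. g' (Y w))"
    and v: "covar U U = v"
  shows "E (\<lambda>w. f (X w) * g (Y w) * hermite v (Suc p) (U w) * hermite v' m (V w)) =
     covar U X * E (\<lambda>w. f' (X w) * g (Y w) * hermite v p (U w) * hermite v' m (V w)) +
     covar U Y * E (\<lambda>w. f (X w) * g' (Y w) * hermite v p (U w) * hermite v' m (V w)) +
     covar U V * real m * E (\<lambda>w. f (X w) * g (Y w) * hermite v p (U w) * hermite v' (m - 1) (V w))"
proof -
  let ?F = "\<lambda>i::nat. [f, g, hermite v p, hermite v' m] ! i"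
  let ?F' = "\<lambda>i::nat. [f', g', (\<lambda>x. real p * hermite v (p - 1) x), (\<lambda>x. real m * hermite v' (m - 1) x)] ! i"
  let ?X = "\<lambda>i::nat. [X, Y, U, V] ! i"
  have amU: "all_moments M (\<lambda>w. U w)" and amV: "all_moments M (\<lambda>w. V w)"
    using UV by (auto intro!: centered_gaussian_all_moments gaussian_space_gaussian[OF S])
  have am4: "all_moments M (\<lambda>w. k1 (X w) * k2 (Y w) * hermite v a (U w) * hermite v' b (V w))"
    if "all_moments M (\<lambda>w. k1 (X w))" "all_moments M (\<lambda>w. k2 (Y w))" for k1 k2 a b
    by (intro all_moments_mult that all_moments_hermite amU amV)
  have "E (\<lambda>w. U w * (\<Prod>i\<in>{0,1,2,3}. ?F i (?X i w))) =
    (\<Sum>j\<in>{0,1,2,3}. E (\<lambda>w. U w * ?X j w) * E (\<lambda>w. \<Prod>i\<in>{0,1,2,3}. (if i = j then ?F' i else ?F i) (?X i w)))"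
  proof (rule gaussian_integration_by_parts[OF S UV(1)])
    fix i :: nat and x assume i: "i \<in> {0,1,2,3}"
    show "?X i \<in> S" using i XY UV by auto
    show "(?F i has_field_derivative ?F' i x) (at x)" using i f(1) g(1) hermite_deriv by auto
    show "continuous_on UNIV (?F' i)" using i f(2) g(2) by (auto intro!: continuous_intros continuous_hermite)
    show "all_moments M (\<lambda>w. ?F i (?X i w))" using i f(3) g(3)
      by (auto intro: all_moments_hermite[OF amU] all_moments_hermite[OF amV])
    show "all_moments M (\<lambda>w. ?F' i (?X i w))" using i f(4) g(4)
      by (auto intro: all_moments_cmult[OF all_moments_hermite[OF amU]] all_moments_cmult[OF all_moments_hermite[OF amV]])
  qed simp
  then have ibp: "E (\<lambda>w. U w * (f (X w) * g (Y w) * hermite v p (U w) * hermite v' m (V w))) =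
     covar U X * E (\<lambda>w. f' (X w) * g (Y w) * hermite v p (U w) * hermite v' m (V w)) +
     covar U Y * E (\<lambda>w. f (X w) * g' (Y w) * hermite v p (U w) * hermite v' m (V w)) +
     v * E (\<lambda>w. real p * (f (X w) * g (Y w) * hermite v (p - 1) (U w) * hermite v' m (V w))) +
     covar U V * E (\<lambda>w. real m * (f (X w) * g (Y w) * hermite v p (U w) * hermite v' (m - 1) (V w)))"
    using v by (simp add: ac_simps)
  have "E (\<lambda>w. f (X w) * g (Y w) * hermite v (Suc p) (U w) * hermite v' m (V w)) =
    E (\<lambda>w. U w * (f (X w) * g (Y w) * hermite v p (U w) * hermite v' m (V w)) -
      (v * real p) * (f (X w) * g (Y w) * hermite v (p - 1) (U w) * hermite v' m (V w)))"
    by (intro lint_cong) (auto simp: hermite_Suc algebra_simps)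
  also have "\<dots> = E (\<lambda>w. U w * (f (X w) * g (Y w) * hermite v p (U w) * hermite v' m (V w))) -
      (v * real p) * E (\<lambda>w. f (X w) * g (Y w) * hermite v (p - 1) (U w) * hermite v' m (V w))"
    using all_moments_integrable[OF all_moments_mult[OF amU am4[OF f(3) g(3), of p m]]]
      all_moments_integrable[OF am4[OF f(3) g(3), of "p - 1" m]]
    by (subst Bochner_Integration.integral_diff) (auto simp: ac_simps)
  finally show ?thesis unfolding ibp integral_mult_right_zero by (simp add: ac_simps)
qed

lemma abs_triangle_ineq3_sum: "\<bar>x + y + z\<bar> \<le> \<bar>x\<bar> + \<bar>y\<bar> + \<bar>z\<bar>" for x y z :: real
  by linarith

text \<open>The next three lemmas are purely algebraic. In the application, \<open>e i j p m\<close> is the expectation of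
  \<open>h\<^sup>(\<^sup>i\<^sup>)(X) h\<^sup>(\<^sup>j\<^sup>)(Y) H\<^sub>p(U) H\<^sub>m(V)\<close>, the numbers \<open>a\<close>, \<open>b\<close>, \<open>c\<close>, \<open>d\<close>, \<open>\<rho>\<close> are the covariances of the pairs
  \<open>(U,X)\<close>, \<open>(U,Y)\<close>, \<open>(V,X)\<close>, \<open>(V,Y)\<close>, \<open>(U,V)\<close>, and the recursions are integration by parts in \<open>U\<close> and,
  once \<open>U\<close> is used up, in \<open>V\<close>.\<close>

lemma contraction_bound_one_sided:
  fixes e :: "nat \<Rightarrow> nat \<Rightarrow> nat \<Rightarrow> nat \<Rightarrow> real"
  assumes R2: "\<And>i j m. i + Suc m \<le> N \<Longrightarrow> j + Suc m \<le> N \<Longrightarrow>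
      e i j 0 (Suc m) = c * e (Suc i) j 0 m + d * e i (Suc j) 0 m"
    and R0: "\<And>i j. i \<le> N \<Longrightarrow> j \<le> N \<Longrightarrow> \<bar>e i j 0 0\<bar> \<le> C"
    and "\<bar>c\<bar> \<le> \<delta>" "\<bar>d\<bar> \<le> \<delta>"
    and "i + m \<le> N" "j + m \<le> N"
  shows "\<bar>e i j 0 m\<bar> \<le> 2 ^ m * C * \<delta> ^ m"
  using assms(5,6)
proof (induction m arbitrary: i j)
  case 0
  then show ?case using R0 by simp
next
  case (Suc m)
  have IH: "\<bar>e (Suc i) j 0 m\<bar> \<le> 2 ^ m * C * \<delta> ^ m" "\<bar>e i (Suc j) 0 m\<bar> \<le> 2 ^ m * C * \<delta> ^ m"
    using Suc.prems by (auto intro!: Suc.IH)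
  have "\<bar>e i j 0 (Suc m)\<bar> \<le> \<bar>c\<bar> * \<bar>e (Suc i) j 0 m\<bar> + \<bar>d\<bar> * \<bar>e i (Suc j) 0 m\<bar>"
    unfolding R2[OF Suc.prems] by (simp flip: abs_mult)
  also have "\<dots> \<le> \<delta> * (2 ^ m * C * \<delta> ^ m) + \<delta> * (2 ^ m * C * \<delta> ^ m)"
    using assms(3,4) IH by (intro add_mono mult_mono) auto
  also have "\<dots> = 2 ^ Suc m * C * \<delta> ^ Suc m" by simp
  finally show ?case .
qed

text \<open>Each contraction yields a factor of at most \<open>\<delta>\<close>, and at least \<open>max p m\<close> contractions are needed to
  remove both polynomials, because one contraction can lower both degrees only by pairing \<open>U\<close> with \<open>V\<close>.\<close>

lemma contraction_bound:
  fixes e :: "nat \<Rightarrow> nat \<Rightarrow> nat \<Rightarrow> nat \<Rightarrow> real"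
  assumes R1: "\<And>i j p m. i + Suc p + m \<le> N \<Longrightarrow> j + Suc p + m \<le> N \<Longrightarrow>
      e i j (Suc p) m = a * e (Suc i) j p m + b * e i (Suc j) p m + \<rho> * real m * e i j p (m - 1)"
    and R2: "\<And>i j m. i + Suc m \<le> N \<Longrightarrow> j + Suc m \<le> N \<Longrightarrow>
      e i j 0 (Suc m) = c * e (Suc i) j 0 m + d * e i (Suc j) 0 m"
    and R0: "\<And>i j. i \<le> N \<Longrightarrow> j \<le> N \<Longrightarrow> \<bar>e i j 0 0\<bar> \<le> C"
    and le: "\<bar>a\<bar> \<le> \<delta>" "\<bar>b\<bar> \<le> \<delta>" "\<bar>\<rho>\<bar> \<le> \<delta>" "\<bar>c\<bar> \<le> \<delta>" "\<bar>d\<bar> \<le> \<delta>" "\<delta> \<le> 1"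
    and "i + p + m \<le> N" "j + p + m \<le> N"
  shows "\<bar>e i j p m\<bar> \<le> (2 * real N + 2) ^ N * C * \<delta> ^ max p m"
proof -
  let ?T = "\<lambda>p m. (real m + 2) ^ p * 2 ^ m * C"
  have \<delta>: "\<delta> \<ge> 0" using le(1) by linarith
  have C: "C \<ge> 0" using R0[of 0 0] by linarith
  have "\<bar>e i j p m\<bar> \<le> ?T p m * \<delta> ^ max p m"
    using assms(10,11)
  proof (induction p arbitrary: i j m)
    case 0
    then show ?case using contraction_bound_one_sided[where e=e and N=N and c=c and d=d and C=C, OF R2 R0 le(4,5), of i m j] by simp
  next
    case (Suc p)
    have IH: "\<bar>e (Suc i) j p m\<bar> \<le> ?T p m * \<delta> ^ max p m"
      "\<bar>e i (Suc j) p m\<bar> \<le> ?T p m * \<delta> ^ max p m"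
      using Suc.prems by (auto intro!: Suc.IH)
    have \<delta>1: "\<delta> * \<delta> ^ max p m \<le> \<delta> ^ max (Suc p) m"
      unfolding power_Suc[symmetric] by (rule power_decreasing) (use \<delta> le in auto)
    have 3: "\<bar>\<rho>\<bar> * real m * \<bar>e i j p (m - 1)\<bar> \<le> real m * (?T p m * \<delta> ^ max (Suc p) m)"
    proof (cases m)
      case (Suc k)
      have "\<bar>e i j p k\<bar> \<le> ?T p k * \<delta> ^ max p k"
        using Suc.prems Suc by (intro Suc.IH) auto
      also have "\<dots> \<le> ?T p m * \<delta> ^ max p k"
        using Suc \<delta> C by (intro mult_right_mono mult_mono power_mono) auto
      finally have "\<bar>\<rho>\<bar> * \<bar>e i j p k\<bar> \<le> \<delta> * (?T p m * \<delta> ^ max p k)"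
        using le \<delta> by (intro mult_mono) auto
      also have "\<dots> = ?T p m * \<delta> ^ max (Suc p) m" using Suc by simp
      finally have "real m * (\<bar>\<rho>\<bar> * \<bar>e i j p k\<bar>) \<le> real m * (?T p m * \<delta> ^ max (Suc p) m)"
        by (rule mult_left_mono) simp
      then show ?thesis using Suc by (simp add: ac_simps)
    qed simp
    have "\<bar>e i j (Suc p) m\<bar> \<le> \<bar>a\<bar> * \<bar>e (Suc i) j p m\<bar> + \<bar>b\<bar> * \<bar>e i (Suc j) p m\<bar> + \<bar>\<rho>\<bar> * real m * \<bar>e i j p (m - 1)\<bar>"
      unfolding R1[OF Suc.prems]
      using abs_triangle_ineq3_sum[of "a * e (Suc i) j p m" "b * e i (Suc j) p m" "\<rho> * real m * e i j p (m - 1)"] by (simp add: abs_mult)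
    also have "\<dots> \<le> \<delta> * (?T p m * \<delta> ^ max p m) + \<delta> * (?T p m * \<delta> ^ max p m)
        + real m * (?T p m * \<delta> ^ max (Suc p) m)"
      by (rule add_mono[OF add_mono[OF mult_mono[OF le(1) IH(1)] mult_mono[OF le(2) IH(2)]] 3]) (use \<delta> in auto)
    also have "\<dots> = (2 * (?T p m)) * (\<delta> * \<delta> ^ max p m)
        + real m * (?T p m * \<delta> ^ max (Suc p) m)" by (simp add: algebra_simps)
    also have "\<dots> \<le> (2 * (?T p m)) * (\<delta> ^ max (Suc p) m)
        + real m * (?T p m * \<delta> ^ max (Suc p) m)"
      using C by (intro add_right_mono mult_left_mono[OF \<delta>1]) auto
    also have "\<dots> = ?T (Suc p) m * \<delta> ^ max (Suc p) m" by (simp add: algebra_simps)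
    finally show ?case .
  qed
  also have "\<dots> \<le> (2 * real N + 2) ^ N * C * \<delta> ^ max p m"
  proof (intro mult_right_mono)
    have "(real m + 2) ^ p * 2 ^ m \<le> (2 * real N + 2) ^ p * (2 * real N + 2) ^ m"
      using assms(10) by (intro mult_mono power_mono) auto
    also have "\<dots> \<le> (2 * real N + 2) ^ N"
      unfolding power_add[symmetric] using assms(10) by (intro power_increasing) auto
    finally show "(real m + 2) ^ p * 2 ^ m \<le> (2 * real N + 2) ^ N" .
  qed (use \<delta> C in auto)
  finally show ?thesis .
qed

text \<open>Replacing \<open>H\<^sub>q(U)\<close> by \<open>\<beta>\<^sup>q\<close> and \<open>q\<close> derivatives of the first weight, one contraction at a time, costs at
  each step only the covariances \<open>a - \<beta>\<close>, \<open>b\<close> and \<open>\<rho>\<close>; the remaining factors are controlled by the preceding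
  bound. This is applied once to the pairing with \<open>H\<^sub>q(V)\<close> and once to the pairing with its
  replacement, where the missing powers of \<open>\<delta>\<close> come from \<open>\<beta>\<^sup>q\<close>.\<close>

lemma contraction_error_bound:
  fixes e :: "nat \<Rightarrow> nat \<Rightarrow> nat \<Rightarrow> nat \<Rightarrow> real"
  assumes R1: "\<And>i j p m. i + Suc p + m \<le> 2 * q \<Longrightarrow> j + Suc p + m \<le> 2 * q \<Longrightarrow>
      e i j (Suc p) m = a * e (Suc i) j p m + b * e i (Suc j) p m + \<rho> * real m * e i j p (m - 1)"
    and R2: "\<And>i j m. i + Suc m \<le> 2 * q \<Longrightarrow> j + Suc m \<le> 2 * q \<Longrightarrow>
      e i j 0 (Suc m) = c * e (Suc i) j 0 m + d * e i (Suc j) 0 m"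
    and R0: "\<And>i j. i \<le> 2 * q \<Longrightarrow> j \<le> 2 * q \<Longrightarrow> \<bar>e i j 0 0\<bar> \<le> C"
    and le: "\<bar>a\<bar> \<le> \<delta>" "\<bar>b\<bar> \<le> \<delta>" "\<bar>\<rho>\<bar> \<le> \<delta>" "\<bar>c\<bar> \<le> \<delta>" "\<bar>d\<bar> \<le> \<delta>" "\<delta> \<le> 1"
    and \<beta>: "\<bar>\<beta>\<bar> \<le> \<delta>"
  shows "\<bar>e 0 0 q q - \<beta> ^ q * e q 0 0 q - \<beta> ^ q * e 0 q q 0 + \<beta> ^ q * \<beta> ^ q * e q q 0 0\<bar> \<le>
     2 * real q ^ 2 * ((2 * real (2 * q) + 2) ^ (2 * q) * C) * ((\<bar>a - \<beta>\<bar> + \<bar>b\<bar>) * \<delta> ^ q + \<bar>\<rho>\<bar> * \<delta> ^ (q - 1))"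
proof -
  define K where "K = (2 * real (2 * q) + 2) ^ (2 * q) * C"
  define x where "x = \<bar>a - \<beta>\<bar> + \<bar>b\<bar>"
  have bound: "\<bar>e i j p m\<bar> \<le> K * \<delta> ^ max p m" if "i + p + m \<le> 2 * q" "j + p + m \<le> 2 * q" for i j p m
    unfolding K_def using contraction_bound[where e=e and N="2 * q" and c=c and d=d and C=C and a=a and b=b and \<rho>=\<rho>, OF R1 R2 R0 le that] by simp
  have \<delta>: "\<delta> \<ge> 0" using le(1) by linarith
  have C: "C \<ge> 0" using R0[of 0 0] by linarith
  have K: "K \<ge> 0" unfolding K_def using C by simp
  have x: "x \<ge> 0" by (simp add: x_def)
  have \<beta>1: "\<bar>\<beta>\<bar> \<le> 1" using \<beta> le by linarith
  have step: "\<bar>e i j (Suc p) m - \<beta> * e (Suc i) j p m\<bar> \<le> K * (x * \<delta> ^ max p m + real m * \<bar>\<rho>\<bar> * \<delta> ^ max p (m - 1))"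
    if "i + Suc p + m \<le> 2 * q" "j + Suc p + m \<le> 2 * q" for i j p m
  proof -
    have b: "\<bar>e (Suc i) j p m\<bar> \<le> K * \<delta> ^ max p m" "\<bar>e i (Suc j) p m\<bar> \<le> K * \<delta> ^ max p m"
      "\<bar>e i j p (m - 1)\<bar> \<le> K * \<delta> ^ max p (m - 1)"
      using that by (auto intro!: bound)
    have "e i j (Suc p) m - \<beta> * e (Suc i) j p m = (a - \<beta>) * e (Suc i) j p m + b * e i (Suc j) p m + (\<rho> * real m) * e i j p (m - 1)"
      using R1[OF that] by (simp add: algebra_simps)
    also have "\<bar>\<dots>\<bar> \<le> \<bar>a - \<beta>\<bar> * \<bar>e (Suc i) j p m\<bar> + \<bar>b\<bar> * \<bar>e i (Suc j) p m\<bar> + (\<bar>\<rho>\<bar> * real m) * \<bar>e i j p (m - 1)\<bar>"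
      using abs_triangle_ineq3_sum[of "(a - \<beta>) * e (Suc i) j p m" "b * e i (Suc j) p m" "(\<rho> * real m) * e i j p (m - 1)"] by (simp add: abs_mult)
    also have "\<dots> \<le> \<bar>a - \<beta>\<bar> * (K * \<delta> ^ max p m) + \<bar>b\<bar> * (K * \<delta> ^ max p m) + (\<bar>\<rho>\<bar> * real m) * (K * \<delta> ^ max p (m - 1))"
      using b by (intro add_mono mult_left_mono) auto
    finally show ?thesis by (simp add: x_def algebra_simps)
  qed
  have D1: "\<bar>e i 0 p q - \<beta> ^ p * e (i + p) 0 0 q\<bar> \<le> real p * (K * (x * \<delta> ^ q + real q * \<bar>\<rho>\<bar> * \<delta> ^ (q - 1)))"
    if "i + p \<le> q" for i p
    using that
  proof (induction p arbitrary: i)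
    case (Suc p)
    have m: "max p q = q" "max p (q - 1) = q - 1" using Suc.prems by auto
    have "\<bar>e i 0 (Suc p) q - \<beta> ^ Suc p * e (i + Suc p) 0 0 q\<bar> \<le>
       \<bar>e i 0 (Suc p) q - \<beta> * e (Suc i) 0 p q\<bar> + \<bar>\<beta>\<bar> * \<bar>e (Suc i) 0 p q - \<beta> ^ p * e (Suc i + p) 0 0 q\<bar>"
      unfolding abs_mult[symmetric] by (rule order_trans[OF _ abs_triangle_ineq]) (simp add: algebra_simps)
    also have "\<dots> \<le> K * (x * \<delta> ^ q + real q * \<bar>\<rho>\<bar> * \<delta> ^ (q - 1)) + 1 * (real p * (K * (x * \<delta> ^ q + real q * \<bar>\<rho>\<bar> * \<delta> ^ (q - 1))))"
      using step[of i p q 0] Suc.prems Suc.IH[of "Suc i"] \<beta>1 unfolding m by (intro add_mono mult_mono) auto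
    finally show ?case by (simp add: algebra_simps)
  qed simp
  have D2: "\<bar>e i q p 0 - \<beta> ^ p * e (i + p) q 0 0\<bar> \<le> real p * (K * x)"
    if "i + p \<le> q" for i p
    using that
  proof (induction p arbitrary: i)
    case (Suc p)
    have "\<bar>e i q (Suc p) 0 - \<beta> ^ Suc p * e (i + Suc p) q 0 0\<bar> \<le>
       \<bar>e i q (Suc p) 0 - \<beta> * e (Suc i) q p 0\<bar> + \<bar>\<beta>\<bar> * \<bar>e (Suc i) q p 0 - \<beta> ^ p * e (Suc i + p) q 0 0\<bar>"
      unfolding abs_mult[symmetric] by (rule order_trans[OF _ abs_triangle_ineq]) (simp add: algebra_simps)
    also have "\<dots> \<le> K * (x * \<delta> ^ p) + 1 * (real p * (K * x))"
      using step[of i p 0 q] Suc.prems Suc.IH[of "Suc i"] \<beta>1 by (intro add_mono mult_mono) auto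
    also have "\<dots> \<le> K * (x * 1) + 1 * (real p * (K * x))"
      using K x le \<delta> by (intro add_mono mult_left_mono power_le_one) auto
    finally show ?case by (simp add: algebra_simps)
  qed simp
  have \<beta>q: "\<bar>\<beta> ^ q\<bar> \<le> \<delta> ^ q" using \<beta> by (simp add: power_abs power_mono)
  have "\<bar>e 0 0 q q - \<beta> ^ q * e q 0 0 q - \<beta> ^ q * e 0 q q 0 + \<beta> ^ q * \<beta> ^ q * e q q 0 0\<bar>
     \<le> \<bar>e 0 0 q q - \<beta> ^ q * e (0 + q) 0 0 q\<bar> + \<bar>\<beta> ^ q\<bar> * \<bar>e 0 q q 0 - \<beta> ^ q * e (0 + q) q 0 0\<bar>"
    unfolding abs_mult[symmetric] by (rule order_trans[OF _ abs_triangle_ineq4]) (simp add: algebra_simps)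
  also have "\<dots> \<le> real q * (K * (x * \<delta> ^ q + real q * \<bar>\<rho>\<bar> * \<delta> ^ (q - 1))) + \<delta> ^ q * (real q * (K * x))"
    using D1[of 0 q] D2[of 0 q] \<beta>q \<delta> by (intro add_mono mult_mono) auto
  also have "\<dots> = 2 * real q * (K * (x * \<delta> ^ q)) + real q ^ 2 * (K * (\<bar>\<rho>\<bar> * \<delta> ^ (q - 1)))"
    by (simp add: algebra_simps power2_eq_square)
  also have "\<dots> \<le> 2 * real q ^ 2 * (K * (x * \<delta> ^ q)) + 2 * real q ^ 2 * (K * (\<bar>\<rho>\<bar> * \<delta> ^ (q - 1)))"
  proof (intro add_mono mult_right_mono)
    show "2 * real q \<le> 2 * (real q)\<^sup>2"
      by (cases q) (auto simp: power2_eq_square algebra_simps)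
  qed (use K x \<delta> in auto)
  finally show ?thesis by (simp add: K_def x_def algebra_simps)
qed

text \<open>Here \<open>h i\<close> stands for the \<open>i\<close>-th derivative of the weight \<open>h 0\<close>. Contracting both polynomials completely
  may differentiate one and the same weight \<open>2 q\<close> times, whence the number of derivatives.\<close>

theorem (in prob_space) hermite_product_expectation_bound:
  fixes h :: "nat \<Rightarrow> real \<Rightarrow> real"
  assumes S: "gaussian_space M S" and XY: "X \<in> S" "Y \<in> S" and UV: "U \<in> S" "V \<in> S"
    and h: "\<And>i x. i < 2 * q \<Longrightarrow> (h i has_field_derivative h (Suc i) x) (at x)"
      "\<And>i. i \<le> 2 * q \<Longrightarrow> continuous_on UNIV (h i)"
    and mX: "\<And>i. i \<le> 2 * q \<Longrightarrow> all_moments M (\<lambda>w. h i (X w))"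
    and mY: "\<And>i. i \<le> 2 * q \<Longrightarrow> all_moments M (\<lambda>w. h i (Y w))"
    and bX: "\<And>i. i \<le> 2 * q \<Longrightarrow> E (\<lambda>w. (h i (X w))\<^sup>2) \<le> C"
    and bY: "\<And>i. i \<le> 2 * q \<Longrightarrow> E (\<lambda>w. (h i (Y w))\<^sup>2) \<le> C"
    and vU: "covar U U = \<delta>" and vV: "covar V V = \<delta>"
    and \<delta>: "\<delta> \<le> 1" and \<beta>: "\<bar>\<beta>\<bar> \<le> \<delta>"
    and a: "\<bar>covar U X\<bar> \<le> \<delta>"
    and b: "\<bar>covar U Y\<bar> \<le> \<delta>"
    and c: "\<bar>covar V X\<bar> \<le> \<delta>"
    and d: "\<bar>covar V Y\<bar> \<le> \<delta>"
    and \<rho>: "\<bar>covar U V\<bar> \<le> \<delta>"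
  shows "\<bar>E (\<lambda>w. (h 0 (X w) * hermite \<delta> q (U w) - \<beta> ^ q * h q (X w)) *
      (h 0 (Y w) * hermite \<delta> q (V w) - \<beta> ^ q * h q (Y w)))\<bar> \<le>
     2 * real q ^ 2 * ((2 * real (2 * q) + 2) ^ (2 * q) * C) *
      ((\<bar>covar U X - \<beta>\<bar> + \<bar>covar U Y\<bar>) * \<delta> ^ q +
        \<bar>covar U V\<bar> * \<delta> ^ (q - 1))"
proof -
  define e where "e i j p m = E (\<lambda>w. h i (X w) * h j (Y w) * hermite \<delta> p (U w) * hermite \<delta> m (V w))" for i j p m
  have amU: "all_moments M (\<lambda>w. U w)" and amV: "all_moments M (\<lambda>w. V w)"
    using UV by (auto intro!: centered_gaussian_all_moments gaussian_space_gaussian[OF S])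
  have int: "integrable M (\<lambda>w. h i (X w) * h j (Y w) * hermite \<delta> p (U w) * hermite \<delta> m (V w))"
    if "i \<le> 2 * q" "j \<le> 2 * q" for i j p m
    by (intro all_moments_integrable all_moments_mult mX mY that all_moments_hermite amU amV)
  have R0: "\<bar>e i j 0 0\<bar> \<le> C" if ij: "i \<le> 2 * q" "j \<le> 2 * q" for i j
  proof -
    have i2: "integrable M (\<lambda>w. (h i (X w))\<^sup>2)" "integrable M (\<lambda>w. (h j (Y w))\<^sup>2)"
      by (intro all_moments_integrable all_moments_power mX mY ij)+
    have "\<bar>e i j 0 0\<bar> \<le> E (\<lambda>w. \<bar>h i (X w) * h j (Y w)\<bar>)"
      unfolding e_def by simp
    also have "\<dots> \<le> E (\<lambda>w. ((h i (X w))\<^sup>2 + (h j (Y w))\<^sup>2) / 2)"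
    proof (rule integral_mono)
      show "integrable M (\<lambda>w. \<bar>h i (X w) * h j (Y w)\<bar>)" using int[OF ij, of 0 0] by simp
      show "integrable M (\<lambda>w. ((h i (X w))\<^sup>2 + (h j (Y w))\<^sup>2) / 2)" using i2 by simp
      show "\<bar>h i (X w) * h j (Y w)\<bar> \<le> ((h i (X w))\<^sup>2 + (h j (Y w))\<^sup>2) / 2" for w
        using sum_squares_bound[of "\<bar>h i (X w)\<bar>" "\<bar>h j (Y w)\<bar>"] by (simp add: abs_mult)
    qed
    also have "\<dots> = (E (\<lambda>w. (h i (X w))\<^sup>2) + E (\<lambda>w. (h j (Y w))\<^sup>2)) / 2"
      using i2 by simp
    also have "\<dots> \<le> C" using bX[OF ij(1)] bY[OF ij(2)] by simp
    finally show ?thesis .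
  qed
  have lin: "E (\<lambda>w. F w - k * F1 w - k * F2 w + l * F3 w) =
      E F - k * E F1 - k * E F2 + l * E F3"
    if "integrable M F" "integrable M F1" "integrable M F2" "integrable M F3" for F F1 F2 F3 :: "'a \<Rightarrow> real" and k l
    using that by simp
  have "E (\<lambda>w. (h 0 (X w) * hermite \<delta> q (U w) - \<beta> ^ q * h q (X w)) *
      (h 0 (Y w) * hermite \<delta> q (V w) - \<beta> ^ q * h q (Y w))) =
    E (\<lambda>w. h 0 (X w) * h 0 (Y w) * hermite \<delta> q (U w) * hermite \<delta> q (V w)
      - \<beta> ^ q * (h q (X w) * h 0 (Y w) * hermite \<delta> 0 (U w) * hermite \<delta> q (V w))
      - \<beta> ^ q * (h 0 (X w) * h q (Y w) * hermite \<delta> q (U w) * hermite \<delta> 0 (V w))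
      + (\<beta> ^ q * \<beta> ^ q) * (h q (X w) * h q (Y w) * hermite \<delta> 0 (U w) * hermite \<delta> 0 (V w)))"
    by (intro lint_cong) (auto simp: algebra_simps)
  also have "\<dots> = e 0 0 q q - \<beta> ^ q * e q 0 0 q - \<beta> ^ q * e 0 q q 0 + \<beta> ^ q * \<beta> ^ q * e q q 0 0"
    unfolding e_def by (rule lin; intro int; simp)
  finally have eq: "E (\<lambda>w. (h 0 (X w) * hermite \<delta> q (U w) - \<beta> ^ q * h q (X w)) *
      (h 0 (Y w) * hermite \<delta> q (V w) - \<beta> ^ q * h q (Y w))) =
     e 0 0 q q - \<beta> ^ q * e q 0 0 q - \<beta> ^ q * e 0 q q 0 + \<beta> ^ q * \<beta> ^ q * e q q 0 0" .
  show ?thesis unfolding eq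
  proof (rule contraction_error_bound[where c = "covar V X" and d = "covar V Y"])
    fix i j p m
    { assume "i + Suc p + m \<le> 2 * q" "j + Suc p + m \<le> 2 * q"
      then show "e i j (Suc p) m = covar U X * e (Suc i) j p m + covar U Y * e i (Suc j) p m +
          covar U V * real m * e i j p (m - 1)"
        unfolding e_def
        by (intro hermite_integration_by_parts[OF S XY UV h(1) h(2) mX mX h(1) h(2) mY mY vU]) auto }
    { assume *: "i + Suc m \<le> 2 * q" "j + Suc m \<le> 2 * q"
      \<comment> \<open>The same formula with the roles of \<open>U\<close> and \<open>V\<close> exchanged; \<open>hermite \<delta> 0\<close> is constant, so \<open>U\<close> drops out.\<close>
      have "E (\<lambda>w. h i (X w) * h j (Y w) * hermite \<delta> (Suc m) (V w) * hermite \<delta> 0 (U w)) =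
        covar V X * E (\<lambda>w. h (Suc i) (X w) * h j (Y w) * hermite \<delta> m (V w) * hermite \<delta> 0 (U w)) +
        covar V Y * E (\<lambda>w. h i (X w) * h (Suc j) (Y w) * hermite \<delta> m (V w) * hermite \<delta> 0 (U w)) +
        covar V U * real 0 * E (\<lambda>w. h i (X w) * h j (Y w) * hermite \<delta> m (V w) * hermite \<delta> (0 - 1) (U w))"
        using * by (intro hermite_integration_by_parts[OF S XY UV(2,1) h(1) h(2) mX mX h(1) h(2) mY mY vV]) auto
      then show "e i j 0 (Suc m) = covar V X * e (Suc i) j 0 m + covar V Y * e i (Suc j) 0 m"
        unfolding e_def by simp }
    { assume "i \<le> 2 * q" "j \<le> 2 * q"
      then show "\<bar>e i j 0 0\<bar> \<le> C" by (rule R0) }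
  qed (use a b c d \<rho> \<delta> \<beta> in auto)
qed

section \<open>Covariances on a uniform grid\<close>

definition apow :: "real \<Rightarrow> real \<Rightarrow> real" where
  "apow \<theta> x = \<bar>x\<bar> powr \<theta>"

lemma apow_nonneg: "apow \<theta> x \<ge> 0"
  by (simp add: apow_def)

lemma apow_0 [simp]: "apow \<theta> 0 = 0"
  and apow_1 [simp]: "apow \<theta> 1 = 1"
  and apow_minus: "apow \<theta> (- x) = apow \<theta> x"
  by (simp_all add: apow_def)

lemma apow_minus_commute: "apow \<theta> (x - y) = apow \<theta> (y - x)"
  by (simp add: apow_def abs_minus_commute)

lemma apow_mono: "0 \<le> \<theta> \<Longrightarrow> 0 \<le> x \<Longrightarrow> x \<le> y \<Longrightarrow> apow \<theta> x \<le> apow \<theta> y"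
  by (simp add: apow_def powr_mono2)

text \<open>For \<open>z \<le> x + y\<close> the ratio \<open>z / (x + y)\<close> lies in the unit interval, where raising to the power \<open>\<theta>\<close>
  increases it; the two ratios for \<open>x\<close> and \<open>y\<close> add up to \<open>1\<close>.\<close>

lemma powr_add_le_add_powr:
  fixes x y :: real
  assumes "0 \<le> \<theta>" "\<theta> \<le> 1" "0 \<le> x" "0 \<le> y"
  shows "(x + y) powr \<theta> \<le> x powr \<theta> + y powr \<theta>"
proof (cases "x + y = 0")
  case False
  then have s: "x + y > 0" using assms by simp
  have part: "z / (x + y) * (x + y) powr \<theta> \<le> z powr \<theta>" if "0 \<le> z" "z \<le> x + y" for z
  proof -
    have "z / (x + y) = (z / (x + y)) powr 1" using that s by simp
    also have "\<dots> \<le> (z / (x + y)) powr \<theta>" using that s assms by (intro powr_mono') auto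
    also have "\<dots> = z powr \<theta> / (x + y) powr \<theta>" using that s by (simp add: powr_divide)
    finally show ?thesis using s by (simp add: field_simps)
  qed
  have "x / (x + y) + y / (x + y) = 1" using s by (simp flip: add_divide_distrib)
  then have "(x + y) powr \<theta> = x / (x + y) * (x + y) powr \<theta> + y / (x + y) * (x + y) powr \<theta>"
    by (metis distrib_right mult_1)
  also have "\<dots> \<le> x powr \<theta> + y powr \<theta>" using assms by (intro add_mono part) auto
  finally show ?thesis .
qed simp

lemma apow_diff_le:
  assumes "0 \<le> \<theta>" "\<theta> \<le> 1"
  shows "\<bar>apow \<theta> x - apow \<theta> y\<bar> \<le> apow \<theta> (x - y)"
proof -
  have *: "apow \<theta> x \<le> apow \<theta> y + apow \<theta> (x - y)" for x y
  proof -
    have "\<bar>x\<bar> powr \<theta> \<le> (\<bar>y\<bar> + \<bar>x - y\<bar>) powr \<theta>" using assms by (intro powr_mono2) auto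
    also have "\<dots> \<le> \<bar>y\<bar> powr \<theta> + \<bar>x - y\<bar> powr \<theta>" using assms by (intro powr_add_le_add_powr) auto
    finally show ?thesis by (simp add: apow_def)
  qed
  show ?thesis using *[of x y] *[of y x] by (simp add: apow_minus_commute[of _ y x] abs_le_iff)
qed

lemma apow_second_difference_nonpos:
  assumes "0 < \<theta>" "\<theta> \<le> 1" "1 \<le> x"
  shows "apow \<theta> (x + 1) + apow \<theta> (x - 1) \<le> 2 * apow \<theta> x"
proof -
  have der: "((\<lambda>x. x powr \<theta>) has_field_derivative \<theta> * z powr (\<theta> - 1)) (at z)" if "z > 0" for z :: real
    using that by (auto intro!: derivative_eq_intros)
  have cont: "continuous_on {u..v} (\<lambda>x. x powr \<theta>)" if "0 \<le> u" for u v :: real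
    using assms that by (intro continuous_on_powr' continuous_intros) auto
  have dif: "(\<lambda>x. x powr \<theta>) differentiable (at z)" if "z > 0" for z :: real
    using der[OF that] real_differentiable_def by blast
  obtain l1 z1 where z1: "x < z1" "z1 < x + 1" "DERIV (\<lambda>x. x powr \<theta>) z1 :> l1" "(x + 1) powr \<theta> - x powr \<theta> = (x + 1 - x) * l1"
    using MVT[of x "x + 1" "\<lambda>x. x powr \<theta>"] cont[of x "x + 1"] dif assms by force
  obtain l2 z2 where z2: "x - 1 < z2" "z2 < x" "DERIV (\<lambda>x. x powr \<theta>) z2 :> l2" "x powr \<theta> - (x - 1) powr \<theta> = (x - (x - 1)) * l2"
    using MVT[of "x - 1" x "\<lambda>x. x powr \<theta>"] cont[of "x - 1" x] dif assms by force
  have "l1 = \<theta> * z1 powr (\<theta> - 1)" using z1 assms by (intro DERIV_unique[OF z1(3) der]) auto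
  moreover have "l2 = \<theta> * z2 powr (\<theta> - 1)" using z2 assms by (intro DERIV_unique[OF z2(3) der]) auto
  moreover have "z1 powr (\<theta> - 1) \<le> z2 powr (\<theta> - 1)" using z1 z2 assms by (intro powr_mono2') auto
  ultimately have "l1 \<le> l2" using assms by simp
  then show ?thesis using z1(4) z2(4) assms by (simp add: apow_def)
qed

text \<open>With \<open>\<theta> = 2 H\<close>, these are the covariances of the \<open>k\<close>-th increment with the value at time \<open>l\<close> and with the
  \<open>l\<close>-th increment for the grid of mesh \<open>1\<close>. By self-similarity the mesh \<open>1 / n\<close> only adds the
  factor \<open>n\<^sup>-\<^sup>2\<^sup>H\<close>.\<close>

definition fbm_cov :: "real \<Rightarrow> nat \<Rightarrow> nat \<Rightarrow> real" where
  "fbm_cov \<theta> k l = (apow \<theta> (real k + 1) - apow \<theta> (real k) - apow \<theta> (real k + 1 - real l) + apow \<theta> (real k - real l)) / 2"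

definition fbm_incr_cov :: "real \<Rightarrow> nat \<Rightarrow> nat \<Rightarrow> real" where
  "fbm_incr_cov \<theta> k l = (apow \<theta> (real k - real l + 1) + apow \<theta> (real k - real l - 1) - 2 * apow \<theta> (real k - real l)) / 2"

lemma abs_fbm_cov_le_1:
  assumes "0 \<le> \<theta>" "\<theta> \<le> 1"
  shows "\<bar>fbm_cov \<theta> k l\<bar> \<le> 1"
  using apow_diff_le[OF assms, of "real k + 1" "real k"] apow_diff_le[OF assms, of "real k + 1 - real l" "real k - real l"]
  by (simp add: fbm_cov_def)

lemma abs_fbm_incr_cov_le_1:
  assumes "0 \<le> \<theta>" "\<theta> \<le> 1"
  shows "\<bar>fbm_incr_cov \<theta> k l\<bar> \<le> 1"
  using apow_diff_le[OF assms, of "real k - real l + 1" "real k - real l"] apow_diff_le[OF assms, of "real k - real l - 1" "real k - real l"]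
  by (simp add: fbm_incr_cov_def apow_minus)

text \<open>The sum telescopes on either side of \<open>l\<close>, where the function decreases and increases respectively.\<close>

lemma sum_apow_increments:
  assumes "0 \<le> \<theta>"
  shows "(\<Sum>k<m. \<bar>apow \<theta> (real k + 1 - real l) - apow \<theta> (real k - real l)\<bar>) =
    (if m \<le> l then apow \<theta> (real l) - apow \<theta> (real l - real m) else apow \<theta> (real l) + apow \<theta> (real m - real l))"
proof (induction m)
  case (Suc m)
  consider "m < l" | "m \<ge> l" by linarith
  then show ?case
  proof cases
    case 1
    have "apow \<theta> (real l - (real m + 1)) \<le> apow \<theta> (real l - real m)"
      using assms 1 by (intro apow_mono) auto
    then show ?thesis using 1 Suc
      by (simp add: apow_minus_commute[of _ "real m" "real l"] apow_minus_commute[of _ "1 + real m" "real l"] add.commute)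
  next
    case 2
    have "apow \<theta> (real m - real l) \<le> apow \<theta> (real m + 1 - real l)"
      using assms 2 by (intro apow_mono) auto
    then show ?thesis using 2 Suc by (auto simp: add.commute)
  qed
qed simp

lemma sum_abs_fbm_cov_le:
  assumes "0 \<le> \<theta>" "l \<le> n"
  shows "(\<Sum>k<n. \<bar>fbm_cov \<theta> k l\<bar>) \<le> 3 / 2 * real n powr \<theta>"
proof -
  have "(\<Sum>k<n. \<bar>fbm_cov \<theta> k l\<bar>) \<le> (\<Sum>k<n. (\<bar>apow \<theta> (real k + 1 - real 0) - apow \<theta> (real k - real 0)\<bar>
      + \<bar>apow \<theta> (real k + 1 - real l) - apow \<theta> (real k - real l)\<bar>) / 2)"
    unfolding fbm_cov_def by (intro sum_mono) auto
  also have "\<dots> = ((\<Sum>k<n. \<bar>apow \<theta> (real k + 1 - real 0) - apow \<theta> (real k - real 0)\<bar>) +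
      (\<Sum>k<n. \<bar>apow \<theta> (real k + 1 - real l) - apow \<theta> (real k - real l)\<bar>)) / 2"
    by (simp only: sum.distrib sum_divide_distrib[symmetric])
  also have "\<dots> \<le> 3 / 2 * apow \<theta> (real n)"
    using apow_mono[of \<theta> "real l" "real n"] apow_mono[of \<theta> "real n - real l" "real n"] assms apow_nonneg[of \<theta> "real l - real n"]
    unfolding sum_apow_increments[OF assms(1)] by (auto simp: apow_nonneg)
  finally show ?thesis by (simp add: apow_def)
qed

lemma sum_abs_fbm_cov_diagonal:
  assumes "0 \<le> \<theta>"
  shows "(\<Sum>k<n. \<bar>fbm_cov \<theta> k k + 1 / 2\<bar>) = real n powr \<theta> / 2"
proof -
  have "(\<Sum>k<n. \<bar>fbm_cov \<theta> k k + 1 / 2\<bar>) = (\<Sum>k<n. \<bar>apow \<theta> (real k + 1 - real 0) - apow \<theta> (real k - real 0)\<bar> / 2)"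
  proof (intro sum.cong refl)
    fix k
    have "fbm_cov \<theta> k k + 1 / 2 = (apow \<theta> (real k + 1 - real 0) - apow \<theta> (real k - real 0)) / 2"
      by (simp add: fbm_cov_def field_simps)
    then show "\<bar>fbm_cov \<theta> k k + 1 / 2\<bar> = \<bar>apow \<theta> (real k + 1 - real 0) - apow \<theta> (real k - real 0)\<bar> / 2"
      by (simp only: abs_divide abs_numeral)
  qed
  also have "\<dots> = real n powr \<theta> / 2"
    unfolding sum_divide_distrib[symmetric] sum_apow_increments[OF assms] by (auto simp: apow_def)
  finally show ?thesis .
qed

text \<open>By concavity, distinct increments are nonpositively correlated, so the sum of the absolute
  values telescopes on either side of \<open>l\<close> to at most \<open>1/2\<close>; the diagonal term is \<open>1\<close>.\<close>

lemma sum_abs_fbm_incr_cov_le: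
  assumes \<theta>: "0 < \<theta>" "\<theta> \<le> 1"
  shows "(\<Sum>k<n. \<bar>fbm_incr_cov \<theta> k l\<bar>) \<le> 2"
proof -
  define D where "D x = apow \<theta> x - apow \<theta> (x - 1)" for x :: real
  have D0: "D x \<ge> 0" if "x \<ge> 1" for x unfolding D_def using apow_mono[of \<theta> "x - 1" x] \<theta> that by simp
  have Dm: "D (x + 1) \<le> D x" if "x \<ge> 1" for x
    unfolding D_def using apow_second_difference_nonpos[OF \<theta> that] by simp
  have D1: "D 1 = 1" by (simp add: D_def)
  have s: "2 * \<bar>fbm_incr_cov \<theta> k l\<bar> = D (\<bar>real k - real l\<bar>) - D (\<bar>real k - real l\<bar> + 1)" if "k \<noteq> l" for k
  proof -
    define x where "x = \<bar>real k - real l\<bar>"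
    have x: "x \<ge> 1" using that unfolding x_def by linarith
    have "2 * fbm_incr_cov \<theta> k l = apow \<theta> (x + 1) + apow \<theta> (x - 1) - 2 * apow \<theta> x"
    proof (cases "k \<ge> l")
      case True
      then have "x = real k - real l" by (simp add: x_def)
      then show ?thesis by (simp add: fbm_incr_cov_def)
    next
      case False
      then have e: "x = real l - real k" by (simp add: x_def)
      have "apow \<theta> (real k - real l + 1) = apow \<theta> (x - 1)" "apow \<theta> (real k - real l - 1) = apow \<theta> (x + 1)"
        "apow \<theta> (real k - real l) = apow \<theta> x"
        unfolding e apow_def by (auto intro!: arg_cong2[where f="(powr)"])
      then show ?thesis by (simp add: fbm_incr_cov_def)
    qed
    then have "2 * fbm_incr_cov \<theta> k l = D (x + 1) - D x" by (simp add: D_def)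
    then show ?thesis using Dm[OF x] unfolding x_def[symmetric] by simp
  qed
  \<comment> \<open>A closed form of the partial sums, by induction through the cases \<open>m < l\<close>, \<open>m = l\<close> and \<open>m > l\<close>; the term for \<open>k = l\<close> contributes \<open>2\<close> to \<open>4 = D 1 + 2 + D 1\<close>.\<close>
  have closed: "2 * (\<Sum>k<m. \<bar>fbm_incr_cov \<theta> k l\<bar>) \<le>
      (if m \<le> l then D (real l - real m + 1) - D (real l + 1) else 4 - D (real l + 1) - D (real m - real l))" for m
  proof (induction m)
    case (Suc m)
    consider "m < l" | "m = l" | "m > l" by linarith
    then show ?case
    proof cases
      case 1
      then have "\<bar>real m - real l\<bar> = real l - real m" by simp
      then show ?thesis using 1 Suc s[of m] by (simp add: algebra_simps)
    next
      case 2
      have "\<bar>fbm_incr_cov \<theta> m l\<bar> = 1" using 2 by (simp add: fbm_incr_cov_def apow_def)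
      then show ?thesis using 2 Suc D1 by (simp add: algebra_simps)
    next
      case 3
      then have "\<bar>real m - real l\<bar> = real m - real l" by simp
      then show ?thesis using 3 Suc s[of m] by (simp add: algebra_simps)
    qed
  qed simp
  have "2 * (\<Sum>k<n. \<bar>fbm_incr_cov \<theta> k l\<bar>) \<le> 4"
  proof (cases "n \<le> l")
    case True
    have decr: "D (1 + real j) \<le> 1" for j :: nat
    proof (induction j)
      case (Suc j)
      show ?case using Suc Dm[of "1 + real j"] by (simp add: add.commute)
    qed (simp add: D1)
    have "real l - real n + 1 = 1 + real (l - n)" using True by simp
    then have "D (real l - real n + 1) \<le> 1" using decr by metis
    then show ?thesis using closed[of n] True D0[of "real l + 1"] by simp
  next
    case False
    then show ?thesis using closed[of n] D0[of "real l + 1"] D0[of "real n - real l"] by simp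
  qed
  then show ?thesis by simp
qed

section \<open>Riemann sums along a process\<close>

text \<open>The pathwise integral in the limit agrees only almost surely with a measurable function, for the
  process is jointly measurable only up to a null set.\<close>

lemma measurable_completion_if_AE_eq:
  fixes f g :: "'a \<Rightarrow> real"
  assumes f[measurable]: "f \<in> borel_measurable M" and eq: "AE x in M. f x = g x"
  shows "g \<in> borel_measurable (completion M)"
proof (rule measurableI)
  fix A :: "real set" assume A: "A \<in> sets borel"
  from eq obtain N where N: "{x \<in> space M. f x \<noteq> g x} \<subseteq> N" "N \<in> null_sets M"
    by (auto elim!: AE_E simp: null_sets_def)
  have "g -` A \<inter> space (completion M) = ((f -` A \<inter> space M) - N) \<union> (g -` A \<inter> space M \<inter> N)"
    using N(1) by auto
  moreover have "(f -` A \<inter> space M) - N \<in> sets M"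
    using A N(2) by (intro sets.Diff measurable_sets[OF f]) auto
  ultimately show "g -` A \<inter> space (completion M) \<in> sets (completion M)"
    by (intro sets_completionI[where N' = N]) (use N(2) in auto)
qed simp

lemma power4_diff_le: "(a - b) ^ 4 \<le> 8 * (a ^ 4 + b ^ 4)" for a b :: real
proof -
  have "(a - b)\<^sup>2 \<le> 2 * (a\<^sup>2 + b\<^sup>2)" using zero_le_power2[of "a + b"] by (simp add: power2_eq_square algebra_simps)
  then have "((a - b)\<^sup>2)\<^sup>2 \<le> (2 * (a\<^sup>2 + b\<^sup>2))\<^sup>2" by (intro power_mono) auto
  also have "\<dots> \<le> 8 * ((a\<^sup>2)\<^sup>2 + (b\<^sup>2)\<^sup>2)"
    using zero_le_power2[of "a\<^sup>2 - b\<^sup>2"] by (simp add: power2_eq_square algebra_simps)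
  finally show ?thesis by simp
qed

text \<open>Where both arguments are bounded by \<open>K\<close> and close to each other, uniform continuity of \<open>g\<close> on a compact
  interval applies. Elsewhere one of \<open>x\<^sup>2 / K\<^sup>2\<close>, \<open>y\<^sup>2 / K\<^sup>2\<close>, \<open>(x - y)\<^sup>2 / \<eta>1\<^sup>2\<close> is at least \<open>1\<close>, and the squared difference
  \<open>D\<close> is split by \<open>D \<le> \<kappa> D\<^sup>2 + 1 / \<kappa>\<close>. The resulting pointwise inequality is integrated; this plays the role of uniform
  integrability and only uses fourth moments of \<open>g(B)\<close>. The function \<open>\<rho>\<close> is a modulus of continuity of \<open>B\<close> in \<open>L\<^sup>2\<close>.\<close>

lemma (in prob_space) composition_uniformly_L2_continuous:
  fixes B :: "real \<Rightarrow> 'a \<Rightarrow> real"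
  assumes g: "continuous_on UNIV g"
    and mom: "\<And>t. t \<in> T \<Longrightarrow> all_moments M (B t)" "\<And>t. t \<in> T \<Longrightarrow> all_moments M (\<lambda>w. g (B t w))"
    and B2: "\<And>t. t \<in> T \<Longrightarrow> E (\<lambda>w. (B t w)\<^sup>2) \<le> C"
    and g4: "\<And>t. t \<in> T \<Longrightarrow> E (\<lambda>w. (g (B t w)) ^ 4) \<le> C"
    and incr: "\<And>s t. s \<in> T \<Longrightarrow> t \<in> T \<Longrightarrow> E (\<lambda>w. (B s w - B t w)\<^sup>2) \<le> \<rho> \<bar>s - t\<bar>"
    and mod: "(\<rho> \<longlongrightarrow> 0) (at_right 0)" "\<rho> 0 = 0"
    and \<epsilon>: "\<epsilon> > 0" and C: "C \<ge> 0"
  obtains \<eta> where "\<eta> > 0" "\<And>s t. s \<in> T \<Longrightarrow> t \<in> T \<Longrightarrow> \<bar>s - t\<bar> < \<eta> \<Longrightarrow>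
     E (\<lambda>w. (g (B s w) - g (B t w))\<^sup>2) \<le> \<epsilon>"
proof -
  \<comment> \<open>\<open>\<kappa>\<close>, \<open>K\<close> and then the modulus are chosen so that each of the four summands of \<open>pointwise\<close> contributes at most \<open>\<epsilon> / 4\<close>.\<close>
  define \<kappa> where "\<kappa> = \<epsilon> / (4 * (16 * C + 1))"
  have \<kappa>: "\<kappa> > 0" using \<epsilon> C by (simp add: \<kappa>_def)
  have \<kappa>C: "\<kappa> * (16 * C) \<le> \<epsilon> / 4"
  proof -
    have "\<kappa> * (16 * C) \<le> \<kappa> * (16 * C + 1)" using \<kappa> by simp
    also have "\<dots> = \<epsilon> / 4" using C by (simp add: \<kappa>_def field_simps)
    finally show ?thesis .
  qed
  define K where "K = sqrt ((8 * C + 1) / (\<kappa> * \<epsilon>))"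
  have K: "K > 0" using \<kappa> \<epsilon> C by (simp add: K_def)
  have K2: "2 * C / (\<kappa> * K\<^sup>2) \<le> \<epsilon> / 4"
  proof -
    have "\<kappa> * K\<^sup>2 = (8 * C + 1) / \<epsilon>" using \<kappa> \<epsilon> C by (simp add: K_def)
    moreover have "2 * C / ((8 * C + 1) / \<epsilon>) \<le> \<epsilon> / 4" using \<epsilon> C by (simp add: field_simps)
    ultimately show ?thesis by simp
  qed
  have "uniformly_continuous_on {-K..K} g"
    by (intro compact_uniformly_continuous continuous_on_subset[OF g]) auto
  then obtain \<eta>1 where \<eta>1: "\<eta>1 > 0" "\<And>x y. x \<in> {-K..K} \<Longrightarrow> y \<in> {-K..K} \<Longrightarrow> \<bar>x - y\<bar> < \<eta>1 \<Longrightarrow> \<bar>g x - g y\<bar> < sqrt (\<epsilon> / 4)"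
    unfolding uniformly_continuous_on_def dist_real_def using \<epsilon>
    by (metis abs_minus_commute divide_pos_pos real_sqrt_gt_0_iff zero_less_numeral)
  have "eventually (\<lambda>x. \<rho> x < \<epsilon> * \<kappa> * \<eta>1\<^sup>2 / 4) (at_right 0)"
    by (rule order_tendstoD(2)[OF mod(1)]) (use \<epsilon> \<kappa> \<eta>1 in auto)
  then obtain \<eta> where \<eta>: "\<eta> > 0" "\<And>x. x > 0 \<Longrightarrow> x < \<eta> \<Longrightarrow> \<rho> x < \<epsilon> * \<kappa> * \<eta>1\<^sup>2 / 4"
    unfolding eventually_at_right_field by auto
  have pointwise: "(g x - g y)\<^sup>2 \<le> \<epsilon> / 4 + \<kappa> * (8 * ((g x) ^ 4 + (g y) ^ 4)) + (x\<^sup>2 + y\<^sup>2) / (\<kappa> * K\<^sup>2) + (x - y)\<^sup>2 / (\<kappa> * \<eta>1\<^sup>2)" for x y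
  proof (cases "x \<in> {-K..K} \<and> y \<in> {-K..K} \<and> \<bar>x - y\<bar> < \<eta>1")
    case True
    then have "\<bar>g x - g y\<bar> < sqrt (\<epsilon> / 4)" using \<eta>1 by blast
    then have "\<bar>g x - g y\<bar>\<^sup>2 \<le> (sqrt (\<epsilon> / 4))\<^sup>2" by (intro power_mono) auto
    then have "(g x - g y)\<^sup>2 \<le> \<epsilon> / 4" using \<epsilon> by simp
    moreover have "0 \<le> \<kappa> * (8 * ((g x) ^ 4 + (g y) ^ 4))" "0 \<le> (x\<^sup>2 + y\<^sup>2) / (\<kappa> * K\<^sup>2)" "0 \<le> (x - y)\<^sup>2 / (\<kappa> * \<eta>1\<^sup>2)"
      using \<kappa> by auto
    ultimately show ?thesis by linarith
  next
    case False
    define D where "D = (g x - g y)\<^sup>2"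
    have "(\<kappa> * D - 1)\<^sup>2 \<ge> 0" by simp
    then have "2 * (\<kappa> * D) \<le> (\<kappa> * D)\<^sup>2 + 1" by (simp add: power2_diff)
    moreover have "(\<kappa> * D)\<^sup>2 \<ge> 0" "\<kappa> * D \<ge> 0" using \<kappa> by (auto simp: D_def)
    ultimately have "\<kappa> * D \<le> (\<kappa> * D)\<^sup>2 + 1" by linarith
    then have 1: "D \<le> \<kappa> * D\<^sup>2 + 1 / \<kappa>" using \<kappa> by (simp add: field_simps power2_eq_square)
    have "D\<^sup>2 = (g x - g y) ^ 4" by (simp add: D_def)
    then have "\<kappa> * D\<^sup>2 \<le> \<kappa> * (8 * ((g x) ^ 4 + (g y) ^ 4))" using power4_diff_le[of "g x" "g y"] \<kappa> by simp
    moreover have "1 \<le> (x\<^sup>2 + y\<^sup>2) / K\<^sup>2 + (x - y)\<^sup>2 / \<eta>1\<^sup>2"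
    proof -
      have n: "0 \<le> x\<^sup>2 / K\<^sup>2" "0 \<le> y\<^sup>2 / K\<^sup>2" "0 \<le> (x - y)\<^sup>2 / \<eta>1\<^sup>2" by auto
      have sq: "1 \<le> z\<^sup>2 / c\<^sup>2" if "c \<le> \<bar>z\<bar>" "c > 0" for z c :: real
        using power_mono[OF that(1), of 2] that(2) by (simp add: field_simps)
      have "1 \<le> x\<^sup>2 / K\<^sup>2 \<or> 1 \<le> y\<^sup>2 / K\<^sup>2 \<or> 1 \<le> (x - y)\<^sup>2 / \<eta>1\<^sup>2"
        using False sq[of K x] sq[of K y] sq[of \<eta>1 "x - y"] K \<eta>1(1) by fastforce
      then show ?thesis using n unfolding add_divide_distrib by linarith
    qed
    then have "1 / \<kappa> * 1 \<le> 1 / \<kappa> * ((x\<^sup>2 + y\<^sup>2) / K\<^sup>2 + (x - y)\<^sup>2 / \<eta>1\<^sup>2)" using \<kappa> by (intro mult_left_mono) auto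
    then have "1 / \<kappa> \<le> (x\<^sup>2 + y\<^sup>2) / (\<kappa> * K\<^sup>2) + (x - y)\<^sup>2 / (\<kappa> * \<eta>1\<^sup>2)"
      by (simp only: distrib_left times_divide_times_eq mult_1 mult_1_right)
    ultimately show ?thesis using 1 \<epsilon> unfolding D_def by linarith
  qed
  show thesis
  proof (rule that[OF \<eta>(1)])
    fix s t assume st: "s \<in> T" "t \<in> T" and d: "\<bar>s - t\<bar> < \<eta>"
    have i: "integrable M (\<lambda>w. (g (B s w)) ^ 4)" "integrable M (\<lambda>w. (g (B t w)) ^ 4)"
      "integrable M (\<lambda>w. (B s w)\<^sup>2)" "integrable M (\<lambda>w. (B t w)\<^sup>2)" "integrable M (\<lambda>w. (B s w - B t w)\<^sup>2)"
      "integrable M (\<lambda>w. (g (B s w) - g (B t w))\<^sup>2)"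
      by (intro all_moments_integrable all_moments_power all_moments_diff mom st)+
    have "\<rho> \<bar>s - t\<bar> \<le> \<epsilon> * \<kappa> * \<eta>1\<^sup>2 / 4"
      using \<eta>(2)[of "\<bar>s - t\<bar>"] d mod(2) \<epsilon> \<kappa> by (cases "s = t") auto
    then have inc: "E (\<lambda>w. (B s w - B t w)\<^sup>2) / (\<kappa> * \<eta>1\<^sup>2) \<le> \<epsilon> / 4"
      using incr[OF st] \<kappa> \<eta>1(1) by (simp add: field_simps)
    have "E (\<lambda>w. (g (B s w) - g (B t w))\<^sup>2) \<le>
      E (\<lambda>w. \<epsilon> / 4 + \<kappa> * (8 * ((g (B s w)) ^ 4 + (g (B t w)) ^ 4)) + ((B s w)\<^sup>2 + (B t w)\<^sup>2) / (\<kappa> * K\<^sup>2) + (B s w - B t w)\<^sup>2 / (\<kappa> * \<eta>1\<^sup>2))"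
      using i by (intro integral_mono pointwise) auto
    also have "\<dots> = \<epsilon> / 4 + \<kappa> * (8 * (E (\<lambda>w. (g (B s w)) ^ 4) + E (\<lambda>w. (g (B t w)) ^ 4)))
       + (E (\<lambda>w. (B s w)\<^sup>2) + E (\<lambda>w. (B t w)\<^sup>2)) / (\<kappa> * K\<^sup>2) + E (\<lambda>w. (B s w - B t w)\<^sup>2) / (\<kappa> * \<eta>1\<^sup>2)"
      using i by (simp add: prob_space)
    also have "\<dots> \<le> \<epsilon> / 4 + \<kappa> * (8 * (C + C)) + (C + C) / (\<kappa> * K\<^sup>2) + \<epsilon> / 4"
      using g4[OF st(1)] g4[OF st(2)] B2[OF st(1)] B2[OF st(2)] \<kappa> inc by (intro add_mono mult_left_mono divide_right_mono) auto
    also have "\<dots> \<le> \<epsilon>" using \<kappa>C K2 by simp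
    finally show "E (\<lambda>w. (g (B s w) - g (B t w))\<^sup>2) \<le> \<epsilon>" .
  qed
qed

lemma (in prob_space) square_expectation_le_nn_integral:
  fixes X :: "'a \<Rightarrow> real"
  assumes [measurable]: "X \<in> borel_measurable M"
  shows "ennreal ((E X)\<^sup>2) \<le> (\<integral>\<^sup>+ x. ennreal ((X x)\<^sup>2) \<partial>M)"
proof (cases "integrable M (\<lambda>x. (X x)\<^sup>2)")
  case True
  then have iX: "integrable M X" by (rule square_integrable_imp_integrable[rotated]) simp
  have "0 \<le> variance X" by (rule variance_positive)
  also have "variance X = E (\<lambda>x. (X x)\<^sup>2) - (E X)\<^sup>2" using iX True by (rule variance_eq)
  finally have "(E X)\<^sup>2 \<le> E (\<lambda>x. (X x)\<^sup>2)" by simp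
  then show ?thesis using True by (subst nn_integral_eq_integral) (auto intro!: ennreal_leI)
next
  case False
  then have "(\<integral>\<^sup>+ x. ennreal ((X x)\<^sup>2) \<partial>M) = \<infinity>"
    by (auto simp: integrable_iff_bounded less_top[symmetric])
  then show ?thesis by simp
qed

definition unif01 :: "real measure" where
  "unif01 = restrict_space lborel {0..1}"

lemma space_unif01 [simp]: "space unif01 = {0..1}"
  by (simp add: unif01_def space_restrict_space)

lemma sets_unif01 [measurable_cong]: "sets unif01 = sets (restrict_space borel {0..1})"
  unfolding unif01_def by (intro sets_restrict_space_cong) simp

lemma prob_space_unif01: "prob_space unif01"
proof (rule prob_spaceI)
  show "emeasure unif01 (space unif01) = 1"
    unfolding space_unif01 unfolding unif01_def by (subst emeasure_restrict_space) auto
qed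

lemma AE_unif01: "(AE u in unif01. P u) \<longleftrightarrow> (AE u in lborel. u \<in> {0..1} \<longrightarrow> P u)"
  unfolding unif01_def by (rule AE_restrict_space_iff) simp

text \<open>Translation between the pathwise integral over \<open>{0..1}\<close> with respect to completed Lebesgue measure and
  integration over a probability space, for integrands measurable up to a null set.\<close>

lemma lebesgue_integral_unif01:
  fixes \<phi> \<psi> :: "real \<Rightarrow> real"
  assumes \<psi>: "\<psi> \<in> borel_measurable unif01" and eq: "AE u in unif01. \<psi> u = \<phi> u"
  shows "(LINT u:{0..1}|lebesgue. \<phi> u) = (LINT u|unif01. \<psi> u)"
proof -
  have m: "(\<lambda>u. indicator {0..1} u *\<^sub>R \<psi> u) \<in> borel_measurable lborel"
    using \<psi> unfolding unif01_def by (subst (asm) borel_measurable_restrict_space_iff) auto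
  have e: "AE u in lborel. indicator {0..1} u *\<^sub>R \<psi> u = indicator {0..1} u *\<^sub>R \<phi> u"
    using eq unfolding AE_unif01 by eventually_elim (auto simp: indicator_def)
  have "(LINT u:{0..1}|lebesgue. \<phi> u) = (LINT u|lebesgue. indicator {0..1} u *\<^sub>R \<psi> u)"
    unfolding set_lebesgue_integral_def
  proof (rule integral_cong_AE)
    show "(\<lambda>u. indicator {0..1} u *\<^sub>R \<phi> u) \<in> borel_measurable lebesgue"
      using measurable_completion_if_AE_eq[OF m] e by simp
    show "(\<lambda>u. indicator {0..1} u *\<^sub>R \<psi> u) \<in> borel_measurable lebesgue"
      using m by (rule measurable_completion)
    show "AE u in lebesgue. indicator {0..1} u *\<^sub>R \<phi> u = indicator {0..1} u *\<^sub>R \<psi> u"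
      by (rule AE_completion) (use e in eventually_elim, auto)
  qed
  also have "\<dots> = (LINT u|lborel. indicator {0..1} u *\<^sub>R \<psi> u)" by (rule integral_completion[OF m])
  also have "\<dots> = (LINT u|unif01. \<psi> u)"
    unfolding unif01_def by (subst integral_restrict_space) auto
  finally show ?thesis .
qed

abbreviation cell :: "nat \<Rightarrow> nat \<Rightarrow> real set" where
  "cell n k \<equiv> {real k / real n..<real (Suc k) / real n}"

lemma integral_step_function:
  fixes c :: "nat \<Rightarrow> real"
  assumes n: "n > 0"
  shows "(LINT u|unif01. (\<Sum>k<n. indicator (cell n k) u * c k)) = (\<Sum>k<n. c k) / real n"
proof -
  interpret L: prob_space unif01 by (rule prob_space_unif01)
  have ms: "cell n k \<inter> {0..1} \<in> sets unif01" for k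
    unfolding unif01_def by (auto simp: sets_restrict_space)
  have me: "measure unif01 (cell n k \<inter> {0..1}) = 1 / real n" if "k < n" for k
  proof -
    have sub: "cell n k \<subseteq> {0..1}"
    proof
      fix x assume x: "x \<in> cell n k"
      have "0 \<le> real k / real n" "real (Suc k) / real n \<le> 1" using that n by (auto simp: field_simps)
      then show "x \<in> {0..1}" using x
        by (meson atLeastAtMost_iff atLeastLessThan_iff order_trans less_imp_le)
    qed
    then have "measure unif01 (cell n k \<inter> {0..1}) = measure lborel (cell n k)"
      unfolding unif01_def by (subst measure_restrict_space) (auto simp: Int_absorb2)
    also have "\<dots> = real (Suc k) / real n - real k / real n" using n by (simp add: divide_right_mono)
    finally show ?thesis using n by (simp add: field_simps)
  qed
  have e: "(LINT u|unif01. indicator (cell n k) u) = measure unif01 (cell n k \<inter> {0..1})" for k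
    using Bochner_Integration.integral_indicator[of unif01 "cell n k"] by simp
  have i: "integrable unif01 (\<lambda>u. indicator (cell n k) u * c k)" for k
  proof (rule L.integrable_const_bound[where B="\<bar>c k\<bar>"])
    show "(\<lambda>u. indicator (cell n k) u * c k) \<in> borel_measurable unif01"
      unfolding unif01_def by (intro measurable_restrict_space1) measurable
  qed (auto simp: indicator_def)
  have "(LINT u|unif01. (\<Sum>k<n. indicator (cell n k) u * c k)) =
     (\<Sum>k<n. measure unif01 (cell n k \<inter> {0..1}) * c k)"
    using i by (subst Bochner_Integration.integral_sum) (auto simp: e)
  also have "\<dots> = (\<Sum>k<n. c k) / real n" by (simp add: me sum_divide_distrib del: of_nat_Suc)
  finally show ?thesis .
qed

lemma sum_indicator_partition:
  assumes n: "n > 0" and u: "0 \<le> u" "u < 1"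
  shows "\<exists>k<n. \<bar>real k / real n - u\<bar> < 1 / real n * 2 \<and>
    (\<forall>c :: nat \<Rightarrow> real. (\<Sum>k<n. indicator (cell n k) u * c k) = c k)"
proof -
  define k where "k = nat \<lfloor>u * real n\<rfloor>"
  have k: "real k \<le> u * real n" "u * real n < real k + 1" using u n unfolding k_def by (auto simp: of_nat_nat)
  have "u * real n < real n" using u n by simp
  then have kn: "k < n" using k by linarith
  have iff: "u \<in> cell n j \<longleftrightarrow> j = k" for j
  proof -
    have "u \<in> cell n j \<longleftrightarrow> real j \<le> u * real n \<and> u * real n < real j + 1"
      using n by (auto simp: field_simps)
    then show ?thesis using k by (auto; linarith)
  qed
  have "(\<Sum>j<n. indicator (cell n j) u * c j) = c k" for c :: "nat \<Rightarrow> real"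
  proof -
  have "(\<Sum>j<n. indicator (cell n j) u * c j) = (\<Sum>j<n. if j = k then c j else 0)"
    by (intro sum.cong refl) (use iff in \<open>simp add: indicator_def\<close>)
  also have "\<dots> = c k" using kn by simp
  finally show ?thesis .
  qed
  moreover have "\<bar>real k / real n - u\<bar> < 1 / real n * 2"
  proof -
    have "real k / real n \<le> u" "u < real k / real n + 1 / real n" using k n by (auto simp: field_simps)
    moreover have "1 / real n > 0" using n by simp
    ultimately show ?thesis by linarith
  qed
  ultimately show ?thesis using kn by blast
qed

text \<open>For \<open>u\<close> in the \<open>k\<close>-th cell, \<open>W n w u\<close> is the difference of \<open>g(B)\<close> at the left end of the cell and at
  \<open>u\<close>. The error of the Riemann sum is the integral of \<open>W\<close> over \<open>u\<close>; by Jensen and Tonelli its second moment is at most the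
  integral over \<open>u\<close> of the second moment of \<open>W\<close>, which is small by uniform continuity. The jointly
  measurable version \<open>B'\<close> serves the measurability requirements of Tonelli.\<close>

theorem (in prob_space) riemann_sums_tendsto_L2:
  fixes B B' :: "real \<Rightarrow> 'a \<Rightarrow> real"
  assumes g: "continuous_on UNIV g"
    and Bm: "\<And>t. t \<in> {0..1} \<Longrightarrow> B t \<in> borel_measurable M"
    and B'[measurable]: "(\<lambda>(w, u). B' u w) \<in> borel_measurable (M \<Otimes>\<^sub>M unif01)"
    and BB': "AE u in unif01. AE w in M. B u w = B' u w"
    and int: "\<And>t. t \<in> {0..1} \<Longrightarrow> integrable M (\<lambda>w. (g (B t w))\<^sup>2)"
    and bnd: "\<And>t. t \<in> {0..1} \<Longrightarrow> E (\<lambda>w. (g (B t w))\<^sup>2) \<le> C"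
    and ucont: "\<And>\<epsilon>. \<epsilon> > 0 \<Longrightarrow> \<exists>\<eta>>0. \<forall>s\<in>{0..1}. \<forall>t\<in>{0..1}. \<bar>s - t\<bar> < \<eta> \<longrightarrow>
       integrable M (\<lambda>w. (g (B s w) - g (B t w))\<^sup>2) \<and> E (\<lambda>w. (g (B s w) - g (B t w))\<^sup>2) \<le> \<epsilon>"
  shows "(\<lambda>w. LINT u|unif01. g (B' u w)) \<in> borel_measurable M"
    and "integrable M (\<lambda>w. (LINT u|unif01. g (B' u w))\<^sup>2)"
    and "(\<lambda>n. E (\<lambda>w. ((\<Sum>k<n. g (B (real k / real n) w)) / real n - (LINT u|unif01. g (B' u w)))\<^sup>2)) \<longlonglongrightarrow> 0"
proof -
  interpret L: prob_space unif01 by (rule prob_space_unif01)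
  interpret P: pair_prob_space M unif01 ..
  note Bm[measurable]
  have gm[measurable]: "g \<in> borel_measurable borel" using g by (rule borel_measurable_continuous_onI)
  define Y where "Y = (\<lambda>w. LINT u|unif01. g (B' u w))"
  show Ym: "Y \<in> borel_measurable M" unfolding Y_def by measurable
  have C: "C \<ge> 0" by (rule order_trans[OF _ bnd[of 0]]) auto
  have B'2: "(\<integral>\<^sup>+w. (\<integral>\<^sup>+u. ennreal ((g (B' u w))\<^sup>2) \<partial>unif01) \<partial>M) \<le> ennreal C"
  proof -
    have "(\<integral>\<^sup>+w. (\<integral>\<^sup>+u. ennreal ((g (B' u w))\<^sup>2) \<partial>unif01) \<partial>M) = (\<integral>\<^sup>+u. (\<integral>\<^sup>+w. ennreal ((g (B' u w))\<^sup>2) \<partial>M) \<partial>unif01)"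
      by (rule P.Fubini'[symmetric]) measurable
    also have "\<dots> \<le> (\<integral>\<^sup>+u. ennreal C \<partial>unif01)"
    proof (rule nn_integral_mono_AE)
      show "AE u in unif01. (\<integral>\<^sup>+w. ennreal ((g (B' u w))\<^sup>2) \<partial>M) \<le> ennreal C"
        using BB' AE_space
      proof eventually_elim
        case (elim u)
        have "(\<integral>\<^sup>+w. ennreal ((g (B' u w))\<^sup>2) \<partial>M) = (\<integral>\<^sup>+w. ennreal ((g (B u w))\<^sup>2) \<partial>M)"
          by (rule nn_integral_cong_AE) (use elim(1) in eventually_elim, simp)
        also have "\<dots> = ennreal (E (\<lambda>w. (g (B u w))\<^sup>2))"
          using elim int by (intro nn_integral_eq_integral) auto
        also have "\<dots> \<le> ennreal C" using elim bnd by (intro ennreal_leI) auto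
        finally show ?case .
      qed
    qed
    finally show ?thesis using L.emeasure_space_1 by simp
  qed
  have "(\<integral>\<^sup>+w. ennreal ((Y w)\<^sup>2) \<partial>M) \<le> (\<integral>\<^sup>+w. (\<integral>\<^sup>+u. ennreal ((g (B' u w))\<^sup>2) \<partial>unif01) \<partial>M)"
    unfolding Y_def by (intro nn_integral_mono L.square_expectation_le_nn_integral) measurable
  also note B'2
  finally have Yn: "(\<integral>\<^sup>+w. ennreal ((Y w)\<^sup>2) \<partial>M) < \<infinity>"
    by (rule le_less_trans) simp
  show "integrable M (\<lambda>w. (Y w)\<^sup>2)"
    by (rule integrableI_bounded) (use Yn Ym in auto)
  have "AE w in M. (\<integral>\<^sup>+u. ennreal ((g (B' u w))\<^sup>2) \<partial>unif01) \<noteq> \<infinity>"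
    by (rule nn_integral_PInf_AE) (use B'2 in \<open>auto simp: top_unique\<close>)
  then have ig: "AE w in M. integrable unif01 (\<lambda>u. g (B' u w))"
    using AE_space
  proof eventually_elim
    case (elim w)
    then have [measurable]: "w \<in> space M" by simp
    have "integrable unif01 (\<lambda>u. (g (B' u w))\<^sup>2)"
      by (rule integrableI_bounded) (use elim(1) in \<open>auto simp: less_top\<close>)
    then show ?case by (rule L.square_integrable_imp_integrable[rotated]) simp
  qed
  define W where "W n w u = (\<Sum>k<n. indicator (cell n k) u * g (B (real k / real n) w)) - g (B' u w)" for n w u
  have kn: "real k / real n \<in> {0..1}" if "k < n" for k n using that by auto
  have Wm: "(\<lambda>(w, u). W n w u) \<in> borel_measurable (M \<Otimes>\<^sub>M unif01)" for n
    unfolding W_def case_prod_beta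
  proof (intro borel_measurable_diff borel_measurable_sum borel_measurable_times)
    fix k assume "k \<in> {..<n}"
    then have [measurable]: "B (real k / real n) \<in> borel_measurable M" using kn by (intro Bm) auto
    show "(\<lambda>x. g (B (real k / real n) (fst x))) \<in> borel_measurable (M \<Otimes>\<^sub>M unif01)" by measurable
    have [measurable]: "indicator (cell n k) \<in> borel_measurable unif01"
      unfolding unif01_def by (intro measurable_restrict_space1) measurable
    show "(\<lambda>x. indicator (cell n k) (snd x)) \<in> borel_measurable (M \<Otimes>\<^sub>M unif01)" by measurable
  qed measurable
  note Wm[measurable]
  define R where "R n w = (\<Sum>k<n. g (B (real k / real n) w)) / real n" for n w
  have RW: "AE w in M. R n w - Y w = (LINT u|unif01. W n w u)" if "n > 0" for n
    using ig
  proof eventually_elim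
    case (elim w)
    have i: "integrable unif01 (\<lambda>u. \<Sum>k<n. indicator (cell n k) u * g (B (real k / real n) w))"
    proof (intro Bochner_Integration.integrable_sum L.integrable_const_bound)
      show "AE u in unif01. norm (indicator (cell n k) u * g (B (real k / real n) w)) \<le> \<bar>g (B (real k / real n) w)\<bar>" for k
        by (auto simp: indicator_def)
      show "(\<lambda>u. indicator (cell n k) u * g (B (real k / real n) w)) \<in> borel_measurable unif01" for k
        unfolding unif01_def by (intro measurable_restrict_space1) measurable
    qed
    show ?case unfolding W_def R_def Y_def Bochner_Integration.integral_diff[OF i elim] integral_step_function[OF that] ..
  qed
  have small: "E (\<lambda>w. (R n w - Y w)\<^sup>2) \<le> \<epsilon>"
    if n: "n > 0" and \<epsilon>: "\<epsilon> > 0" "\<And>s t. s \<in> {0..1} \<Longrightarrow> t \<in> {0..1} \<Longrightarrow> \<bar>s - t\<bar> < 1 / real n * 2 \<Longrightarrow>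
       integrable M (\<lambda>w. (g (B s w) - g (B t w))\<^sup>2) \<and> E (\<lambda>w. (g (B s w) - g (B t w))\<^sup>2) \<le> \<epsilon>" for n \<epsilon>
  proof -
    have Rm: "R n \<in> borel_measurable M"
      unfolding R_def by (intro borel_measurable_divide borel_measurable_sum measurable_compose[OF Bm gm] kn) auto
    have "(\<integral>\<^sup>+w. ennreal ((R n w - Y w)\<^sup>2) \<partial>M) = (\<integral>\<^sup>+w. ennreal ((LINT u|unif01. W n w u)\<^sup>2) \<partial>M)"
      by (rule nn_integral_cong_AE) (use RW[OF n] in eventually_elim, simp)
    also have "\<dots> \<le> (\<integral>\<^sup>+w. (\<integral>\<^sup>+u. ennreal ((W n w u)\<^sup>2) \<partial>unif01) \<partial>M)"
      by (intro nn_integral_mono L.square_expectation_le_nn_integral) measurable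
    also have "\<dots> = (\<integral>\<^sup>+u. (\<integral>\<^sup>+w. ennreal ((W n w u)\<^sup>2) \<partial>M) \<partial>unif01)"
      by (rule P.Fubini'[symmetric]) measurable
    also have "\<dots> \<le> (\<integral>\<^sup>+u. ennreal \<epsilon> \<partial>unif01)"
    proof (rule nn_integral_mono_AE)
      \<comment> \<open>The right end point lies in no cell.\<close>
      have n1: "AE u in unif01. u \<noteq> 1"
        unfolding AE_unif01 using AE_lborel_singleton[of "1::real"] by eventually_elim auto
      show "AE u in unif01. (\<integral>\<^sup>+w. ennreal ((W n w u)\<^sup>2) \<partial>M) \<le> ennreal \<epsilon>"
        using BB' AE_space n1
      proof eventually_elim
        case (elim u)
        then have u: "0 \<le> u" "u < 1" by auto
        have "\<exists>k<n. \<bar>real k / real n - u\<bar> < 1 / real n * 2 \<and> (\<forall>w. W n w u = g (B (real k / real n) w) - g (B' u w))"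
        proof -
          obtain j where j: "j < n" "\<bar>real j / real n - u\<bar> < 1 / real n * 2"
            "\<And>c :: nat \<Rightarrow> real. (\<Sum>k<n. indicator (cell n k) u * c k) = c j"
            using sum_indicator_partition[OF n u] by blast
          show ?thesis unfolding W_def j(3) using j(1,2) by blast
        qed
        then obtain k where k: "k < n" "\<bar>real k / real n - u\<bar> < 1 / real n * 2" "\<And>w. W n w u = g (B (real k / real n) w) - g (B' u w)" by blast
        have "(\<integral>\<^sup>+w. ennreal ((W n w u)\<^sup>2) \<partial>M) = (\<integral>\<^sup>+w. ennreal ((g (B (real k / real n) w) - g (B u w))\<^sup>2) \<partial>M)"
          by (rule nn_integral_cong_AE) (use elim(1) in eventually_elim, simp add: k)
        also have "\<dots> = ennreal (E (\<lambda>w. (g (B (real k / real n) w) - g (B u w))\<^sup>2))"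
          using \<epsilon>(2)[OF kn[OF k(1)] _ k(2)] u by (intro nn_integral_eq_integral) auto
        also have "\<dots> \<le> ennreal \<epsilon>" using \<epsilon>(2)[OF kn[OF k(1)] _ k(2)] u by (intro ennreal_leI) auto
        finally show ?case .
      qed
    qed
    also have "\<dots> = ennreal \<epsilon>" using L.emeasure_space_1 by simp
    finally have le: "(\<integral>\<^sup>+w. ennreal ((R n w - Y w)\<^sup>2) \<partial>M) \<le> ennreal \<epsilon>" .
    have "E (\<lambda>w. (R n w - Y w)\<^sup>2) = enn2real (\<integral>\<^sup>+w. ennreal ((R n w - Y w)\<^sup>2) \<partial>M)"
      using Rm Ym by (intro integral_eq_nn_integral) auto
    also have "\<dots> \<le> \<epsilon>" using le \<epsilon>(1) by (intro enn2real_leI) auto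
    finally show ?thesis .
  qed
  show "(\<lambda>n. E (\<lambda>w. ((\<Sum>k<n. g (B (real k / real n) w)) / real n - (LINT u|unif01. g (B' u w)))\<^sup>2)) \<longlonglongrightarrow> 0"
    unfolding R_def[symmetric] Y_def[symmetric, THEN fun_cong]
  proof (rule LIMSEQ_I)
    fix r :: real assume r: "r > 0"
    then obtain \<eta> where \<eta>: "\<eta> > 0" "\<forall>s\<in>{0..1}. \<forall>t\<in>{0..1}. \<bar>s - t\<bar> < \<eta> \<longrightarrow>
       integrable M (\<lambda>w. (g (B s w) - g (B t w))\<^sup>2) \<and> E (\<lambda>w. (g (B s w) - g (B t w))\<^sup>2) \<le> r / 2"
      using ucont[of "r / 2"] by auto
    obtain N :: nat where N: "real N > 2 / \<eta>" using reals_Archimedean2 by blast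
    have "norm (E (\<lambda>w. (R n w - Y w)\<^sup>2) - 0) < r" if "n \<ge> N" for n
    proof -
      have n: "real n > 2 / \<eta>" using N that by linarith
      then have n0: "n > 0" using \<eta>(1) by (cases n) auto
      have "1 / real n * 2 < \<eta>" using n n0 \<eta>(1) by (simp add: field_simps)
      then have "E (\<lambda>w. (R n w - Y w)\<^sup>2) \<le> r / 2" using \<eta>(2) r by (intro small[OF n0]) auto
      moreover have "0 \<le> E (\<lambda>w. (R n w - Y w)\<^sup>2)" by simp
      ultimately show ?thesis using r by simp
    qed
    then show "\<exists>no. \<forall>n\<ge>no. norm (E (\<lambda>w. (R n w - Y w)\<^sup>2) - 0) < r" by blast
  qed
qed

section \<open>Fractional Brownian motion with Hurst index at most one half\<close>

text \<open>Integrability comes first, since \<open>E X = 0\<close> says nothing about a variable that is not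
  integrable.\<close>

lemma (in prob_space) gaussian_rv_integrable_and_centered:
  assumes "gaussian_rv M X"
  shows "integrable M X" "E X = 0 \<Longrightarrow> centered_gaussian M X"
proof -
  have X[measurable]: "X \<in> borel_measurable M" using assms by (simp add: gaussian_rv_def)
  interpret N: real_distribution \<gamma> by (rule real_dist_normal_dist)
  have "integrable M X \<and> (E X = 0 \<longrightarrow> centered_gaussian M X)"
  proof (cases "\<exists>\<mu>. distr M borel X = return borel \<mu>")
    case True
    then obtain \<mu> where \<mu>: "distr M borel X = return borel \<mu>" by blast
    have "AE x in distr M borel X. x = \<mu>" unfolding \<mu> by (subst AE_return) auto
    then have ae: "AE w in M. X w = \<mu>" by (subst (asm) AE_distr_iff) auto
    have iX: "integrable M X"
      by (rule integrable_cong_AE_imp[of _ "\<lambda>_. \<mu>"]) (use ae in auto)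
    have "E X = E (\<lambda>_. \<mu>)" by (rule integral_cong_AE) (use ae in auto)
    then have EX: "E X = \<mu>" by (simp add: prob_space)
    show ?thesis
    proof (intro conjI impI iX)
      assume "E X = 0"
      then have "distr M borel X = distr \<gamma> borel (\<lambda>x. 0 * x)"
        using \<mu> EX N.distr_const[of 0 borel] by simp
      then show "centered_gaussian M X" using X unfolding centered_gaussian_def by blast
    qed
  next
    case False
    then obtain \<mu> \<sigma> where \<sigma>: "\<sigma> > 0" and D: "distributed M lborel X (normal_density \<mu> \<sigma>)"
      using assms by (auto simp: gaussian_rv_def)
    have iX: "integrable M X"
      using distributed_integrable[OF D, of "\<lambda>x. x"] integrable_normal_moment_nz_1[OF \<sigma>, of \<mu>] by simp
    show ?thesis
    proof (intro conjI impI iX)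
      assume "E X = 0"
      then have "\<mu> = 0" using normal_distributed_expectation[OF \<sigma> D] by simp
      then have "distributed M lborel (\<lambda>x. X x / \<sigma>) std_normal_density"
        using D normal_standard_normal_convert[OF \<sigma>, of X \<mu>] by simp
      then have d: "distr M lborel (\<lambda>x. X x / \<sigma>) = \<gamma>"
        by (rule distributed_distr_eq_density)
      have "distr M borel X = distr M borel (\<lambda>w. \<sigma> * (X w / \<sigma>))" using \<sigma> by simp
      also have "\<dots> = distr (distr M lborel (\<lambda>x. X x / \<sigma>)) borel (\<lambda>x. \<sigma> * x)"
        by (subst distr_distr) (auto simp: comp_def)
      also have "\<dots> = distr \<gamma> borel (\<lambda>x. \<sigma> * x)" unfolding d ..
      finally show "centered_gaussian M X" using X unfolding centered_gaussian_def by blast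
    qed
  qed
  then show "integrable M X" "E X = 0 \<Longrightarrow> centered_gaussian M X" by auto
qed

definition lincombs :: "'i set \<Rightarrow> ('i \<Rightarrow> 'a \<Rightarrow> real) \<Rightarrow> ('a \<Rightarrow> real) set" where
  "lincombs T B = {(\<lambda>w. \<Sum>t\<in>J. c t * B t w) | J c. finite J \<and> J \<subseteq> T}"

lemma lincombs_base: "t \<in> T \<Longrightarrow> B t \<in> lincombs T B"
  unfolding lincombs_def by (rule CollectI, rule exI[of _ "{t}"], rule exI[of _ "\<lambda>_. 1"]) auto

lemma lincombs_lincomb:
  assumes "X \<in> lincombs T B" "Y \<in> lincombs T B"
  shows "(\<lambda>w. a * X w + b * Y w) \<in> lincombs T B"
proof -
  from assms obtain I c J d where I: "finite I" "I \<subseteq> T" "X = (\<lambda>w. \<Sum>t\<in>I. c t * B t w)"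
    and J: "finite J" "J \<subseteq> T" "Y = (\<lambda>w. \<Sum>t\<in>J. d t * B t w)"
    unfolding lincombs_def by blast
  have x: "X w = (\<Sum>t\<in>I \<union> J. (if t \<in> I then c t else 0) * B t w)" for w
    unfolding I(3) by (intro sum.mono_neutral_cong_left) (use I J in auto)
  have y: "Y w = (\<Sum>t\<in>I \<union> J. (if t \<in> J then d t else 0) * B t w)" for w
    unfolding J(3) by (intro sum.mono_neutral_cong_left) (use I J in auto)
  have "(\<lambda>w. a * X w + b * Y w) = (\<lambda>w. \<Sum>t\<in>I \<union> J. (a * (if t \<in> I then c t else 0) + b * (if t \<in> J then d t else 0)) * B t w)"
    unfolding x y by (simp only: sum_distrib_left sum.distrib[symmetric] distrib_right mult.assoc)
  moreover have "finite (I \<union> J)" "I \<union> J \<subseteq> T" using I J by auto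
  ultimately show ?thesis unfolding lincombs_def by (intro CollectI exI conjI) auto
qed

text \<open>The Gaussian property of all linear combinations is the definition of a Gaussian process; centering
  needs integrability of the single variables first.\<close>

lemma (in prob_space) gaussian_process_gaussian_space:
  assumes G: "gaussian_process M T B" and mean: "\<And>t. t \<in> T \<Longrightarrow> E (B t) = 0"
  shows "gaussian_space M (lincombs T B)"
  unfolding gaussian_space_def
proof (intro conjI ballI allI lincombs_lincomb)
  have iB: "integrable M (B t)" if "t \<in> T" for t
  proof -
    have "gaussian_rv M (\<lambda>w. \<Sum>s\<in>{t}. 1 * B s w)"
      using G that unfolding gaussian_process_def by (elim allE[of _ "{t}"] allE[of _ "\<lambda>_. 1"]) auto
    then show ?thesis using gaussian_rv_integrable_and_centered(1) by simp
  qed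
  fix X assume "X \<in> lincombs T B"
  then obtain J c where J: "finite J" "J \<subseteq> T" and X: "X = (\<lambda>w. \<Sum>t\<in>J. c t * B t w)"
    unfolding lincombs_def by blast
  have "gaussian_rv M X" using G J unfolding gaussian_process_def X by blast
  moreover have "E X = (\<Sum>t\<in>J. c t * E (B t))"
    unfolding X using iB J by (subst Bochner_Integration.integral_sum) auto
  then have "E X = 0" using mean J by (auto intro!: sum.neutral)
  ultimately show "centered_gaussian M X" by (rule gaussian_rv_integrable_and_centered(2))
qed

text \<open>For \<open>H \<le> 1 / 2\<close> the function \<open>x\<^sup>2\<^sup>H\<close> is concave on the half-line, as the covariance bounds require.\<close>

locale rough_fbm = prob_space M for M :: "'a measure" +
  fixes H :: real and B :: "real \<Rightarrow> 'a \<Rightarrow> real"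
  assumes fbm: "fractional_brownian_motion M H B" and H_le: "H \<le> 1 / 2"
begin

lemma H_pos: "H > 0" using fbm by (simp add: fractional_brownian_motion_def)

abbreviation "span_B \<equiv> lincombs {0..1} B"

lemma gaussian_span: "gaussian_space M span_B"
  using fbm by (intro gaussian_process_gaussian_space) (auto simp: fractional_brownian_motion_def)

lemma B_in_span: "t \<in> {0..1} \<Longrightarrow> B t \<in> span_B"
  by (rule lincombs_base)

abbreviation "Bn n k \<equiv> B (real k / real n)"

abbreviation "dB \<equiv> increment B"

abbreviation "\<delta>n n \<equiv> real n powr (- (2 * H))"

abbreviation "riemann_sum g n \<equiv> \<lambda>w. (\<Sum>k<n. g (Bn n k w)) / real n"

lemma grid: "k \<le> n \<Longrightarrow> real k / real n \<in> {0..1}"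
  by (cases "n = 0") auto

lemma increment_in_span:
  assumes "k < n" shows "increment B n k \<in> span_B"
proof -
  have "(\<lambda>w. 1 * B (real (k + 1) / real n) w + (-1) * B (real k / real n) w) \<in> span_B"
    using assms by (intro lincombs_lincomb B_in_span grid) auto
  moreover have "increment B n k = (\<lambda>w. 1 * B (real (k + 1) / real n) w + (-1) * B (real k / real n) w)"
    by (auto simp: increment_def)
  ultimately show ?thesis by simp
qed

lemma all_moments_span: "X \<in> span_B \<Longrightarrow> all_moments M X"
  by (intro centered_gaussian_all_moments gaussian_space_gaussian[OF gaussian_span])

lemma cov: "s \<in> {0..1} \<Longrightarrow> t \<in> {0..1} \<Longrightarrow>
    E (\<lambda>w. B s w * B t w) = (apow (2 * H) t + apow (2 * H) s - apow (2 * H) (t - s)) / 2"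
  using fbm by (simp add: fractional_brownian_motion_def apow_def)

lemma apow_divide: "apow \<theta> (x / real n) = apow \<theta> x * real n powr (- \<theta>)"
  by (simp add: apow_def powr_divide powr_minus field_simps)

lemma cov_grid:
  assumes "k \<le> n" "l \<le> n"
  shows "E (\<lambda>w. Bn n k w * Bn n l w) =
    \<delta>n n * ((apow (2 * H) (real k) + apow (2 * H) (real l) - apow (2 * H) (real k - real l)) / 2)"
proof -
  have "real l / real n - real k / real n = (real l - real k) / real n" by (simp add: diff_divide_distrib)
  then show ?thesis
    unfolding cov[OF grid[OF assms(1)] grid[OF assms(2)]]
    by (simp only: apow_divide apow_minus_commute[of _ "real l" "real k"]) (simp add: field_simps)
qed

lemma span_diff_cov:
  assumes "X \<in> span_B" "Y \<in> span_B" "Z \<in> span_B"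
  shows "E (\<lambda>w. (X w - Y w) * Z w) = E (\<lambda>w. X w * Z w) - E (\<lambda>w. Y w * Z w)"
  using gaussian_space_mult_integrable[OF gaussian_span assms(1,3)] gaussian_space_mult_integrable[OF gaussian_span assms(2,3)]
  by (simp add: left_diff_distrib)

lemma increment_cov:
  assumes "k < n" "l \<le> n"
  shows "E (\<lambda>w. dB n k w * Bn n l w) = \<delta>n n * fbm_cov (2 * H) k l"
proof -
  have "E (\<lambda>w. dB n k w * Bn n l w) =
    E (\<lambda>w. Bn n (k + 1) w * Bn n l w) - E (\<lambda>w. Bn n k w * Bn n l w)"
    unfolding increment_def using assms by (intro span_diff_cov B_in_span grid) auto
  also have "\<dots> = \<delta>n n * fbm_cov (2 * H) k l"
    using assms by (subst (1 2) cov_grid) (auto simp: fbm_cov_def field_simps)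
  finally show ?thesis .
qed

lemma increment_increment_cov:
  assumes "k < n" "l < n"
  shows "E (\<lambda>w. dB n k w * dB n l w) = \<delta>n n * fbm_incr_cov (2 * H) k l"
proof -
  have "E (\<lambda>w. dB n k w * dB n l w) = E (\<lambda>w. (Bn n (l + 1) w - Bn n l w) * dB n k w)"
    by (simp only: increment_def[of B n l] mult.commute)
  also have "\<dots> = E (\<lambda>w. Bn n (l + 1) w * dB n k w) - E (\<lambda>w. Bn n l w * dB n k w)"
    using assms by (intro span_diff_cov B_in_span grid increment_in_span) auto
  also have "\<dots> = \<delta>n n * fbm_cov (2 * H) k (l + 1) - \<delta>n n * fbm_cov (2 * H) k l"
    using increment_cov[OF assms(1), of "l + 1"] increment_cov[OF assms(1), of l] assms by (simp add: mult.commute)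
  also have "\<dots> = \<delta>n n * (fbm_cov (2 * H) k (l + 1) - fbm_cov (2 * H) k l)"
    by (simp only: right_diff_distrib)
  also have "fbm_cov (2 * H) k (l + 1) - fbm_cov (2 * H) k l = fbm_incr_cov (2 * H) k l"
    by (simp add: fbm_cov_def fbm_incr_cov_def field_simps)
  finally show ?thesis .
qed

lemma increment_variance:
  assumes "k < n"
  shows "E (\<lambda>w. dB n k w * dB n k w) = \<delta>n n"
  using increment_increment_cov[OF assms assms] by (simp add: fbm_incr_cov_def apow_minus)

lemma B_diff_variance:
  assumes "s \<in> {0..1}" "t \<in> {0..1}"
  shows "E (\<lambda>w. (B s w - B t w)\<^sup>2) = apow (2 * H) \<bar>s - t\<bar>"
proof -
  have d: "(\<lambda>w. B s w - B t w) \<in> span_B"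
    using lincombs_lincomb[OF B_in_span[OF assms(1)] B_in_span[OF assms(2)], of 1 "-1"] by simp
  have "E (\<lambda>w. (B s w - B t w)\<^sup>2) = E (\<lambda>w. B s w * (B s w - B t w)) - E (\<lambda>w. B t w * (B s w - B t w))"
    unfolding power2_eq_square by (intro span_diff_cov B_in_span assms d)
  also have "E (\<lambda>w. B s w * (B s w - B t w)) = E (\<lambda>w. B s w * B s w) - E (\<lambda>w. B t w * B s w)"
    using span_diff_cov[OF B_in_span B_in_span B_in_span, of s t s] assms by (simp add: mult.commute)
  also have "E (\<lambda>w. B t w * (B s w - B t w)) = E (\<lambda>w. B s w * B t w) - E (\<lambda>w. B t w * B t w)"
    using span_diff_cov[OF B_in_span B_in_span B_in_span, of s t t] assms by (simp add: mult.commute)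
  finally show ?thesis using assms
    by (simp add: cov apow_minus_commute[of _ t s]) (simp add: apow_def field_simps)
qed

text \<open>The function \<open>h i\<close> stands for the \<open>i\<close>-th derivative of \<open>h 0\<close>. Second moments enter the variance bound, and
  fourth moments the convergence of Riemann sums.\<close>

definition controlled :: "nat \<Rightarrow> (nat \<Rightarrow> real \<Rightarrow> real) \<Rightarrow> real \<Rightarrow> bool" where
  "controlled N h C \<longleftrightarrow> C \<ge> 0 \<and>
     (\<forall>i<N. \<forall>x. (h i has_field_derivative h (Suc i) x) (at x)) \<and>
     (\<forall>i\<le>N. continuous_on UNIV (h i)) \<and>
     (\<forall>i\<le>N. \<forall>t\<in>{0..1}. all_moments M (\<lambda>w. h i (B t w)) \<and>
        E (\<lambda>w. (h i (B t w))\<^sup>2) \<le> C \<and> E (\<lambda>w. (h i (B t w)) ^ 4) \<le> C)"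

lemma controlled_mono: "controlled N h C \<Longrightarrow> N' \<le> N \<Longrightarrow> controlled N' h C"
  unfolding controlled_def by auto

text \<open>The sum of the variables called \<open>D\<^sub>k\<close> in the introduction.\<close>

definition comp_sum :: "nat \<Rightarrow> (nat \<Rightarrow> real \<Rightarrow> real) \<Rightarrow> nat \<Rightarrow> 'a \<Rightarrow> real" where
  "comp_sum q h n w = (\<Sum>k<n. h 0 (Bn n k w) * hermite (\<delta>n n) q (dB n k w) -
     (- (\<delta>n n) / 2) ^ q * h q (Bn n k w))"

lemma all_moments_comp_sum:
  assumes h: "controlled N h C" and "q \<le> N"
  shows "all_moments M (comp_sum q h n)"
proof -
  have "all_moments M (\<lambda>w. \<Sum>k<n. h 0 (Bn n k w) * hermite (\<delta>n n) q (dB n k w) -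
     (- (\<delta>n n) / 2) ^ q * h q (Bn n k w))"
  proof (intro all_moments_sum all_moments_diff)
    fix k assume k: "k \<in> {..<n}"
    have hm: "all_moments M (\<lambda>w. h i (Bn n k w))" if "i \<le> N" for i
      using h that k grid[of k n] unfolding controlled_def by auto
    have "all_moments M (\<lambda>w. hermite (\<delta>n n) q (dB n k w))"
      using k by (intro all_moments_hermite all_moments_span increment_in_span) auto
    then show "all_moments M (\<lambda>w. h 0 (Bn n k w) * hermite (\<delta>n n) q (dB n k w))"
      by (intro all_moments_mult hm) auto
    show "all_moments M (\<lambda>w. (- (\<delta>n n) / 2) ^ q * h q (Bn n k w))"
      using assms(2) by (intro all_moments_cmult hm)
  qed
  then show ?thesis unfolding comp_sum_def .
qed

text \<open>The bound \<open>hermite_product_expectation_bound\<close> is summed over all pairs of grid points. For fixed \<open>l\<close>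
  the sum over \<open>k\<close> is of order \<open>\<delta>\<^sup>q\<close>: the covariances with values of the process carry \<open>\<delta>\<^sup>q\<^sup>+\<^sup>1\<close> and add up to a
  multiple of \<open>n\<^sup>2\<^sup>H = 1 / \<delta>\<close>, those between increments carry \<open>\<delta>\<^sup>q\<close> and have bounded sum.\<close>

theorem comp_sum_variance:
  assumes q: "q \<ge> 1" and h: "controlled (2 * q) h C" and n: "n > 0"
  shows "E (\<lambda>w. (comp_sum q h n w)\<^sup>2) \<le>
    8 * real q ^ 2 * ((2 * real (2 * q) + 2) ^ (2 * q) * C) * real n * (\<delta>n n) ^ q"
proof -
  define \<delta> where "\<delta> = \<delta>n n"
  define \<beta> where "\<beta> = - \<delta> / 2"
  define A where "A = 2 * real q ^ 2 * ((2 * real (2 * q) + 2) ^ (2 * q) * C)"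
  define X where "X k = Bn n k" for k
  define D where "D k w = h 0 (X k w) * hermite \<delta> q (dB n k w) - \<beta> ^ q * h q (X k w)" for k w
  have C: "C \<ge> 0" using h by (simp add: controlled_def)
  have A: "A \<ge> 0" using C by (simp add: A_def)
  have \<theta>: "0 < 2 * H" "2 * H \<le> 1" using H_pos H_le by auto
  have \<delta>0: "\<delta> > 0" using n by (simp add: \<delta>_def)
  have \<delta>1: "\<delta> \<le> 1" unfolding \<delta>_def using n \<theta> powr_mono[of "- (2 * H)" 0 "real n"] by simp
  have \<delta>n: "\<delta> * real n powr (2 * H) = 1" unfolding \<delta>_def using n by (simp flip: powr_add)
  have hm: "all_moments M (\<lambda>w. h i (X k w))" "E (\<lambda>w. (h i (X k w))\<^sup>2) \<le> C" if "i \<le> 2 * q" "k < n" for i k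
    using h that grid[of k n] unfolding controlled_def X_def by auto
  have XS: "X k \<in> span_B" if "k < n" for k unfolding X_def using that by (intro B_in_span grid) auto
  have am: "all_moments M (D k)" if "k < n" for k
    unfolding D_def using that q
    by (intro all_moments_diff all_moments_mult all_moments_cmult all_moments_hermite hm all_moments_span increment_in_span) auto
  have cv: "E (\<lambda>w. dB n k w * X l w) = \<delta> * fbm_cov (2 * H) k l" if "k < n" "l < n" for k l
    unfolding X_def \<delta>_def using increment_cov[of k n l] that by simp
  have ci: "E (\<lambda>w. dB n k w * dB n l w) = \<delta> * fbm_incr_cov (2 * H) k l" if "k < n" "l < n" for k l
    unfolding \<delta>_def using increment_increment_cov that by simp
  have sc: "\<bar>\<delta> * x\<bar> \<le> \<delta>" if "\<bar>x\<bar> \<le> 1" for x using that \<delta>0 by (simp add: abs_mult)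
  have pair: "E (\<lambda>w. D k w * D l w) \<le>
      A * (\<delta> ^ Suc q * (\<bar>fbm_cov (2 * H) k k + 1 / 2\<bar> + \<bar>fbm_cov (2 * H) k l\<bar>) + \<delta> ^ q * \<bar>fbm_incr_cov (2 * H) k l\<bar>)"
    if kl: "k < n" "l < n" for k l
  proof -
    have cl: "\<bar>fbm_cov (2 * H) i j\<bar> \<le> 1" "\<bar>fbm_incr_cov (2 * H) i j\<bar> \<le> 1" for i j
      using \<theta> by (auto intro!: abs_fbm_cov_le_1 abs_fbm_incr_cov_le_1)
    have "\<bar>E (\<lambda>w. D k w * D l w)\<bar> \<le>
      A * ((\<bar>E (\<lambda>w. dB n k w * X k w) - \<beta>\<bar> + \<bar>E (\<lambda>w. dB n k w * X l w)\<bar>) * \<delta> ^ q +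
        \<bar>E (\<lambda>w. dB n k w * dB n l w)\<bar> * \<delta> ^ (q - 1))"
      unfolding D_def A_def
    proof (rule hermite_product_expectation_bound[OF gaussian_span XS[OF kl(1)] XS[OF kl(2)] increment_in_span[OF kl(1)] increment_in_span[OF kl(2)]])
      show "(h i has_field_derivative h (Suc i) x) (at x)" if "i < 2 * q" for i x
        using h that unfolding controlled_def by auto
      show "continuous_on UNIV (h i)" if "i \<le> 2 * q" for i
        using h that unfolding controlled_def by auto
      show "E (\<lambda>w. dB n k w * dB n k w) = \<delta>" "E (\<lambda>w. dB n l w * dB n l w) = \<delta>"
        unfolding \<delta>_def using increment_variance kl by auto
      show "\<bar>\<beta>\<bar> \<le> \<delta>" using \<delta>0 by (simp add: \<beta>_def)
    qed (simp_all add: hm kl \<delta>1 cv ci sc cl)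
    also have "\<dots> = A * (\<delta> ^ Suc q * (\<bar>fbm_cov (2 * H) k k + 1 / 2\<bar> + \<bar>fbm_cov (2 * H) k l\<bar>) + \<delta> ^ q * \<bar>fbm_incr_cov (2 * H) k l\<bar>)"
    proof -
      have "\<delta> * fbm_cov (2 * H) k k - \<beta> = \<delta> * (fbm_cov (2 * H) k k + 1 / 2)" by (simp add: \<beta>_def algebra_simps)
      then have 1: "\<bar>E (\<lambda>w. dB n k w * X k w) - \<beta>\<bar> = \<delta> * \<bar>fbm_cov (2 * H) k k + 1 / 2\<bar>"
        using \<delta>0 unfolding cv[OF kl(1,1)] by (simp only: abs_mult abs_of_pos)
      have 2: "\<bar>E (\<lambda>w. dB n k w * X l w)\<bar> = \<delta> * \<bar>fbm_cov (2 * H) k l\<bar>"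
        "\<bar>E (\<lambda>w. dB n k w * dB n l w)\<bar> = \<delta> * \<bar>fbm_incr_cov (2 * H) k l\<bar>"
        using \<delta>0 unfolding cv[OF kl] ci[OF kl] by (simp_all only: abs_mult abs_of_pos)
      have 3: "\<delta> ^ q = \<delta> * \<delta> ^ (q - 1)" using q by (cases q) auto
      show ?thesis unfolding 1 2 power_Suc 3 by (simp add: algebra_simps)
    qed
    finally show ?thesis by linarith
  qed
  have cs: "comp_sum q h n = (\<lambda>w. \<Sum>k<n. D k w)"
    by (simp add: comp_sum_def D_def X_def \<delta>_def \<beta>_def fun_eq_iff)
  have "E (\<lambda>w. (comp_sum q h n w)\<^sup>2) = E (\<lambda>w. \<Sum>l<n. \<Sum>k<n. D k w * D l w)"
    unfolding cs power2_eq_square sum_product by (subst sum.swap) simp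
  also have "\<dots> = (\<Sum>l<n. \<Sum>k<n. E (\<lambda>w. D k w * D l w))"
  proof -
    have i: "integrable M (\<lambda>w. D k w * D l w)" if "k < n" "l < n" for k l
      using all_moments_integrable[OF all_moments_mult[OF am[OF that(1)] am[OF that(2)]]] .
    then show ?thesis by (subst Bochner_Integration.integral_sum; (intro Bochner_Integration.integrable_sum)?; simp?)+
  qed
  also have "\<dots> \<le> (\<Sum>l<n. \<Sum>k<n. A * (\<delta> ^ Suc q * (\<bar>fbm_cov (2 * H) k k + 1 / 2\<bar> + \<bar>fbm_cov (2 * H) k l\<bar>) + \<delta> ^ q * \<bar>fbm_incr_cov (2 * H) k l\<bar>))"
    by (intro sum_mono pair) auto
  also have "\<dots> = (\<Sum>l<n. A * (\<delta> ^ Suc q * ((\<Sum>k<n. \<bar>fbm_cov (2 * H) k k + 1 / 2\<bar>) + (\<Sum>k<n. \<bar>fbm_cov (2 * H) k l\<bar>)) + \<delta> ^ q * (\<Sum>k<n. \<bar>fbm_incr_cov (2 * H) k l\<bar>)))"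
    by (intro sum.cong refl) (simp only: sum_distrib_left[symmetric] sum.distrib)
  also have "\<dots> \<le> (\<Sum>l<n. A * (\<delta> ^ Suc q * (real n powr (2 * H) / 2 + 3 / 2 * real n powr (2 * H)) + \<delta> ^ q * 2))"
    using \<theta> A \<delta>0
    by (intro sum_mono mult_left_mono add_mono sum_abs_fbm_cov_le sum_abs_fbm_incr_cov_le) (auto simp: sum_abs_fbm_cov_diagonal)
  also have "\<dots> = real n * (A * (4 * \<delta> ^ q))"
  proof -
    have "\<delta> ^ Suc q * (real n powr (2 * H) / 2 + 3 / 2 * real n powr (2 * H)) = 2 * \<delta> ^ q * (\<delta> * real n powr (2 * H))" by simp
    then show ?thesis unfolding \<delta>n by simp
  qed
  finally show ?thesis by (simp add: A_def \<delta>_def algebra_simps)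
qed

lemma cond_H_controlled:
  assumes h: "cond_H M B N h"
  obtains C where "controlled N (\<lambda>i. (deriv ^^ i) h) C"
proof -
  let ?h = "\<lambda>i. (deriv ^^ i) h"
  define m where "m i p = (SUP t\<in>{0..1}. \<integral>\<^sup>+ w. ennreal (\<bar>?h i (B t w)\<bar> powr p) \<partial>M)" for i p
  have cls: "\<And>i x. i < N \<Longrightarrow> ?h i differentiable (at x)" "continuous_on UNIV (?h N)"
    using h by (auto simp: cond_H_def class_C_def)
  have der: "(?h i has_field_derivative ?h (Suc i) x) (at x)" if "i < N" for i x
    using cls(1)[OF that, of x] by (simp add: DERIV_deriv_iff_real_differentiable)
  have cont: "continuous_on UNIV (?h i)" if "i \<le> N" for i
  proof (cases "i = N")
    case False
    then show ?thesis using that by (intro continuous_at_imp_continuous_on ballI DERIV_isCont[OF der]) auto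
  qed (use cls in simp)
  have fin: "m i p < \<infinity>" if "i \<le> N" "p > 0" for i p using h that unfolding cond_H_def m_def by auto
  have Bm: "B t \<in> borel_measurable M" if "t \<in> {0..1}" for t
    using all_moments_measurable[OF all_moments_span[OF B_in_span[OF that]]] .
  have meas: "(\<lambda>w. ?h i (B t w)) \<in> borel_measurable M" if "i \<le> N" "t \<in> {0..1}" for i t
    by (rule measurable_compose[OF Bm[OF that(2)] borel_measurable_continuous_onI[OF cont[OF that(1)]]])
  have nn: "(\<integral>\<^sup>+ w. ennreal (\<bar>?h i (B t w)\<bar> ^ p) \<partial>M) \<le> m i (real p)" if "t \<in> {0..1}" "p > 0" for i t p
  proof -
    have "(\<integral>\<^sup>+ w. ennreal (\<bar>?h i (B t w)\<bar> ^ p) \<partial>M) = (\<integral>\<^sup>+ w. ennreal (\<bar>?h i (B t w)\<bar> powr real p) \<partial>M)"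
      using that by (intro nn_integral_cong) (simp add: powr_realpow')
    also have "\<dots> \<le> m i (real p)" unfolding m_def by (rule SUP_upper) (rule that)
    finally show ?thesis .
  qed
  have int: "integrable M (\<lambda>w. \<bar>?h i (B t w)\<bar> ^ p)" if "i \<le> N" "t \<in> {0..1}" for i t p
  proof (cases "p = 0")
    case False
    show ?thesis
    proof (rule integrableI_bounded)
      show "(\<lambda>w. \<bar>?h i (B t w)\<bar> ^ p) \<in> borel_measurable M" using meas[OF that] by simp
      have "(\<integral>\<^sup>+ w. ennreal (norm (\<bar>?h i (B t w)\<bar> ^ p)) \<partial>M) = (\<integral>\<^sup>+ w. ennreal (\<bar>?h i (B t w)\<bar> ^ p) \<partial>M)" by simp
      also have "\<dots> \<le> m i (real p)" using nn that False by auto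
      also have "\<dots> < \<infinity>" using fin that False by auto
      finally show "(\<integral>\<^sup>+ w. ennreal (norm (\<bar>?h i (B t w)\<bar> ^ p)) \<partial>M) < \<infinity>" .
    qed
  qed simp
  define C where "C = (\<Sum>i\<le>N. enn2real (m i 2) + enn2real (m i 4))"
  have mC: "enn2real (m i 2) \<le> C" "enn2real (m i 4) \<le> C" if "i \<le> N" for i
  proof -
    have "enn2real (m i 2) + enn2real (m i 4) \<le> C"
      unfolding C_def by (rule member_le_sum[where f="\<lambda>i. enn2real (m i 2) + enn2real (m i 4)"]) (use that in auto)
    moreover have "enn2real (m i 2) \<ge> 0" "enn2real (m i 4) \<ge> 0" by auto
    ultimately show "enn2real (m i 2) \<le> C" "enn2real (m i 4) \<le> C" by linarith+
  qed
  have E: "E (\<lambda>w. \<bar>?h i (B t w)\<bar> ^ p) \<le> enn2real (m i (real p))" if "i \<le> N" "t \<in> {0..1}" "p > 0" for i t p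
  proof -
    have "E (\<lambda>w. \<bar>?h i (B t w)\<bar> ^ p) = enn2real (\<integral>\<^sup>+ w. ennreal (\<bar>?h i (B t w)\<bar> ^ p) \<partial>M)"
      using meas[OF that(1,2)] by (intro integral_eq_nn_integral) auto
    also have "\<dots> \<le> enn2real (m i (real p))" using nn[OF that(2,3)] fin[of i "real p"] that by (intro enn2real_mono) auto
    finally show ?thesis .
  qed
  show thesis
  proof (rule that[of C])
    show "controlled N ?h C"
      unfolding controlled_def
    proof (intro conjI allI impI ballI)
      show "C \<ge> 0" unfolding C_def by (intro sum_nonneg) auto
    next
      fix i x assume "i < N" then show "(?h i has_field_derivative ?h (Suc i) x) (at x)" by (rule der)
    next
      fix i assume "i \<le> N" then show "continuous_on UNIV (?h i)" by (rule cont)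
    next
      fix i t assume it: "i \<le> N" "t \<in> {0..1::real}"
      show "all_moments M (\<lambda>w. ?h i (B t w))" unfolding all_moments_def using meas int it by auto
      show "E (\<lambda>w. (?h i (B t w))\<^sup>2) \<le> C" using E[OF it, of 2] mC[OF it(1)] by simp
      show "E (\<lambda>w. (?h i (B t w)) ^ 4) \<le> C" using E[OF it, of 4] mC[OF it(1)] by simp
    qed
  qed
qed

end

section \<open>Convergence in mean square to the pathwise integral\<close>

lemma (in prob_space) integral_square_triangle:
  fixes X Y :: "'a \<Rightarrow> real"
  assumes "integrable M (\<lambda>w. (X w)\<^sup>2)" "integrable M (\<lambda>w. (Y w)\<^sup>2)"
    and [measurable]: "X \<in> borel_measurable M" "Y \<in> borel_measurable M"
  shows "integrable M (\<lambda>w. (X w + Y w)\<^sup>2)"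
    and "E (\<lambda>w. (X w + Y w)\<^sup>2) \<le> 2 * E (\<lambda>w. (X w)\<^sup>2) + 2 * E (\<lambda>w. (Y w)\<^sup>2)"
proof -
  have le: "(x + y)\<^sup>2 \<le> 2 * x\<^sup>2 + 2 * y\<^sup>2" for x y :: real
    using zero_le_power2[of "x - y"] by (simp add: power2_eq_square algebra_simps)
  have i: "integrable M (\<lambda>w. 2 * (X w)\<^sup>2 + 2 * (Y w)\<^sup>2)" using assms by simp
  show int: "integrable M (\<lambda>w. (X w + Y w)\<^sup>2)"
    by (rule lint_bound[OF i]) (simp_all add: le)
  have "E (\<lambda>w. (X w + Y w)\<^sup>2) \<le> E (\<lambda>w. 2 * (X w)\<^sup>2 + 2 * (Y w)\<^sup>2)"
    by (intro integral_mono int i le)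
  then show "E (\<lambda>w. (X w + Y w)\<^sup>2) \<le> 2 * E (\<lambda>w. (X w)\<^sup>2) + 2 * E (\<lambda>w. (Y w)\<^sup>2)"
    using assms by simp
qed

text \<open>\<open>R\<close> is the Riemann sum and \<open>Y'\<close> a measurable version of its limit \<open>Y\<close>, which itself is measurable only for the
  completion.\<close>

lemma (in prob_space) tendsto_L2_via_approximation:
  assumes X: "\<And>n. all_moments M (X n)" and R: "\<And>n. all_moments M (R n)"
    and Y'[measurable]: "Y' \<in> borel_measurable M" and Y'2: "integrable M (\<lambda>w. (Y' w)\<^sup>2)"
    and YY': "AE w in M. Y' w = Y w"
    and XR: "(\<lambda>n. E (\<lambda>w. (X n w - c * R n w)\<^sup>2)) \<longlonglongrightarrow> 0"
    and RY: "(\<lambda>n. E (\<lambda>w. (R n w - Y' w)\<^sup>2)) \<longlonglongrightarrow> 0"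
  shows "tendsto_L2 M X (\<lambda>w. c * Y w)"
proof -
  note [measurable] = X[THEN all_moments_measurable] R[THEN all_moments_measurable]
  have sq: "integrable M (\<lambda>w. (Z w)\<^sup>2)" if "all_moments M Z" for Z
    by (rule all_moments_integrable[OF all_moments_power[OF that]])
  have Xc: "X n \<in> borel_measurable (completion M)" for n by (rule measurable_completion) simp
  have cae: "AE w in M. c * Y' w = c * Y w" using YY' by eventually_elim simp
  have Yc: "(\<lambda>w. c * Y w) \<in> borel_measurable (completion M)"
    by (rule measurable_completion_if_AE_eq[OF _ cae]) simp
  have Y'c: "(\<lambda>w. c * Y' w) \<in> borel_measurable (completion M)" by (rule measurable_completion) simp
  have cY: "integrable M (\<lambda>w. (c * Y' w)\<^sup>2)" using Y'2 by (simp add: power_mult_distrib)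
  have RYi: "integrable M (\<lambda>w. (R n w - Y' w)\<^sup>2)" for n
    using integral_square_triangle(1)[of "R n" "\<lambda>w. - Y' w"] sq[OF R] Y'2 by simp
  have XRi: "integrable M (\<lambda>w. (X n w - c * R n w)\<^sup>2)" for n
    by (intro sq all_moments_diff all_moments_cmult X R)
  have eq: "(LINT w|completion M. (X n w - c * Y w)\<^sup>2) = E (\<lambda>w. (X n w - c * Y' w)\<^sup>2)" for n
  proof -
    have "(LINT w|completion M. (X n w - c * Y w)\<^sup>2) = (LINT w|completion M. (X n w - c * Y' w)\<^sup>2)"
    proof (rule integral_cong_AE)
      show "AE w in completion M. (X n w - c * Y w)\<^sup>2 = (X n w - c * Y' w)\<^sup>2"
        by (rule AE_completion) (use YY' in eventually_elim, simp)
    qed (intro borel_measurable_power borel_measurable_diff Xc Yc Y'c)+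
    also have "\<dots> = E (\<lambda>w. (X n w - c * Y' w)\<^sup>2)" by (rule integral_completion) simp
    finally show ?thesis .
  qed
  have le: "E (\<lambda>w. (X n w - c * Y' w)\<^sup>2) \<le>
      2 * E (\<lambda>w. (X n w - c * R n w)\<^sup>2) + 2 * (c\<^sup>2 * E (\<lambda>w. (R n w - Y' w)\<^sup>2))" for n
  proof -
    have i: "integrable M (\<lambda>w. (c * (R n w - Y' w))\<^sup>2)" using RYi[of n] by (simp add: power_mult_distrib)
    have "E (\<lambda>w. (X n w - c * Y' w)\<^sup>2) = E (\<lambda>w. ((X n w - c * R n w) + c * (R n w - Y' w))\<^sup>2)"
      by (intro lint_cong) (auto simp: algebra_simps)
    also have "\<dots> \<le> 2 * E (\<lambda>w. (X n w - c * R n w)\<^sup>2) + 2 * E (\<lambda>w. (c * (R n w - Y' w))\<^sup>2)"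
      by (rule integral_square_triangle(2)[OF XRi i]) simp_all
    finally show ?thesis by (simp add: power_mult_distrib)
  qed
  have "(\<lambda>n. E (\<lambda>w. (X n w - c * Y' w)\<^sup>2)) \<longlonglongrightarrow> 0"
  proof (rule tendsto_sandwich[OF _ _ tendsto_const])
    have "(\<lambda>n. 2 * E (\<lambda>w. (X n w - c * R n w)\<^sup>2) + 2 * (c\<^sup>2 * E (\<lambda>w. (R n w - Y' w)\<^sup>2)))
        \<longlonglongrightarrow> 2 * 0 + 2 * (c\<^sup>2 * 0)"
      by (intro tendsto_intros XR RY)
    then show "(\<lambda>n. 2 * E (\<lambda>w. (X n w - c * R n w)\<^sup>2) + 2 * (c\<^sup>2 * E (\<lambda>w. (R n w - Y' w)\<^sup>2)))
        \<longlonglongrightarrow> 0" by simp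
  qed (use le in auto)
  moreover have "integrable (completion M) (\<lambda>w. (X n w)\<^sup>2)" for n
    using sq[OF X, of n] by (subst integrable_completion) auto
  moreover have "integrable (completion M) (\<lambda>w. (c * Y w)\<^sup>2)"
  proof (rule integrable_cong_AE_imp)
    show "integrable (completion M) (\<lambda>w. (c * Y' w)\<^sup>2)" using cY by (subst integrable_completion) auto
    show "(\<lambda>w. (c * Y w)\<^sup>2) \<in> borel_measurable (completion M)" by (intro borel_measurable_power Yc)
    show "AE w in completion M. (c * Y' w)\<^sup>2 = (c * Y w)\<^sup>2"
      by (rule AE_completion) (use YY' in eventually_elim, simp)
  qed
  ultimately show ?thesis unfolding tendsto_L2_def in_L2_def eq using Xc Yc by blast
qed

text \<open>The exceptional set of an almost everywhere identity on the product need not be measurable in the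
  product, so it is enlarged to a measurable null set before the order of the two quantifiers is exchanged.\<close>

lemma (in prob_space) measurable_process_version:
  assumes "measurable_process M B"
  obtains B' where "(\<lambda>(w, u). B' u w) \<in> borel_measurable (M \<Otimes>\<^sub>M unif01)"
    "AE w in M. AE u in unif01. B u w = B' u w"
    "AE u in unif01. AE w in M. B u w = B' u w"
proof -
  interpret L: prob_space unif01 by (rule prob_space_unif01)
  interpret P: pair_prob_space M unif01 ..
  have "(\<lambda>(w, u). B u w) \<in> borel_measurable (completion (M \<Otimes>\<^sub>M unif01))"
    using assms by (simp add: measurable_process_def unif01_def)
  from completion_ex_borel_measurable_real[OF this] obtain g
    where g: "g \<in> borel_measurable (M \<Otimes>\<^sub>M unif01)" "AE x in M \<Otimes>\<^sub>M unif01. (case x of (w, u) \<Rightarrow> B u w) = g x"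
    by blast
  from g(2) obtain N where N: "N \<in> sets (M \<Otimes>\<^sub>M unif01)" "emeasure (M \<Otimes>\<^sub>M unif01) N = 0"
     "{x \<in> space (M \<Otimes>\<^sub>M unif01). \<not> (case x of (w, u) \<Rightarrow> B u w) = g x} \<subseteq> N"
    by (rule AE_E)
  have *: "B u w = g (w, u)" if "(w, u) \<notin> N" "w \<in> space M" "u \<in> {0..1}" for w u
  proof (rule ccontr)
    assume "B u w \<noteq> g (w, u)"
    then have "(w, u) \<in> {x \<in> space (M \<Otimes>\<^sub>M unif01). \<not> (case x of (w, u) \<Rightarrow> B u w) = g x}"
      using that by (simp add: space_pair_measure)
    then show False using subsetD[OF N(3)] that(1) by blast
  qed
  have NN: "AE x in M \<Otimes>\<^sub>M unif01. x \<notin> N" using N by (intro AE_not_in) (auto simp: null_sets_def)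
  have A1: "AE w in M. AE u in unif01. (w, u) \<notin> N" by (rule P.AE_pair[OF NN])
  have "{x \<in> space (M \<Otimes>\<^sub>M unif01). (fst x, snd x) \<notin> N} = space (M \<Otimes>\<^sub>M unif01) - N" by auto
  also have "\<dots> \<in> sets (M \<Otimes>\<^sub>M unif01)" using N(1) by blast
  finally have m: "{x \<in> space (M \<Otimes>\<^sub>M unif01). (fst x, snd x) \<notin> N} \<in> sets (M \<Otimes>\<^sub>M unif01)" .
  have A2: "AE u in unif01. AE w in M. (w, u) \<notin> N"
    using A1 P.AE_commute[OF m] by simp
  show thesis
  proof (rule that[of "\<lambda>u w. g (w, u)"])
    show "(\<lambda>(w, u). g (w, u)) \<in> borel_measurable (M \<Otimes>\<^sub>M unif01)" using g(1) by simp
    show "AE w in M. AE u in unif01. B u w = g (w, u)"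
      using A1 AE_space
    proof eventually_elim
      case (elim w)
      from elim(1) AE_space show ?case by eventually_elim (use * elim(2) in auto)
    qed
    show "AE u in unif01. AE w in M. B u w = g (w, u)"
      using A2 AE_space
    proof eventually_elim
      case (elim u)
      from elim(1) AE_space show ?case by eventually_elim (use * elim(2) in auto)
    qed
  qed
qed

context rough_fbm
begin

lemma tendsto_L2_integral:
  assumes mp: "measurable_process M B" and g: "continuous_on UNIV g"
    and mom: "\<And>t. t \<in> {0..1} \<Longrightarrow> all_moments M (\<lambda>w. g (B t w))"
    and g2: "\<And>t. t \<in> {0..1} \<Longrightarrow> E (\<lambda>w. (g (B t w))\<^sup>2) \<le> C"
    and g4: "\<And>t. t \<in> {0..1} \<Longrightarrow> E (\<lambda>w. (g (B t w)) ^ 4) \<le> C"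
    and X: "\<And>n. all_moments M (X n)"
    and XR: "(\<lambda>n. E (\<lambda>w. (X n w - c * riemann_sum g n w)\<^sup>2)) \<longlonglongrightarrow> 0"
  shows "tendsto_L2 M X (\<lambda>w. c * (LINT u:{0..1}|lebesgue. g (B u w)))"
proof -
  obtain B' where B': "(\<lambda>(w, u). B' u w) \<in> borel_measurable (M \<Otimes>\<^sub>M unif01)"
    "AE w in M. AE u in unif01. B u w = B' u w"
    "AE u in unif01. AE w in M. B u w = B' u w"
    using measurable_process_version[OF mp] by blast
  have Bam: "all_moments M (B t)" if "t \<in> {0..1}" for t using all_moments_span[OF B_in_span[OF that]] .
  have gm[measurable]: "g \<in> borel_measurable borel" using g by (rule borel_measurable_continuous_onI)
  have B2: "E (\<lambda>w. (B t w)\<^sup>2) \<le> max C 1" if "t \<in> {0..1}" for t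
  proof -
    have "E (\<lambda>w. (B t w)\<^sup>2) = apow (2 * H) t" using cov[OF that that] by (simp add: power2_eq_square)
    also have "\<dots> \<le> 1" using that H_pos powr_mono2[of "2 * H" t 1] by (simp add: apow_def)
    finally show ?thesis by simp
  qed
  have lim: "(apow (2 * H) \<longlongrightarrow> 0) (at_right 0)"
  proof -
    have "((\<lambda>x::real. \<bar>x\<bar> powr (2 * H)) \<longlongrightarrow> \<bar>0\<bar> powr (2 * H)) (at_right 0)"
      by (intro tendsto_powr' tendsto_intros) (use H_pos in auto)
    then show ?thesis by (simp add: apow_def[abs_def])
  qed
  have ucont: "\<exists>\<eta>>0. \<forall>s\<in>{0..1}. \<forall>t\<in>{0..1}. \<bar>s - t\<bar> < \<eta> \<longrightarrow>
       integrable M (\<lambda>w. (g (B s w) - g (B t w))\<^sup>2) \<and> E (\<lambda>w. (g (B s w) - g (B t w))\<^sup>2) \<le> \<epsilon>"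
    if \<epsilon>: "\<epsilon> > 0" for \<epsilon>
  proof -
    obtain \<eta> where \<eta>: "\<eta> > 0" "\<And>s t. s \<in> {0..1} \<Longrightarrow> t \<in> {0..1} \<Longrightarrow> \<bar>s - t\<bar> < \<eta> \<Longrightarrow>
        E (\<lambda>w. (g (B s w) - g (B t w))\<^sup>2) \<le> \<epsilon>"
    proof (rule composition_uniformly_L2_continuous[where B=B and T="{0..1}" and C="max C 1" and \<rho>="apow (2 * H)", OF g Bam mom B2])
      show "E (\<lambda>w. (g (B t w)) ^ 4) \<le> max C 1" if "t \<in> {0..1}" for t using g4[OF that] by simp
      show "E (\<lambda>w. (B s w - B t w)\<^sup>2) \<le> apow (2 * H) \<bar>s - t\<bar>" if "s \<in> {0..1}" "t \<in> {0..1}" for s t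
        using B_diff_variance[OF that] by simp
    qed (use lim \<epsilon> in auto)
    have "integrable M (\<lambda>w. (g (B s w) - g (B t w))\<^sup>2)" if "s \<in> {0..1}" "t \<in> {0..1}" for s t
      using all_moments_integrable[OF all_moments_power[OF all_moments_diff[OF mom[OF that(1)] mom[OF that(2)]]]] .
    then show ?thesis using \<eta> by blast
  qed
  have g2i: "integrable M (\<lambda>w. (g (B t w))\<^sup>2)" if "t \<in> {0..1}" for t
    by (rule all_moments_integrable[OF all_moments_power[OF mom[OF that]]])
  note riem = riemann_sums_tendsto_L2[OF g all_moments_measurable[OF Bam] B'(1,3) g2i g2 ucont]
  show ?thesis
  proof (rule tendsto_L2_via_approximation[OF X _ riem(1,2) _ XR riem(3)])
    show "all_moments M (\<lambda>w. riemann_sum g n w)" for n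
    proof -
      have "all_moments M (\<lambda>w. (1 / real n) * (\<Sum>k<n. g (Bn n k w)))"
        by (intro all_moments_cmult all_moments_sum mom grid) auto
      then show ?thesis by simp
    qed
    show "AE w in M. (LINT u|unif01. g (B' u w)) = (LINT u:{0..1}|lebesgue. g (B u w))"
      using B'(2) AE_space
    proof eventually_elim
      case (elim w)
      have "(\<lambda>u. B' u w) \<in> borel_measurable unif01"
        using measurable_Pair2[OF B'(1) elim(2)] by simp
      then have m: "(\<lambda>u. g (B' u w)) \<in> borel_measurable unif01" by (rule measurable_compose[OF _ gm])
      show ?case
        by (rule lebesgue_integral_unif01[symmetric, OF m]) (use elim(1) in eventually_elim, simp)
    qed
  qed
qed

section \<open>Weighted quadratic and cubic variations\<close>

lemma comp_sum_square:
  assumes h: "controlled (2 * q) h C" and q: "q \<ge> 1" and n: "n > 0"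
  shows "E (\<lambda>w. (c * comp_sum q h n w)\<^sup>2) \<le>
     c\<^sup>2 * (8 * real q ^ 2 * ((2 * real (2 * q) + 2) ^ (2 * q) * C) * real n * (\<delta>n n) ^ q)"
  using mult_left_mono[OF comp_sum_variance[OF q h n], of "c\<^sup>2"] by (simp add: power_mult_distrib)

lemma all_moments_grid:
  assumes h: "controlled N h C" and "i \<le> N" "k < n"
  shows "all_moments M (\<lambda>w. h i (Bn n k w))"
  using assms grid[of k n] unfolding controlled_def by auto

text \<open>With \<open>a = n\<^sup>H\<close>, the difference is \<open>a\<^sup>4 / n\<close> times the compensated sum for \<open>q = 2\<close>, whose second moment is of
  order \<open>n a\<^sup>-\<^sup>4\<close>; this leaves \<open>n\<^sup>4\<^sup>H\<^sup>-\<^sup>1\<close>.\<close>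

lemma quadratic_variation:
  assumes h: "controlled 4 h C" and H: "H < 1 / 4"
  defines "X \<equiv> \<lambda>n w. real n powr (2 * H - 1) * (\<Sum>k<n. h 0 (Bn n k w) *
                    (real n powr (2 * H) * (dB n k w)\<^sup>2 - 1))"
  shows "all_moments M (X n)"
    and "(\<lambda>n. E (\<lambda>w. (X n w - 1 / 4 * riemann_sum (h 2) n w)\<^sup>2)) \<longlonglongrightarrow> 0"
proof -
  let ?D = "\<lambda>n w. X n w - 1 / 4 * riemann_sum (h 2) n w"
  show "all_moments M (X n)" unfolding X_def
  proof (intro all_moments_cmult all_moments_sum all_moments_mult all_moments_diff all_moments_const all_moments_power)
    fix k assume "k \<in> {..<n}"
    then show "all_moments M (\<lambda>w. h 0 (Bn n k w))" "all_moments M (dB n k)"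
      using all_moments_grid[OF h] increment_in_span all_moments_span by auto
  qed
  define A where "A = 8 * real 2 ^ 2 * ((2 * real (2 * 2) + 2) ^ (2 * 2) * C)"
  have bound: "E (\<lambda>w. (?D n w)\<^sup>2) \<le> A * real n powr (4 * H - 1)"
    if n: "n > 0" for n
  proof -
    define a where "a = real n powr H"
    have a: "a > 0" using n by (simp add: a_def)
    have pw: "a ^ m = real n powr (real m * H)" for m
      unfolding a_def using n by (simp add: powr_power mult.commute)
    have p: "real n powr (2 * H) = a\<^sup>2" "real n powr (2 * H - 1) = a\<^sup>2 / real n" "\<delta>n n = 1 / a\<^sup>2"
      "real n powr (4 * H - 1) = a ^ 4 / real n"
      using n by (simp_all add: pw powr_diff powr_minus divide_inverse flip: a_def)
    have "?D n w = a ^ 4 / real n * comp_sum 2 h n w" for w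
    proof -
      have he: "hermite (1 / a\<^sup>2) 2 u = u\<^sup>2 - 1 / a\<^sup>2" for u by (simp add: numeral_2_eq_2)
      have "?D n w =
         (\<Sum>k<n. a\<^sup>2 / real n * (h 0 (Bn n k w) * (a\<^sup>2 * (dB n k w)\<^sup>2 - 1)) - 1 / 4 * (h 2 (Bn n k w) / real n))"
        unfolding X_def p by (simp only: sum_subtractf sum_distrib_left sum_divide_distrib)
      also have "\<dots> = (\<Sum>k<n. a ^ 4 / real n * (h 0 (Bn n k w) * hermite (1 / a\<^sup>2) 2 (dB n k w) - (- (1 / a\<^sup>2) / 2) ^ 2 * h 2 (Bn n k w)))"
        unfolding he using a n by (intro sum.cong refl) (simp add: field_simps power2_eq_square power4_eq_xxxx)
      finally show ?thesis unfolding comp_sum_def p sum_distrib_left .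
    qed
    then have "E (\<lambda>w. (?D n w)\<^sup>2) =
       E (\<lambda>w. (a ^ 4 / real n * comp_sum 2 h n w)\<^sup>2)" by simp
    also have "\<dots> \<le> (a ^ 4 / real n)\<^sup>2 * (A * real n * (1 / a\<^sup>2)\<^sup>2)"
      using comp_sum_square[of 2 h C n "a ^ 4 / real n"] h n unfolding A_def p by simp
    also have "\<dots> = A * real n powr (4 * H - 1)"
      unfolding p using a n by (simp add: field_simps eval_nat_numeral)
    finally show ?thesis .
  qed
  show "(\<lambda>n. E (\<lambda>w. (?D n w)\<^sup>2)) \<longlonglongrightarrow> 0"
  proof (rule tendsto_sandwich[OF _ _ tendsto_const])
    have "(\<lambda>n. real n powr (4 * H - 1)) \<longlonglongrightarrow> 0"
      using H by (intro tendsto_neg_powr filterlim_real_sequentially) auto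
    from tendsto_mult_left[OF this, of A] show "(\<lambda>n. A * real n powr (4 * H - 1)) \<longlonglongrightarrow> 0" by simp
    show "\<forall>\<^sub>F n in sequentially. E (\<lambda>w. (?D n w)\<^sup>2) \<le> A * real n powr (4 * H - 1)"
      using eventually_gt_at_top[of 0] by eventually_elim (rule bound)
  qed simp
qed

text \<open>With \<open>a = n\<^sup>H\<close>, the identity \<open>U\<^sup>3 = H\<^sub>3(U) + 3 U / a\<^sup>2\<close> splits the difference into \<open>a\<^sup>6 / n\<close> times the
  compensated sum for \<open>q = 3\<close> and \<open>3 a\<^sup>4 / n\<close> times the one for \<open>q = 1\<close>. Both parts have a second moment of order \<open>n\<^sup>6\<^sup>H\<^sup>-\<^sup>1\<close>.\<close>

lemma cubic_variation:
  assumes h: "controlled 6 h C" and H: "H < 1 / 6"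
  defines "X \<equiv> \<lambda>n w. real n powr (3 * H - 1) * (\<Sum>k<n. h 0 (Bn n k w) * real n powr (3 * H) * (dB n k w) ^ 3
                    + 3 / 2 * h 1 (Bn n k w) * real n powr (- H))"
  shows "all_moments M (X n)"
    and "(\<lambda>n. E (\<lambda>w. (X n w - (- (1 / 8)) * riemann_sum (h 3) n w)\<^sup>2)) \<longlonglongrightarrow> 0"
proof -
  let ?D = "\<lambda>n w. X n w - (- (1 / 8)) * riemann_sum (h 3) n w"
  show "all_moments M (X n)" unfolding X_def
  proof (intro all_moments_cmult all_moments_sum all_moments_add all_moments_mult all_moments_const all_moments_power)
    fix k assume "k \<in> {..<n}"
    then show "all_moments M (\<lambda>w. h 0 (Bn n k w))" "all_moments M (\<lambda>w. h 1 (Bn n k w))" "all_moments M (dB n k)"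
      using all_moments_grid[OF h] increment_in_span all_moments_span by auto
  qed
  define A3 where "A3 = 8 * real 3 ^ 2 * ((2 * real (2 * 3) + 2) ^ (2 * 3) * C)"
  define A1 where "A1 = 8 * real 1 ^ 2 * ((2 * real (2 * 1) + 2) ^ (2 * 1) * C)"
  have h1: "controlled 2 h C" by (rule controlled_mono[OF h]) simp
  have bound: "E (\<lambda>w. (?D n w)\<^sup>2) \<le> (2 * A3 + 18 * A1) * real n powr (6 * H - 1)"
    if n: "n > 0" for n
  proof -
    define a where "a = real n powr H"
    have a: "a > 0" using n by (simp add: a_def)
    have pw: "a ^ m = real n powr (real m * H)" for m
      unfolding a_def using n by (simp add: powr_power mult.commute)
    have p: "real n powr (3 * H) = a ^ 3" "real n powr (3 * H - 1) = a ^ 3 / real n" "\<delta>n n = 1 / a\<^sup>2"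
      "real n powr (6 * H - 1) = a ^ 6 / real n" "real n powr (- H) = 1 / a"
      using n by (simp_all add: pw powr_diff powr_minus divide_inverse flip: a_def)
    have "?D n w =
       a ^ 6 / real n * comp_sum 3 h n w + 3 * a ^ 4 / real n * comp_sum 1 h n w" for w
    proof -
      have he: "hermite (1 / a\<^sup>2) 3 u = u ^ 3 - 3 * u / a\<^sup>2" "hermite (1 / a\<^sup>2) 1 u = u" for u
        by (simp_all add: eval_nat_numeral field_simps)
      have "?D n w =
         (\<Sum>k<n. a ^ 3 / real n * (h 0 (Bn n k w) * a ^ 3 * (dB n k w) ^ 3 + 3 / 2 * h 1 (Bn n k w) * (1 / a))
           - (- (1 / 8)) * (h 3 (Bn n k w) / real n))"
        unfolding X_def p by (simp only: sum_subtractf sum_distrib_left sum_divide_distrib)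
      also have "\<dots> = (\<Sum>k<n. a ^ 6 / real n * (h 0 (Bn n k w) * hermite (1 / a\<^sup>2) 3 (dB n k w) - (- (1 / a\<^sup>2) / 2) ^ 3 * h 3 (Bn n k w))
         + 3 * a ^ 4 / real n * (h 0 (Bn n k w) * hermite (1 / a\<^sup>2) 1 (dB n k w) - (- (1 / a\<^sup>2) / 2) ^ 1 * h 1 (Bn n k w)))"
        unfolding he using a n by (intro sum.cong refl) (simp add: field_simps eval_nat_numeral)
      finally show ?thesis unfolding comp_sum_def p sum_distrib_left sum.distrib .
    qed
    then have "E (\<lambda>w. (?D n w)\<^sup>2) =
       E (\<lambda>w. (a ^ 6 / real n * comp_sum 3 h n w + 3 * a ^ 4 / real n * comp_sum 1 h n w)\<^sup>2)" by simp
    also have "\<dots> \<le> 2 * E (\<lambda>w. (a ^ 6 / real n * comp_sum 3 h n w)\<^sup>2) + 2 * E (\<lambda>w. (3 * a ^ 4 / real n * comp_sum 1 h n w)\<^sup>2)"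
      by (intro integral_square_triangle(2) all_moments_integrable all_moments_power all_moments_measurable
          all_moments_cmult all_moments_comp_sum[OF h]) simp_all
    also have "\<dots> \<le> 2 * ((a ^ 6 / real n)\<^sup>2 * (A3 * real n * (1 / a\<^sup>2) ^ 3)) + 2 * ((3 * a ^ 4 / real n)\<^sup>2 * (A1 * real n * (1 / a\<^sup>2) ^ 1))"
      using comp_sum_square[of 3 h C n "a ^ 6 / real n"] comp_sum_square[of 1 h C n "3 * a ^ 4 / real n"] h h1 n
      unfolding A3_def A1_def p by simp
    also have "\<dots> = (2 * A3 + 18 * A1) * real n powr (6 * H - 1)"
      unfolding p using a n by (simp add: field_simps eval_nat_numeral)
    finally show ?thesis .
  qed
  show "(\<lambda>n. E (\<lambda>w. (?D n w)\<^sup>2)) \<longlonglongrightarrow> 0"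
  proof (rule tendsto_sandwich[OF _ _ tendsto_const])
    have "(\<lambda>n. real n powr (6 * H - 1)) \<longlonglongrightarrow> 0"
      using H by (intro tendsto_neg_powr filterlim_real_sequentially) auto
    from tendsto_mult_left[OF this, of "2 * A3 + 18 * A1"] show "(\<lambda>n. (2 * A3 + 18 * A1) * real n powr (6 * H - 1)) \<longlonglongrightarrow> 0" by simp
    show "\<forall>\<^sub>F n in sequentially. E (\<lambda>w. (?D n w)\<^sup>2) \<le> (2 * A3 + 18 * A1) * real n powr (6 * H - 1)"
      using eventually_gt_at_top[of 0] by eventually_elim (rule bound)
  qed simp
qed

lemma tendsto_L2_integral_of_derivative:
  assumes mp: "measurable_process M B" and h: "controlled N h C" and i: "i \<le> N"
    and X: "\<And>n. all_moments M (X n)"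
    and XR: "(\<lambda>n. E (\<lambda>w. (X n w - c * riemann_sum (h i) n w)\<^sup>2)) \<longlonglongrightarrow> 0"
  shows "tendsto_L2 M X (\<lambda>w. c * (LINT u:{0..1}|lebesgue. h i (B u w)))"
  by (rule tendsto_L2_integral[OF mp _ _ _ _ X XR, where C = C]) (use h i in \<open>auto simp: controlled_def\<close>)

end

theorem theorem1p1:
  fixes M :: "'a measure" and B :: "real \<Rightarrow> 'a \<Rightarrow> real" and H :: real
  assumes "prob_space M"
    and "fractional_brownian_motion M H B"
    and "measurable_process M B"
  shows "(\<forall>h :: real \<Rightarrow> real. cond_H M B 4 h \<and> 0 < H \<and> H < 1 / 4 \<longrightarrow>
            tendsto_L2 M
              (\<lambda>n \<omega>. real n powr (2 * H - 1) *
                 (\<Sum>k<n. h (B (real k / real n) \<omega>) *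
                    (real n powr (2 * H) * (increment B n k \<omega>)\<^sup>2 - 1)))
              (\<lambda>\<omega>. 1 / 4 * (LINT u:{0..1}|lebesgue. (deriv ^^ 2) h (B u \<omega>)))) \<and>
         (\<forall>h :: real \<Rightarrow> real. cond_H M B 6 h \<and> 0 < H \<and> H < 1 / 6 \<longrightarrow>
            tendsto_L2 M
              (\<lambda>n \<omega>. real n powr (3 * H - 1) *
                 (\<Sum>k<n. h (B (real k / real n) \<omega>) * real n powr (3 * H) * (increment B n k \<omega>) ^ 3
                    + 3 / 2 * deriv h (B (real k / real n) \<omega>) * real n powr (- H)))
              (\<lambda>\<omega>. - (1 / 8) * (LINT u:{0..1}|lebesgue. (deriv ^^ 3) h (B u \<omega>))))"
proof (intro conjI allI impI)
  fix h :: "real \<Rightarrow> real" assume h: "cond_H M B 4 h \<and> 0 < H \<and> H < 1 / 4"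
  interpret prob_space M by (rule assms)
  interpret rough_fbm M H B by unfold_locales (use assms h in auto)
  obtain C where C: "controlled 4 (\<lambda>i. (deriv ^^ i) h) C"
    using cond_H_controlled h by blast
  note q = quadratic_variation[OF C, simplified funpow_0]
  show "tendsto_L2 M
              (\<lambda>n \<omega>. real n powr (2 * H - 1) *
                 (\<Sum>k<n. h (B (real k / real n) \<omega>) *
                    (real n powr (2 * H) * (increment B n k \<omega>)\<^sup>2 - 1)))
              (\<lambda>\<omega>. 1 / 4 * (LINT u:{0..1}|lebesgue. (deriv ^^ 2) h (B u \<omega>)))"
    by (rule tendsto_L2_integral_of_derivative[OF assms(3) C, of 2]) (use q h in auto)
next
  fix h :: "real \<Rightarrow> real" assume h: "cond_H M B 6 h \<and> 0 < H \<and> H < 1 / 6"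
  interpret prob_space M by (rule assms)
  interpret rough_fbm M H B by unfold_locales (use assms h in auto)
  obtain C where C: "controlled 6 (\<lambda>i. (deriv ^^ i) h) C"
    using cond_H_controlled h by blast
  have 1: "(deriv ^^ 1) h = deriv h" by simp
  note c = cubic_variation[OF C, unfolded funpow_0 1]
  show "tendsto_L2 M
              (\<lambda>n \<omega>. real n powr (3 * H - 1) *
                 (\<Sum>k<n. h (B (real k / real n) \<omega>) * real n powr (3 * H) * (increment B n k \<omega>) ^ 3
                    + 3 / 2 * deriv h (B (real k / real n) \<omega>) * real n powr (- H)))
              (\<lambda>\<omega>. - (1 / 8) * (LINT u:{0..1}|lebesgue. (deriv ^^ 3) h (B u \<omega>)))"
    by (rule tendsto_L2_integral_of_derivative[OF assms(3) C, of 3]) (use c h in auto)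
qed

end
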